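(* Let $\mathcal{S}$ be a class of $(\vee,0)$-semilattices closed under finite products and directed unions, let $I$ be a poset, let $\vec\kappa=(\kappa_i)_{i\in I}$ be a family of cardinal numbers, let $(U,|\cdot|)$ be a $\vec\kappa$-compatible norm-covering of $I$, and let $\mathcal{V}$ be a class of algebras of the same similarity type. Let $J$ be a small category. Suppose that $\mathcal{V}$ is closed under homomorphic images and is $\big(\mathrm{Id}_e(U,|\cdot|)^{=},\,J,\,(\kappa_{|\boldsymbol u|})_{\boldsymbol u\in \mathrm{Id}_e(U,|\cdot|)^{=}}\big)$-L\"owenheim-Skolem. Let $\mathcal{D}\colon J\to\mathcal{S}^I$ be a functor, written $\mathcal{D}(j)=(D_i^j,\phi_{i,i'}^j)_{i\le i'\text{ in }I}$ for $j\in\mathrm{Ob}\,J$, and let $(\vec\tau,\mathcal{A})$ be a $U$-quasi-lifting of $\mathcal{D}$ in $\mathcal{V}$. If $\sum_{j\in\mathrm{Ob}\,J}\mathrm{card}\,D_i^j<\kappa_i$ for all $i\in I$, then there exists a lifting in $\mathcal{V}$ of the diagram $\widehat{\mathcal{D}}\colon I\times J\to\mathcal{S}$ associated to $\mathcal{D}$.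
   Context: Congruences and liftings. For an algebra $A$, $\mathrm{Con}\,A$ is its congruence lattice and $\mathrm{Con_c}A$ the $(\vee,0)$-semilattice of its compact (finitely generated) congruences; $\mathrm{Con}\,A$ is identified with the ideal lattice of $\mathrm{Con_c}A$. For a homomorphism $f\colon A\to B$, $\mathrm{Con}\,f$ sends $\alpha$ to the congruence of $B$ generated by $\{(f(x),f(y)):(x,y)\in\alpha\}$, and $\mathrm{Con_c}f$ is its restriction $\mathrm{Con_c}A\to\mathrm{Con_c}B$; this makes $\mathrm{Con_c}$ a functor. Classes of algebras are viewed as categories with all homomorphisms ($(\vee,0)$-homomorphisms for $\mathcal S$); posets are viewed as categories. A lifting in $\mathcal V$ of a functor $\mathcal E\colon K\to\mathcal S$ is a functor $\mathcal B\colon K\to\mathcal V$ with $\mathrm{Con_c}\circ\mathcal B$ naturally isomorphic to $\mathcal E$. $\mathcal S^I$ is the category of functors $I\to\mathcal S$ and natural transformations. For $\mathcal D\colon J\to\mathcal S^I$, $\widehat{\mathcal D}\colon I\times J\to\mathcal S$ is given by $\widehat{\mathcal D}(i,j)=\mathcal D(j)(i)$ and $\widehat{\mathcal D}(i\le i',g\colon j\to j')=\mathcal D(g)_{i'}\circ\mathcal D(j)(i\le i')$. Norm-coverings. An ideal of a poset is a nonempty, upward directed, lower subset. For a poset $P$, $P^{=}$ is the set of non-maximal elements of $P$. A finite subset $V$ of a poset $U$ is a kernel if for every $u\in U$ there is a largest $v\in V$ with $v\le u$, denoted $V\cdot u$. For a kernel $V$ and an ideal $\boldsymbol u$ of $U$,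 $V\cdot\boldsymbol u$ denotes the largest element of $V\cap\boldsymbol u$. $U$ is supported if every finite subset of $U$ is contained in a kernel of $U$. A norm-covering of $I$ is a pair $(U,|\cdot|)$ with $U$ a supported poset and $|\cdot|\colon U\to I$ order-preserving. A sharp ideal is an ideal $\boldsymbol u$ of $U$ such that $\{|v|:v\in\boldsymbol u\}$ has a largest element, denoted $|\boldsymbol u|$. A sharp ideal $\boldsymbol u$ is extreme if there is no sharp ideal $\boldsymbol v\supsetneq\boldsymbol u$ with $|\boldsymbol v|=|\boldsymbol u|$. $\mathrm{Id}_e(U,|\cdot|)$ is the set of extreme ideals, ordered by inclusion. $(U,|\cdot|)$ is $\vec\kappa$-compatible if for every order-preserving map $F\colon\mathrm{Id}_e(U,|\cdot|)\to\mathfrak P(U)$ (the powerset of $U$) with $\mathrm{card}\,F(\boldsymbol u)<\kappa_{|\boldsymbol u|}$ for all $\boldsymbol u\in\mathrm{Id}_e(U,|\cdot|)^{=}$, there is an order-preserving $\sigma\colon I\to\mathrm{Id}_e(U,|\cdot|)$ such that $|\sigma(i)|=i$ for all $i\in I$ and $F(\sigma(i))\cap\sigma(j)\subseteq\sigma(i)$ for all $i\le j$ in $I$. Condensates. For $\vec D=(D_i,\phi_{i,j})_{i\le j\text{ in }I}$ in $\mathcal S^I$, a support of $a\in\prod_{u\in U}D_{|u|}$ is a kernel $V$ of $U$ with $a_u=\phi_{|V\cdot u|,|u|}(a_{V\cdot u})$ for all $u\in U$. The condensate $\mathrm{Cond}(\vec D,U)$ is the subsemilattice of $\prod_{u\in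 U}D_{|u|}$ of all elements having a support. For $\vec\psi=(\psi_i)_{i\in I}\colon\vec C\to\vec D$ in $\mathcal S^I$, $\mathrm{Cond}(\vec\psi,U)\colon (a_u)_{u}\mapsto(\psi_{|u|}(a_u))_{u}$; this makes $\mathrm{Cond}(-,U)$ a functor. For a sharp ideal $\boldsymbol u$, $\pi_{\boldsymbol u}^{\vec D}\colon\mathrm{Cond}(\vec D,U)\to D_{|\boldsymbol u|}$ sends $a$ to $\phi_{|V\cdot\boldsymbol u|,|\boldsymbol u|}(a_{V\cdot\boldsymbol u})$, for any support $V$ of $a$ (independent of $V$), and $\theta_{\boldsymbol u}^{\vec D}=\{a\in\mathrm{Cond}(\vec D,U):\pi_{\boldsymbol u}^{\vec D}(a)=0\}$, an ideal of $\mathrm{Cond}(\vec D,U)$. Quasi-liftings. A $U$-quasi-lifting of $\vec D\in\mathcal S^I$ in $\mathcal V$ is a pair $(\tau,T)$ with $T\in\mathcal V$ and $\tau\colon\mathrm{Con_c}T\to\mathrm{Cond}(\vec D,U)$ a $(\vee,0)$-homomorphism such that for every $\boldsymbol u\in\mathrm{Id}_e(U,|\cdot|)$, putting $\alpha_{\boldsymbol u}=\bigvee\{\beta\in\mathrm{Con_c}T:\tau(\beta)\in\theta_{\boldsymbol u}^{\vec D}\}$, the map $\beta\mapsto\mathrm{Id}(\tau)(\beta)\vee\theta_{\boldsymbol u}^{\vec D}$ is an isomorphism from $\{\beta\in\mathrm{Con}\,T:\beta\ge\alpha_{\boldsymbol u}\}$ onto the lattice of ideals of $\mathrm{Cond}(\vec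 D,U)$ containing $\theta_{\boldsymbol u}^{\vec D}$ (here $\mathrm{Id}(\tau)$ sends an ideal to the ideal generated by its image under $\tau$). A $U$-quasi-lifting of a functor $\mathcal D\colon J\to\mathcal S^I$ in $\mathcal V$ is a pair $(\vec\tau,\mathcal A)$ with $\mathcal A\colon J\to\mathcal V$ a functor and $\vec\tau=(\tau^j)_{j\in\mathrm{Ob}\,J}\colon\mathrm{Con_c}\circ\mathcal A\to\mathrm{Cond}(\mathcal D(-),U)$ a natural transformation such that $(\tau^j,\mathcal A(j))$ is a $U$-quasi-lifting of $\mathcal D(j)$ for all $j$. L\"owenheim-Skolem property. For a poset $P$, a small category $J$ and a family $(\lambda_u)_{u\in P}$ of cardinals, $\mathcal V$ is $(P,J,(\lambda_u)_{u\in P})$-L\"owenheim-Skolem if for every functor $\mathcal A\colon J\to\mathcal V$ and every family $(\alpha_u^j)_{u\in P}^{j\in\mathrm{Ob}\,J}$ with $\alpha_u^j\in\mathrm{Con}\,\mathcal A(j)$ and $\sum_{j\in\mathrm{Ob}\,J}\mathrm{card}\,\mathrm{Con_c}(\mathcal A(j)/\alpha_u^j)<\lambda_u$ for all $u\in P$, there is a family $(B_u^j)_{u\in P}^{j\in\mathrm{Ob}\,J}$ such that: (1) $B_u^j$ is a subalgebra of $\mathcal A(j)$; (2) $B_u^j/\alpha_u^j\in\mathcal V$, where $B_u^j/\alpha_u^j$ denotes the quotient of $B_u^j$ by the restriction of $\alpha_u^j$; (3) $B_u^j\subseteq B_v^j$ for all $u\le v$ in $P$; (4) $\mathcal A(f)(B_u^j)\subseteq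 B_u^k$ for every morphism $f\colon j\to k$ in $J$; (5) $\mathrm{Con}(q_u^j)$ is an isomorphism, where $q_u^j\colon B_u^j/\alpha_u^j\hookrightarrow\mathcal A(j)/\alpha_u^j$ is the canonical embedding; (6) $\sum_{j\in\mathrm{Ob}\,J}\mathrm{card}\,B_u^j<\lambda_u$ for all $u\in P$.
   Formalization: The cardinals κ_{|u|} are additionally assumed infinite for every non-maximal extreme ideal u of U; for finite cardinals the statement is false (e.g. I={0<1}, κ_0=3, κ_1=6, algebras without operations). *)

theory Defs
  imports "HOL-Algebra.Lattice"
begin

unbundle cardinal_syntax

section \<open>Categories and functors\<close>

text \<open>
  Categories are given by hom-sets. Composition takes the three objects involved, so that
  \<open>Cmp C x y z g f\<close> is the composite of \<open>f : x \<rightarrow> y\<close> and \<open>g : y \<rightarrow> z\<close>.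
\<close>

record ('o, 'h) cat =
  Ob :: "'o set"
  Hom :: "'o \<Rightarrow> 'o \<Rightarrow> 'h set"
  Idm :: "'o \<Rightarrow> 'h"
  Cmp :: "'o \<Rightarrow> 'o \<Rightarrow> 'o \<Rightarrow> 'h \<Rightarrow> 'h \<Rightarrow> 'h"

locale category =
  fixes C :: "('o, 'h) cat"
  assumes Idm_in_Hom: "x \<in> Ob C \<Longrightarrow> Idm C x \<in> Hom C x x"
    and Cmp_in_Hom: "\<lbrakk>x \<in> Ob C; y \<in> Ob C; z \<in> Ob C; f \<in> Hom C x y; g \<in> Hom C y z\<rbrakk>
      \<Longrightarrow> Cmp C x y z g f \<in> Hom C x z"
    and Cmp_Idm_right: "\<lbrakk>x \<in> Ob C; y \<in> Ob C; f \<in> Hom C x y\<rbrakk> \<Longrightarrow> Cmp C x x y f (Idm C x) = f"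
    and Cmp_Idm_left: "\<lbrakk>x \<in> Ob C; y \<in> Ob C; f \<in> Hom C x y\<rbrakk> \<Longrightarrow> Cmp C x y y (Idm C y) f = f"
    and Cmp_assoc: "\<lbrakk>w \<in> Ob C; x \<in> Ob C; y \<in> Ob C; z \<in> Ob C;
        f \<in> Hom C w x; g \<in> Hom C x y; h \<in> Hom C y z\<rbrakk>
      \<Longrightarrow> Cmp C w x z (Cmp C x y z h g) f = Cmp C w y z h (Cmp C w x y g f)"

record ('o, 'h, 'p, 'k) fctr =
  fob :: "'o \<Rightarrow> 'p"
  fmor :: "'o \<Rightarrow> 'o \<Rightarrow> 'h \<Rightarrow> 'k"

definition is_functor :: "('o, 'h) cat \<Rightarrow> ('p, 'k) cat \<Rightarrow> ('o, 'h, 'p, 'k) fctr \<Rightarrow> bool" where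
  "is_functor C D F \<longleftrightarrow>
     (\<forall>x\<in>Ob C. fob F x \<in> Ob D) \<and>
     (\<forall>x\<in>Ob C. \<forall>y\<in>Ob C. \<forall>f\<in>Hom C x y. fmor F x y f \<in> Hom D (fob F x) (fob F y)) \<and>
     (\<forall>x\<in>Ob C. fmor F x x (Idm C x) = Idm D (fob F x)) \<and>
     (\<forall>x\<in>Ob C. \<forall>y\<in>Ob C. \<forall>z\<in>Ob C. \<forall>f\<in>Hom C x y. \<forall>g\<in>Hom C y z.
        fmor F x z (Cmp C x y z g f) =
        Cmp D (fob F x) (fob F y) (fob F z) (fmor F y z g) (fmor F x y f))"

text \<open>Functors and natural transformations; the latter are extensional on the objects of \<open>C\<close>.\<close>

definition functor_cat ::
  "('o, 'h) cat \<Rightarrow> ('p, 'k) cat \<Rightarrow> (('o, 'h, 'p, 'k) fctr, 'o \<Rightarrow> 'k) cat" where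
  "functor_cat C D = \<lparr>
     Ob = {F. is_functor C D F},
     Hom = (\<lambda>F G. {\<eta> \<in> extensional (Ob C).
       (\<forall>x\<in>Ob C. \<eta> x \<in> Hom D (fob F x) (fob G x)) \<and>
       (\<forall>x\<in>Ob C. \<forall>y\<in>Ob C. \<forall>f\<in>Hom C x y.
          Cmp D (fob F x) (fob G x) (fob G y) (fmor G x y f) (\<eta> x) =
          Cmp D (fob F x) (fob F y) (fob G y) (\<eta> y) (fmor F x y f))}),
     Idm = (\<lambda>F. \<lambda>x\<in>Ob C. Idm D (fob F x)),
     Cmp = (\<lambda>F G H \<theta> \<eta>. \<lambda>x\<in>Ob C. Cmp D (fob F x) (fob G x) (fob H x) (\<theta> x) (\<eta> x))\<rparr>"

definition poset_cat :: "'i gorder \<Rightarrow> ('i, unit) cat" where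
  "poset_cat I = \<lparr>
     Ob = carrier I,
     Hom = (\<lambda>i j. {_. i \<sqsubseteq>\<^bsub>I\<^esub> j}),
     Idm = (\<lambda>_. ()),
     Cmp = (\<lambda>_ _ _ _ _. ())\<rparr>"

definition prod_cat :: "('o, 'h) cat \<Rightarrow> ('p, 'k) cat \<Rightarrow> ('o \<times> 'p, 'h \<times> 'k) cat" where
  "prod_cat C D = \<lparr>
     Ob = Ob C \<times> Ob D,
     Hom = (\<lambda>(x, y) (x', y'). Hom C x x' \<times> Hom D y y'),
     Idm = (\<lambda>(x, y). (Idm C x, Idm D y)),
     Cmp = (\<lambda>(x, y) (x', y') (x'', y'') (g, h) (f, e). (Cmp C x x' x'' g f, Cmp D y y' y'' h e))\<rparr>"


section \<open>Posets and semilattices\<close>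

abbreviation incl_order :: "'a set set \<Rightarrow> 'a set gorder" where
  "incl_order X \<equiv> \<lparr>carrier = X, eq = (=), le = (\<subseteq>)\<rparr>"

definition order_preserving :: "'a gorder \<Rightarrow> 'b gorder \<Rightarrow> ('a \<Rightarrow> 'b) \<Rightarrow> bool" where
  "order_preserving P Q f \<longleftrightarrow> f \<in> carrier P \<rightarrow> carrier Q \<and> isotone P Q f"

definition order_iso :: "'a gorder \<Rightarrow> 'b gorder \<Rightarrow> ('a \<Rightarrow> 'b) \<Rightarrow> bool" where
  "order_iso P Q f \<longleftrightarrow> bij_betw f (carrier P) (carrier Q) \<and> order_emb P Q f"

definition non_maximal :: "'a gorder \<Rightarrow> 'a gorder" where
  "non_maximal P = P\<lparr>carrier := {x \<in> carrier P. \<exists>y\<in>carrier P. x \<sqsubset>\<^bsub>P\<^esub> y}\<rparr>"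

definition poset_ideal :: "'a gorder \<Rightarrow> 'a set \<Rightarrow> bool" where
  "poset_ideal P X \<longleftrightarrow> X \<subseteq> carrier P \<and> X \<noteq> {} \<and>
     (\<forall>x\<in>X. \<forall>y\<in>X. \<exists>z\<in>X. x \<sqsubseteq>\<^bsub>P\<^esub> z \<and> y \<sqsubseteq>\<^bsub>P\<^esub> z) \<and>
     (\<forall>x\<in>X. \<forall>y\<in>carrier P. y \<sqsubseteq>\<^bsub>P\<^esub> x \<longrightarrow> y \<in> X)"

definition join_semilattice0 :: "'a gorder \<Rightarrow> bool" where
  "join_semilattice0 L \<longleftrightarrow> upper_semilattice L \<and> weak_partial_order_bottom L"

definition sl_hom :: "'a gorder \<Rightarrow> 'b gorder \<Rightarrow> ('a \<Rightarrow> 'b) \<Rightarrow> bool" where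
  "sl_hom L M f \<longleftrightarrow> f \<in> carrier L \<rightarrow> carrier M \<and>
     (\<forall>x\<in>carrier L. \<forall>y\<in>carrier L. f (x \<squnion>\<^bsub>L\<^esub> y) = f x \<squnion>\<^bsub>M\<^esub> f y) \<and>
     f \<bottom>\<^bsub>L\<^esub> = \<bottom>\<^bsub>M\<^esub>"

definition sl_iso :: "'a gorder \<Rightarrow> 'b gorder \<Rightarrow> ('a \<Rightarrow> 'b) \<Rightarrow> bool" where
  "sl_iso L M f \<longleftrightarrow> sl_hom L M f \<and> bij_betw f (carrier L) (carrier M)"

definition sl_cat :: "'s gorder set \<Rightarrow> ('s gorder, 's \<Rightarrow> 's) cat" where
  "sl_cat S = \<lparr>
     Ob = S,
     Hom = (\<lambda>L M. {f \<in> extensional (carrier L). sl_hom L M f}),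
     Idm = (\<lambda>L. \<lambda>x\<in>carrier L. x),
     Cmp = (\<lambda>L _ _ g f. compose (carrier L) g f)\<rparr>"

definition sl_prod :: "'u set \<Rightarrow> ('u \<Rightarrow> 's gorder) \<Rightarrow> ('u \<Rightarrow> 's) gorder" where
  "sl_prod X L = \<lparr>
     carrier = (\<Pi>\<^sub>E u\<in>X. carrier (L u)),
     eq = (=),
     le = (\<lambda>a b. \<forall>u\<in>X. a u \<sqsubseteq>\<^bsub>L u\<^esub> b u)\<rparr>"

text \<open>
  A class of semilattices is a set of semilattices over one type \<open>'s\<close>. Products live on another
  type, so closure under them (and under unions) means containing an isomorphic copy.
\<close>

definition closed_finite_products :: "'s gorder set \<Rightarrow> bool" where
  "closed_finite_products S \<longleftrightarrow>
     (\<forall>(n::nat) L. (\<forall>k<n. L k \<in> S) \<longrightarrow> (\<exists>M\<in>S. \<exists>h. sl_iso (sl_prod {..<n} L) M h))"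

definition subsemilattice :: "'s gorder \<Rightarrow> 's gorder \<Rightarrow> bool" where
  "subsemilattice L M \<longleftrightarrow> carrier L \<subseteq> carrier M \<and> sl_hom L M (\<lambda>x. x)"

definition sl_Union :: "'s gorder set \<Rightarrow> 's gorder" where
  "sl_Union X = \<lparr>
     carrier = (\<Union>L\<in>X. carrier L),
     eq = (=),
     le = (\<lambda>x y. \<exists>L\<in>X. x \<in> carrier L \<and> y \<in> carrier L \<and> x \<sqsubseteq>\<^bsub>L\<^esub> y)\<rparr>"

definition closed_directed_unions :: "'s gorder set \<Rightarrow> bool" where
  "closed_directed_unions S \<longleftrightarrow>
     (\<forall>X. X \<subseteq> S \<and> X \<noteq> {} \<and>
        (\<forall>L\<in>X. \<forall>M\<in>X. \<exists>N\<in>X. subsemilattice L N \<and> subsemilattice M N) \<longrightarrow>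
        (\<exists>M\<in>S. \<exists>h. sl_iso (sl_Union X) M h))"

definition Id_order :: "'a gorder \<Rightarrow> 'a set gorder" where
  "Id_order P = incl_order {X. poset_ideal P X}"

definition ideal_gen :: "'a gorder \<Rightarrow> 'a set \<Rightarrow> 'a set" where
  "ideal_gen P A = \<Inter>{X. poset_ideal P X \<and> A \<subseteq> X}"

text \<open>The map \<open>Id(f)\<close> between ideal lattices.\<close>

definition Id_map :: "'b gorder \<Rightarrow> ('a \<Rightarrow> 'b) \<Rightarrow> 'a set \<Rightarrow> 'b set" where
  "Id_map M f X = ideal_gen M (f ` X)"


section \<open>Algebras and congruences\<close>

record 'f signature =
  symbols :: "'f set"
  arity :: "'f \<Rightarrow> nat"

record ('f, 'a) alg = "'a partial_object" +
  op :: "'f \<Rightarrow> 'a list \<Rightarrow> 'a"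

definition algebra_on :: "'f signature \<Rightarrow> ('f, 'a) alg \<Rightarrow> bool" where
  "algebra_on \<Sigma> A \<longleftrightarrow> (\<forall>f\<in>symbols \<Sigma>. \<forall>xs. length xs = arity \<Sigma> f \<and> set xs \<subseteq> carrier A \<longrightarrow>
     op A f xs \<in> carrier A)"

definition alg_hom :: "'f signature \<Rightarrow> ('f, 'a) alg \<Rightarrow> ('f, 'b) alg \<Rightarrow> ('a \<Rightarrow> 'b) \<Rightarrow> bool" where
  "alg_hom \<Sigma> A B h \<longleftrightarrow> h \<in> carrier A \<rightarrow> carrier B \<and>
     (\<forall>f\<in>symbols \<Sigma>. \<forall>xs. length xs = arity \<Sigma> f \<and> set xs \<subseteq> carrier A \<longrightarrow>
        h (op A f xs) = op B f (map h xs))"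

definition alg_iso :: "'f signature \<Rightarrow> ('f, 'a) alg \<Rightarrow> ('f, 'b) alg \<Rightarrow> ('a \<Rightarrow> 'b) \<Rightarrow> bool" where
  "alg_iso \<Sigma> A B h \<longleftrightarrow> alg_hom \<Sigma> A B h \<and> bij_betw h (carrier A) (carrier B)"

definition alg_cat :: "'f signature \<Rightarrow> ('f, 'a) alg set \<Rightarrow> (('f, 'a) alg, 'a \<Rightarrow> 'a) cat" where
  "alg_cat \<Sigma> V = \<lparr>
     Ob = V,
     Hom = (\<lambda>A B. {h \<in> extensional (carrier A). alg_hom \<Sigma> A B h}),
     Idm = (\<lambda>A. \<lambda>x\<in>carrier A. x),
     Cmp = (\<lambda>A _ _ g f. compose (carrier A) g f)\<rparr>"

definition closed_hom_images :: "'f signature \<Rightarrow> ('f, 'a) alg set \<Rightarrow> bool" where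
  "closed_hom_images \<Sigma> V \<longleftrightarrow>
     (\<forall>A\<in>V. \<forall>B h. algebra_on \<Sigma> B \<and> alg_hom \<Sigma> A B h \<and> h ` carrier A = carrier B \<longrightarrow> B \<in> V)"

definition subalg :: "'f signature \<Rightarrow> ('f, 'a) alg \<Rightarrow> 'a set \<Rightarrow> bool" where
  "subalg \<Sigma> A B \<longleftrightarrow> B \<subseteq> carrier A \<and> algebra_on \<Sigma> (A\<lparr>carrier := B\<rparr>)"

definition congruence :: "'f signature \<Rightarrow> ('f, 'a) alg \<Rightarrow> ('a \<times> 'a) set \<Rightarrow> bool" where
  "congruence \<Sigma> A \<alpha> \<longleftrightarrow> equiv (carrier A) \<alpha> \<and>
     (\<forall>f\<in>symbols \<Sigma>. \<forall>xs ys. length xs = arity \<Sigma> f \<and> list_all2 (\<lambda>x y. (x, y) \<in> \<alpha>) xs ys \<longrightarrow>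
        (op A f xs, op A f ys) \<in> \<alpha>)"

definition cong_gen :: "'f signature \<Rightarrow> ('f, 'a) alg \<Rightarrow> ('a \<times> 'a) set \<Rightarrow> ('a \<times> 'a) set" where
  "cong_gen \<Sigma> A R = \<Inter>{\<alpha>. congruence \<Sigma> A \<alpha> \<and> R \<subseteq> \<alpha>}"

definition Con :: "'f signature \<Rightarrow> ('f, 'a) alg \<Rightarrow> ('a \<times> 'a) set gorder" where
  "Con \<Sigma> A = incl_order {\<alpha>. congruence \<Sigma> A \<alpha>}"

definition Conc :: "'f signature \<Rightarrow> ('f, 'a) alg \<Rightarrow> ('a \<times> 'a) set gorder" where
  "Conc \<Sigma> A = incl_order {cong_gen \<Sigma> A R | R. finite R \<and> R \<subseteq> carrier A \<times> carrier A}"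

text \<open>\<open>Con f\<close> for \<open>f\<close> a homomorphism into \<open>B\<close>; its restriction to compact congruences is \<open>Con\<^sub>c f\<close>.\<close>

definition Con_map ::
  "'f signature \<Rightarrow> ('f, 'b) alg \<Rightarrow> ('a \<Rightarrow> 'b) \<Rightarrow> ('a \<times> 'a) set \<Rightarrow> ('b \<times> 'b) set" where
  "Con_map \<Sigma> B f \<alpha> = cong_gen \<Sigma> B (map_prod f f ` \<alpha>)"

text \<open>
  An operation of the quotient is computed on all representatives at once; for a congruence the
  union below is a single class.
\<close>

definition quot_alg :: "('f, 'a) alg \<Rightarrow> ('a \<times> 'a) set \<Rightarrow> ('f, 'a set) alg" where
  "quot_alg A \<alpha> = \<lparr>
     carrier = carrier A // \<alpha>,
     op = (\<lambda>f Xs. \<Union>xs\<in>listset Xs. \<alpha> `` {op A f xs})\<rparr>"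

definition sub_quot :: "('f, 'a) alg \<Rightarrow> 'a set \<Rightarrow> ('a \<times> 'a) set \<Rightarrow> ('f, 'a set) alg" where
  "sub_quot A B \<alpha> = quot_alg (A\<lparr>carrier := B\<rparr>) (\<alpha> \<inter> B \<times> B)"

text \<open>
  The canonical embedding of a quotient of a subalgebra sends the class of \<open>x\<close> in the subalgebra
  to the class of \<open>x\<close> in the whole algebra.
\<close>

definition sub_quot_emb :: "('a \<times> 'a) set \<Rightarrow> 'a set \<Rightarrow> 'a set" where
  "sub_quot_emb \<alpha> X = \<alpha> `` X"

definition lifting ::
  "'f signature \<Rightarrow> ('f, 'a) alg set \<Rightarrow> ('o, 'h) cat \<Rightarrow> ('o, 'h, 's gorder, 's \<Rightarrow> 's) fctr \<Rightarrow>
   ('o, 'h, ('f, 'a) alg, 'a \<Rightarrow> 'a) fctr \<Rightarrow> bool" where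
  "lifting \<Sigma> V K E B \<longleftrightarrow> is_functor K (alg_cat \<Sigma> V) B \<and>
     (\<exists>\<eta>. (\<forall>x\<in>Ob K. sl_iso (Conc \<Sigma> (fob B x)) (fob E x) (\<eta> x)) \<and>
        (\<forall>x\<in>Ob K. \<forall>y\<in>Ob K. \<forall>f\<in>Hom K x y. \<forall>\<beta>\<in>carrier (Conc \<Sigma> (fob B x)).
           \<eta> y (Con_map \<Sigma> (fob B y) (fmor B x y f) \<beta>) = fmor E x y f (\<eta> x \<beta>)))"

text \<open>
  A class of algebras is a set of algebras over one type \<open>'a\<close>, whereas quotients live on \<open>'a set\<close>;
  hence the quotient in the second condition is required to be isomorphic to a member of \<open>V\<close>.
  Sums of cardinals are cardinals of disjoint unions.
\<close>

definition loewenheim_skolem ::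
  "'f signature \<Rightarrow> ('f, 'a) alg set \<Rightarrow> 'p gorder \<Rightarrow> ('j, 'h) cat \<Rightarrow> ('p \<Rightarrow> 'k rel) \<Rightarrow> bool" where
  "loewenheim_skolem \<Sigma> V P J \<mu> \<longleftrightarrow>
     (\<forall>A \<alpha>. is_functor J (alg_cat \<Sigma> V) A \<and>
        (\<forall>u\<in>carrier P. \<forall>j\<in>Ob J. congruence \<Sigma> (fob A j) (\<alpha> u j)) \<and>
        (\<forall>u\<in>carrier P. |SIGMA j:Ob J. carrier (Conc \<Sigma> (quot_alg (fob A j) (\<alpha> u j)))| <o \<mu> u) \<longrightarrow>
        (\<exists>B.
           (\<forall>u\<in>carrier P. \<forall>j\<in>Ob J. subalg \<Sigma> (fob A j) (B u j)) \<and>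
           (\<forall>u\<in>carrier P. \<forall>j\<in>Ob J.
              \<exists>Q\<in>V. \<exists>h. alg_iso \<Sigma> (sub_quot (fob A j) (B u j) (\<alpha> u j)) Q h) \<and>
           (\<forall>u\<in>carrier P. \<forall>v\<in>carrier P. \<forall>j\<in>Ob J. u \<sqsubseteq>\<^bsub>P\<^esub> v \<longrightarrow> B u j \<subseteq> B v j) \<and>
           (\<forall>u\<in>carrier P. \<forall>j\<in>Ob J. \<forall>k\<in>Ob J. \<forall>f\<in>Hom J j k. fmor A j k f ` B u j \<subseteq> B u k) \<and>
           (\<forall>u\<in>carrier P. \<forall>j\<in>Ob J.
              order_iso (Con \<Sigma> (sub_quot (fob A j) (B u j) (\<alpha> u j)))
                (Con \<Sigma> (quot_alg (fob A j) (\<alpha> u j)))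
                (Con_map \<Sigma> (quot_alg (fob A j) (\<alpha> u j)) (sub_quot_emb (\<alpha> u j)))) \<and>
           (\<forall>u\<in>carrier P. |SIGMA j:Ob J. B u j| <o \<mu> u)))"


section \<open>Norm-coverings\<close>

definition poset_kernel :: "'u gorder \<Rightarrow> 'u set \<Rightarrow> bool" where
  "poset_kernel U V \<longleftrightarrow> finite V \<and> V \<subseteq> carrier U \<and>
     (\<forall>u\<in>carrier U. \<exists>v. greatest U v {w \<in> V. w \<sqsubseteq>\<^bsub>U\<^esub> u})"

text \<open>\<open>V \<cdot> u\<close> for elements and for ideals.\<close>

definition kdot :: "'u gorder \<Rightarrow> 'u set \<Rightarrow> 'u \<Rightarrow> 'u" where
  "kdot U V u = (THE v. greatest U v {w \<in> V. w \<sqsubseteq>\<^bsub>U\<^esub> u})"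

definition kdot_ideal :: "'u gorder \<Rightarrow> 'u set \<Rightarrow> 'u set \<Rightarrow> 'u" where
  "kdot_ideal U V X = (THE v. greatest U v (V \<inter> X))"

definition supported :: "'u gorder \<Rightarrow> bool" where
  "supported U \<longleftrightarrow> partial_order U \<and>
     (\<forall>X. finite X \<and> X \<subseteq> carrier U \<longrightarrow> (\<exists>V. poset_kernel U V \<and> X \<subseteq> V))"

definition norm_covering :: "'i gorder \<Rightarrow> 'u gorder \<Rightarrow> ('u \<Rightarrow> 'i) \<Rightarrow> bool" where
  "norm_covering I U nm \<longleftrightarrow> supported U \<and> order_preserving U I nm"

definition sharp_ideal :: "'i gorder \<Rightarrow> 'u gorder \<Rightarrow> ('u \<Rightarrow> 'i) \<Rightarrow> 'u set \<Rightarrow> bool" where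
  "sharp_ideal I U nm X \<longleftrightarrow> poset_ideal U X \<and> (\<exists>i. greatest I i (nm ` X))"

definition ideal_norm :: "'i gorder \<Rightarrow> ('u \<Rightarrow> 'i) \<Rightarrow> 'u set \<Rightarrow> 'i" where
  "ideal_norm I nm X = (THE i. greatest I i (nm ` X))"

definition extreme_ideal :: "'i gorder \<Rightarrow> 'u gorder \<Rightarrow> ('u \<Rightarrow> 'i) \<Rightarrow> 'u set \<Rightarrow> bool" where
  "extreme_ideal I U nm X \<longleftrightarrow> sharp_ideal I U nm X \<and>
     \<not> (\<exists>Y. sharp_ideal I U nm Y \<and> X \<subset> Y \<and> ideal_norm I nm Y = ideal_norm I nm X)"

definition Id_e :: "'i gorder \<Rightarrow> 'u gorder \<Rightarrow> ('u \<Rightarrow> 'i) \<Rightarrow> 'u set gorder" where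
  "Id_e I U nm = incl_order {X. extreme_ideal I U nm X}"

text \<open>
  Compatibility makes sense for arbitrary cardinals. The lifting theorem, however, fails for finite
  ones: take \<open>I = {0 < 1}\<close>, \<open>U\<close> a least element of norm 0 with three elements of norm 1 above it,
  \<open>\<kappa>\<^sub>0 = 3\<close>, \<open>\<kappa>\<^sub>1 = 6\<close>, algebras without operations, and the map from the two-element semilattice
  to the partition lattice of a three-element set that preserves the top. Therefore it is a
  separate hypothesis of the theorem that the cardinals at norms of non-maximal extreme ideals are
  infinite.
\<close>

definition compatible ::
  "'i gorder \<Rightarrow> ('i \<Rightarrow> 'k rel) \<Rightarrow> 'u gorder \<Rightarrow> ('u \<Rightarrow> 'i) \<Rightarrow> bool" where
  "compatible I \<kappa> U nm \<longleftrightarrow>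
     (\<forall>F. order_preserving (Id_e I U nm) (incl_order (Pow (carrier U))) F \<and>
        (\<forall>X\<in>carrier (non_maximal (Id_e I U nm)). |F X| <o \<kappa> (ideal_norm I nm X)) \<longrightarrow>
        (\<exists>\<sigma>. order_preserving I (Id_e I U nm) \<sigma> \<and>
           (\<forall>i\<in>carrier I. ideal_norm I nm (\<sigma> i) = i) \<and>
           (\<forall>i\<in>carrier I. \<forall>j\<in>carrier I. i \<sqsubseteq>\<^bsub>I\<^esub> j \<longrightarrow> F (\<sigma> i) \<inter> \<sigma> j \<subseteq> \<sigma> i)))"


section \<open>Condensates\<close>

type_synonym ('i, 's) diagram = "('i, unit, 's gorder, 's \<Rightarrow> 's) fctr"

definition is_support ::
  "'u gorder \<Rightarrow> ('u \<Rightarrow> 'i) \<Rightarrow> ('i, 's) diagram \<Rightarrow> ('u \<Rightarrow> 's) \<Rightarrow> 'u set \<Rightarrow> bool" where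
  "is_support U nm D a V \<longleftrightarrow> poset_kernel U V \<and>
     (\<forall>u\<in>carrier U. a u = fmor D (nm (kdot U V u)) (nm u) () (a (kdot U V u)))"

definition Cond :: "'u gorder \<Rightarrow> ('u \<Rightarrow> 'i) \<Rightarrow> ('i, 's) diagram \<Rightarrow> ('u \<Rightarrow> 's) gorder" where
  "Cond U nm D =
     (let L = sl_prod (carrier U) (\<lambda>u. fob D (nm u))
      in L\<lparr>carrier := {a \<in> carrier L. \<exists>V. is_support U nm D a V}\<rparr>)"

definition Cond_map ::
  "'u gorder \<Rightarrow> ('u \<Rightarrow> 'i) \<Rightarrow> ('i \<Rightarrow> 's \<Rightarrow> 's) \<Rightarrow> ('u \<Rightarrow> 's) \<Rightarrow> ('u \<Rightarrow> 's)" where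
  "Cond_map U nm \<psi> a = (\<lambda>u\<in>carrier U. \<psi> (nm u) (a u))"

definition cond_proj ::
  "'i gorder \<Rightarrow> 'u gorder \<Rightarrow> ('u \<Rightarrow> 'i) \<Rightarrow> ('i, 's) diagram \<Rightarrow> 'u set \<Rightarrow> ('u \<Rightarrow> 's) \<Rightarrow> 's" where
  "cond_proj I U nm D X a =
     (let V = (SOME V. is_support U nm D a V)
      in fmor D (nm (kdot_ideal U V X)) (ideal_norm I nm X) () (a (kdot_ideal U V X)))"

definition cond_theta ::
  "'i gorder \<Rightarrow> 'u gorder \<Rightarrow> ('u \<Rightarrow> 'i) \<Rightarrow> ('i, 's) diagram \<Rightarrow> 'u set \<Rightarrow> ('u \<Rightarrow> 's) set" where
  "cond_theta I U nm D X =
     {a \<in> carrier (Cond U nm D). cond_proj I U nm D X a = \<bottom>\<^bsub>fob D (ideal_norm I nm X)\<^esub>}"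


section \<open>Quasi-liftings\<close>

definition ql_alpha ::
  "'f signature \<Rightarrow> 'i gorder \<Rightarrow> 'u gorder \<Rightarrow> ('u \<Rightarrow> 'i) \<Rightarrow> ('i, 's) diagram \<Rightarrow>
   (('a \<times> 'a) set \<Rightarrow> 'u \<Rightarrow> 's) \<Rightarrow> ('f, 'a) alg \<Rightarrow> 'u set \<Rightarrow> ('a \<times> 'a) set" where
  "ql_alpha \<Sigma> I U nm D \<tau> T X =
     \<Squnion>\<^bsub>Con \<Sigma> T\<^esub> {\<beta> \<in> carrier (Conc \<Sigma> T). \<tau> \<beta> \<in> cond_theta I U nm D X}"

text \<open>
  In the argument of \<open>Id_map\<close>, the congruence \<open>\<beta>\<close> is identified with the ideal of compact
  congruences below it.
\<close>

definition quasi_lifting_ob ::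
  "'f signature \<Rightarrow> ('f, 'a) alg set \<Rightarrow> 'i gorder \<Rightarrow> 'u gorder \<Rightarrow> ('u \<Rightarrow> 'i) \<Rightarrow> ('i, 's) diagram \<Rightarrow>
   (('a \<times> 'a) set \<Rightarrow> 'u \<Rightarrow> 's) \<Rightarrow> ('f, 'a) alg \<Rightarrow> bool" where
  "quasi_lifting_ob \<Sigma> V I U nm D \<tau> T \<longleftrightarrow>
     T \<in> V \<and> sl_hom (Conc \<Sigma> T) (Cond U nm D) \<tau> \<and>
     (\<forall>X\<in>carrier (Id_e I U nm).
        order_iso
          (incl_order {\<beta> \<in> carrier (Con \<Sigma> T). ql_alpha \<Sigma> I U nm D \<tau> T X \<subseteq> \<beta>})
          (incl_order {Y \<in> carrier (Id_order (Cond U nm D)). cond_theta I U nm D X \<subseteq> Y})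
          (\<lambda>\<beta>. Id_map (Cond U nm D) \<tau> {\<gamma> \<in> carrier (Conc \<Sigma> T). \<gamma> \<subseteq> \<beta>}
                 \<squnion>\<^bsub>Id_order (Cond U nm D)\<^esub> cond_theta I U nm D X))"

definition quasi_lifting ::
  "'f signature \<Rightarrow> ('f, 'a) alg set \<Rightarrow> 'i gorder \<Rightarrow> 'u gorder \<Rightarrow> ('u \<Rightarrow> 'i) \<Rightarrow> ('j, 'h) cat \<Rightarrow>
   ('j, 'h, ('i, 's) diagram, 'i \<Rightarrow> 's \<Rightarrow> 's) fctr \<Rightarrow>
   ('j \<Rightarrow> ('a \<times> 'a) set \<Rightarrow> 'u \<Rightarrow> 's) \<Rightarrow> ('j, 'h, ('f, 'a) alg, 'a \<Rightarrow> 'a) fctr \<Rightarrow> bool" where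
  "quasi_lifting \<Sigma> V I U nm J D \<tau> A \<longleftrightarrow>
     is_functor J (alg_cat \<Sigma> V) A \<and>
     (\<forall>j\<in>Ob J. quasi_lifting_ob \<Sigma> V I U nm (fob D j) (\<tau> j) (fob A j)) \<and>
     (\<forall>j\<in>Ob J. \<forall>k\<in>Ob J. \<forall>f\<in>Hom J j k. \<forall>\<beta>\<in>carrier (Conc \<Sigma> (fob A j)).
        \<tau> k (Con_map \<Sigma> (fob A k) (fmor A j k f) \<beta>) = Cond_map U nm (fmor D j k f) (\<tau> j \<beta>))"

definition diagram_hat ::
  "('j, 'h, ('i, 's) diagram, 'i \<Rightarrow> 's \<Rightarrow> 's) fctr \<Rightarrow>
   ('i \<times> 'j, unit \<times> 'h, 's gorder, 's \<Rightarrow> 's) fctr" where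
  "diagram_hat D = \<lparr>
     fob = (\<lambda>(i, j). fob (fob D j) i),
     fmor = (\<lambda>(i, j) (i', j') (_, g).
       compose (carrier (fob (fob D j) i)) (fmor D j j' g i') (fmor (fob D j) i i' ()))\<rparr>"

end

theory Submission
  imports Defs
begin

text \<open>
  For an extreme ideal \<open>u\<close> of norm \<open>i\<close>, the projection of the condensate to \<open>D\<^sub>i\<close> is onto and induces an
  isomorphism between the ideals containing \<open>\<theta>\<^sub>u\<close> and the ideals of \<open>D\<^sub>i\<close>. Composed with a
  quasi-lifting \<open>\<tau>\<close>, it yields on \<open>T\<close> the \<open>D\<^sub>i\<close>-valued distance
  \<open>\<delta>\<^sub>u(x, y) = \<pi>\<^sub>u(\<tau>(\<Theta>(x, y)))\<close>, and the congruences above \<open>\<alpha>\<^sub>u\<close> are exactly the relations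
  \<open>{(x, y). \<delta>\<^sub>u(x, y) \<in> X}\<close> with \<open>X\<close> an ideal of \<open>D\<^sub>i\<close>; in particular \<open>Con\<^sub>c(T/\<alpha>\<^sub>u) \<cong> D\<^sub>i\<close>. The
  cardinality hypothesis thus lets the Loewenheim-Skolem property cut \<open>A(j)\<close> down to small
  subalgebras \<open>B\<^sub>u(j)\<close> with \<open>Con\<^sub>c(B\<^sub>u(j)/\<alpha>\<^sub>u) \<cong> D\<^sub>i(j)\<close> (for maximal \<open>u\<close>, take all of \<open>A(j)\<close>). Let
  \<open>F(u)\<close> be the union of supports of the elements \<open>\<tau>(\<Theta>(x, y))\<close> with \<open>x, y \<in> B\<^sub>u(j)\<close>, and let
  \<open>\<sigma>\<close> be given by compatibility. If \<open>V\<close> is such a support for \<open>u = \<sigma>(i)\<close> and \<open>i \<le> i'\<close>, then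
  \<open>V \<inter> \<sigma>(i') \<subseteq> \<sigma>(i)\<close>, so \<open>\<delta>\<close> at \<open>\<sigma>(i')\<close> is the image of \<open>\<delta>\<close> at \<open>\<sigma>(i)\<close> under
  the transition map of \<open>D\<close>. Hence the quotients \<open>B\<^sub>u(j)/\<alpha>\<^sub>u\<close> with \<open>u = \<sigma>(i)\<close> form the required
  lifting.
\<close>

section \<open>Posets and semilattices\<close>

text \<open>The subalgebras have to be chosen before \<open>\<sigma>\<close> is known, whereas the
  comparison of distances at \<open>\<sigma> i\<close> and \<open>\<sigma> i'\<close> depends on how
  supports meet these two ideals. \<open>F\<close> settles this by listing in advance every point
  that could spoil the comparison; it is small because the subalgebras are small and supports are
  finite. Finitely many finite supports may still exceed a finite bound, which is where the
  cardinals must be infinite. Compatibility bounds \<open>F\<close> only at non-maximal ideals, so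
  nothing has to be cut down at maximal ones.

  Distances are preferred to lattice isomorphisms because one equation, saying that the distance of
  two images is the transition map applied to the distance, does two jobs: it sends pairs at
  distance zero to such pairs, so that maps descend to quotients, and it makes the isomorphisms of
  compact congruences natural. Quotients live on sets of elements rather than on elements, so
  members of \<open>V\<close> replace them only up to isomorphism; such a member is handled through
  a surjection from the subalgebra, and morphisms are defined on chosen preimages.\<close>

lemma partial_order_incl_order: "partial_order (incl_order X)"
  by unfold_locales auto

context partial_order
begin

text \<open>\<open>\<Squnion>\<close> and \<open>\<bottom>\<close> are chosen by
  \<open>SOME\<close>; antisymmetry makes the choice unique, so a join or a bottom is computed by
  exhibiting it.\<close>

lemma sup_eqI: "is_lub L s A \<Longrightarrow> \<Squnion>A = s"
  unfolding sup_def by (blast intro: some_equality least_unique)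

lemma join_eqI:
  assumes "x \<in> carrier L" "y \<in> carrier L" "z \<in> carrier L" "x \<sqsubseteq> z" "y \<sqsubseteq> z"
    and "\<And>w. \<lbrakk>w \<in> carrier L; x \<sqsubseteq> w; y \<sqsubseteq> w\<rbrakk> \<Longrightarrow> z \<sqsubseteq> w"
  shows "x \<squnion> y = z"
  unfolding join_def using assms by (intro sup_eqI least_UpperI) (auto simp: Upper_def)

lemma bottom_eqI:
  assumes "b \<in> carrier L" "\<And>w. w \<in> carrier L \<Longrightarrow> b \<sqsubseteq> w"
  shows "\<bottom> = b"
  unfolding bottom_def using assms by (intro some_equality) (auto simp: least_def)

end

lemma join_semilattice0I:
  fixes L :: "'s gorder" (structure)
  assumes "partial_order L"
    and join: "\<And>x y. \<lbrakk>x \<in> carrier L; y \<in> carrier L\<rbrakk> \<Longrightarrow>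
      \<exists>z\<in>carrier L. x \<sqsubseteq> z \<and> y \<sqsubseteq> z \<and> (\<forall>w\<in>carrier L. x \<sqsubseteq> w \<longrightarrow> y \<sqsubseteq> w \<longrightarrow> z \<sqsubseteq> w)"
    and bot: "b \<in> carrier L" "\<And>w. w \<in> carrier L \<Longrightarrow> b \<sqsubseteq> w"
  shows "join_semilattice0 L"
  unfolding join_semilattice0_def
proof
  interpret partial_order L by fact
  show "upper_semilattice L"
  proof
    fix x y assume xy: "x \<in> carrier L" "y \<in> carrier L"
    from join[OF this] obtain z where "z \<in> carrier L" "x \<sqsubseteq> z" "y \<sqsubseteq> z"
      "\<forall>w\<in>carrier L. x \<sqsubseteq> w \<longrightarrow> y \<sqsubseteq> w \<longrightarrow> z \<sqsubseteq> w" by blast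
    then have "is_lub L z {x, y}" using xy by (intro least_UpperI) (auto simp: Upper_def)
    then show "\<exists>s. is_lub L s {x, y}" ..
  qed
  show "weak_partial_order_bottom L"
    using bot by unfold_locales (auto simp: least_def)
qed

lemma ideal_finite_ub:
  assumes po: "partial_order P" and X: "poset_ideal P X" and "finite F" "F \<subseteq> X"
  shows "\<exists>z\<in>X. \<forall>x\<in>F. x \<sqsubseteq>\<^bsub>P\<^esub> z"
  using assms(3,4)
proof (induction rule: finite_induct)
  case empty
  then show ?case using X by (auto simp: poset_ideal_def)
next
  case (insert a F)
  interpret partial_order P by fact
  from insert obtain z where z: "z \<in> X" "\<forall>x\<in>F. x \<sqsubseteq>\<^bsub>P\<^esub> z" by auto
  with insert X obtain w where w: "w \<in> X" "a \<sqsubseteq>\<^bsub>P\<^esub> w" "z \<sqsubseteq>\<^bsub>P\<^esub> w"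
    unfolding poset_ideal_def by (metis insert_subset)
  have "x \<sqsubseteq>\<^bsub>P\<^esub> w" if "x \<in> F" for x
    using le_trans[of x z w] w z insert.prems X that by (auto simp: poset_ideal_def)
  then have "\<forall>x\<in>insert a F. x \<sqsubseteq>\<^bsub>P\<^esub> w" using w by blast
  with w show ?case by blast
qed

lemma ideal_subset: "poset_ideal P X \<Longrightarrow> x \<in> X \<Longrightarrow> x \<in> carrier P"
  by (auto simp: poset_ideal_def)

text \<open>In the ideal lattice the principal ideals are the compact elements; through them the
  elements of \<open>L\<close> are found again among the congruences.\<close>

definition down :: "'s gorder \<Rightarrow> 's \<Rightarrow> 's set" where
  "down L d = {e \<in> carrier L. e \<sqsubseteq>\<^bsub>L\<^esub> d}"

locale semilattice0 =
  fixes L :: "'s gorder" (structure)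
  assumes join_semilattice0: "join_semilattice0 L"

sublocale semilattice0 \<subseteq> upper_semilattice L + weak_partial_order_bottom L
  using join_semilattice0 by (auto simp: join_semilattice0_def)

context semilattice0
begin

lemma ideal_iff:
  "poset_ideal L X \<longleftrightarrow> X \<subseteq> carrier L \<and> \<bottom> \<in> X \<and> (\<forall>x\<in>X. \<forall>y\<in>X. x \<squnion> y \<in> X) \<and>
     (\<forall>x\<in>X. \<forall>y\<in>carrier L. y \<sqsubseteq> x \<longrightarrow> y \<in> X)" (is "?l \<longleftrightarrow> ?r")
proof
  assume X: ?l
  have "\<bottom> \<in> X" using X unfolding poset_ideal_def by (metis all_not_in_conv bottom_closed bottom_lower subsetD)
  moreover have "x \<squnion> y \<in> X" if "x \<in> X" "y \<in> X" for x y
  proof -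
    have c: "x \<in> carrier L" "y \<in> carrier L" using X that by (auto simp: poset_ideal_def)
    obtain z where z: "z \<in> X" "x \<sqsubseteq> z" "y \<sqsubseteq> z" using X \<open>x \<in> X\<close> \<open>y \<in> X\<close> unfolding poset_ideal_def by blast
    then have "x \<squnion> y \<sqsubseteq> z" using c X by (intro join_le) (auto simp: poset_ideal_def)
    then show ?thesis using X z c unfolding poset_ideal_def by (meson join_closed)
  qed
  ultimately show ?r using X by (auto simp: poset_ideal_def)
next
  assume X: ?r
  have "\<exists>z\<in>X. x \<sqsubseteq> z \<and> y \<sqsubseteq> z" if "x \<in> X" "y \<in> X" for x y
    using X that by (intro bexI[of _ "x \<squnion> y"]) (auto intro: join_left join_right)
  then show ?l using X unfolding poset_ideal_def by blast
qed

lemma ideal_bottom: "poset_ideal L X \<Longrightarrow> \<bottom> \<in> X"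
  and ideal_join: "poset_ideal L X \<Longrightarrow> x \<in> X \<Longrightarrow> y \<in> X \<Longrightarrow> x \<squnion> y \<in> X"
  and ideal_down: "poset_ideal L X \<Longrightarrow> x \<in> X \<Longrightarrow> y \<in> carrier L \<Longrightarrow> y \<sqsubseteq> x \<Longrightarrow> y \<in> X"
  by (auto simp: ideal_iff)

lemma ideal_down_set: "d \<in> carrier L \<Longrightarrow> poset_ideal L (down L d)"
  unfolding ideal_iff down_def using le_trans by (auto intro!: join_le)

lemma down_subset_iff: "\<lbrakk>poset_ideal L X; d \<in> carrier L\<rbrakk> \<Longrightarrow> down L d \<subseteq> X \<longleftrightarrow> d \<in> X"
  unfolding down_def using ideal_down by auto

lemma ideal_carrier: "poset_ideal L (carrier L)"
  unfolding ideal_iff by auto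

lemma le_bottom_iff: "x \<in> carrier L \<Longrightarrow> x \<sqsubseteq> \<bottom> \<longleftrightarrow> x = \<bottom>"
  by (auto intro: le_antisym)

text \<open>In the form of \<open>ideal_iff\<close> an ideal is given by closure conditions, which
  pass to intersections; \<open>carrier L\<close> keeps the intersected family from being
  empty.\<close>

lemma ideal_ideal_gen: "Y \<subseteq> carrier L \<Longrightarrow> poset_ideal L (ideal_gen L Y)"
  using ideal_carrier unfolding ideal_iff ideal_gen_def by blast

lemma ideal_gen_incl: "Y \<subseteq> ideal_gen L Y"
  unfolding ideal_gen_def by blast

lemma ideal_gen_least: "poset_ideal L X \<Longrightarrow> Y \<subseteq> X \<Longrightarrow> ideal_gen L Y \<subseteq> X"
  unfolding ideal_gen_def by blast

text \<open>Turns the join in the definition of a quasi-lifting into a generated ideal, whose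
  inclusion in another ideal is tested on generators.\<close>

lemma Id_join_eq:
  assumes "poset_ideal L X" "poset_ideal L Y"
  shows "X \<squnion>\<^bsub>Id_order L\<^esub> Y = ideal_gen L (X \<union> Y)"
proof -
  interpret Id: partial_order "Id_order L"
    unfolding Id_order_def by (rule partial_order_incl_order)
  have sub: "X \<union> Y \<subseteq> carrier L" using assms by (auto simp: poset_ideal_def)
  show ?thesis
    by (rule Id.join_eqI)
      (use assms sub ideal_ideal_gen[of "X \<union> Y"] ideal_gen_incl[of "X \<union> Y"]
        ideal_gen_least[of _ "X \<union> Y"] in \<open>auto simp: Id_order_def\<close>)
qed

end

lemma sl_hom_closed: "sl_hom L M f \<Longrightarrow> x \<in> carrier L \<Longrightarrow> f x \<in> carrier M"
  by (auto simp: sl_hom_def)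

lemma sl_hom_mono:
  assumes "join_semilattice0 L" "join_semilattice0 M" "sl_hom L M f"
    and "x \<in> carrier L" "y \<in> carrier L" "x \<sqsubseteq>\<^bsub>L\<^esub> y"
  shows "f x \<sqsubseteq>\<^bsub>M\<^esub> f y"
proof -
  interpret L: semilattice0 L by standard fact
  interpret M: semilattice0 M by standard fact
  have "x \<squnion>\<^bsub>L\<^esub> y = y" using assms by (intro L.join_eqI) auto
  then have "f y = f x \<squnion>\<^bsub>M\<^esub> f y" using assms unfolding sl_hom_def by metis
  then show ?thesis using assms by (metis M.join_left sl_hom_closed)
qed

lemma ideal_vimage:
  assumes "join_semilattice0 L" "join_semilattice0 M" "sl_hom L M f" "poset_ideal M X"
  shows "poset_ideal L {x \<in> carrier L. f x \<in> X}"
proof -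
  interpret L: semilattice0 L by standard fact
  interpret M: semilattice0 M by standard fact
  have "f y \<in> X" if "x \<in> carrier L" "f x \<in> X" "y \<in> carrier L" "y \<sqsubseteq>\<^bsub>L\<^esub> x" for x y
    using that sl_hom_mono[OF assms(1-3)] M.ideal_down[OF assms(4)] sl_hom_closed[OF assms(3)] by blast
  then show ?thesis
    using assms(3) M.ideal_bottom[OF assms(4)] M.ideal_join[OF assms(4)]
    unfolding L.ideal_iff sl_hom_def by auto
qed


section \<open>Homomorphisms, congruences and quotients\<close>

text \<open>This is the \<Theta>(x, y) of the overview.\<close>

definition principal_cong :: "'f signature \<Rightarrow> ('f, 'a) alg \<Rightarrow> 'a \<Rightarrow> 'a \<Rightarrow> ('a \<times> 'a) set" where
  "principal_cong \<Sigma> A x y = cong_gen \<Sigma> A {(x, y)}"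

lemma alg_hom_closed: "alg_hom \<Sigma> A B h \<Longrightarrow> x \<in> carrier A \<Longrightarrow> h x \<in> carrier B"
  by (auto simp: alg_hom_def)

lemma alg_hom_op:
  "\<lbrakk>alg_hom \<Sigma> A B h; f \<in> symbols \<Sigma>; length xs = arity \<Sigma> f; set xs \<subseteq> carrier A\<rbrakk> \<Longrightarrow>
    h (op A f xs) = op B f (map h xs)"
  by (auto simp: alg_hom_def)

lemma alg_hom_comp:
  assumes "alg_hom \<Sigma> A B h" "alg_hom \<Sigma> B C k"
  shows "alg_hom \<Sigma> A C (k \<circ> h)"
proof -
  have "set (map h xs) \<subseteq> carrier B" if "set xs \<subseteq> carrier A" for xs
    using that assms(1) by (auto simp: alg_hom_def)
  then show ?thesis using assms unfolding alg_hom_def by auto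
qed

lemma ex_map_eq:
  assumes "set ys \<subseteq> p ` A"
  shows "\<exists>xs. set xs \<subseteq> A \<and> map p xs = ys"
proof (intro exI conjI)
  have r: "inv_into A p y \<in> A" "p (inv_into A p y) = y" if "y \<in> set ys" for y
    using that assms by (auto intro: inv_into_into f_inv_into_f)
  then show "set (map (inv_into A p) ys) \<subseteq> A" by auto
  show "map p (map (inv_into A p) ys) = ys" using r by (simp add: map_idI)
qed

text \<open>An argument list in \<open>Q\<close> is lifted along \<open>p\<close>, after which both
  sides are values of \<open>g\<close>. Maps out of quotients become homomorphisms this way without
  their definitions being opened.\<close>

lemma alg_hom_factor:
  assumes p: "alg_hom \<Sigma> G Q p" and surj: "p ` carrier G = carrier Q"
    and g: "alg_hom \<Sigma> G R g" and e: "\<And>x. x \<in> carrier G \<Longrightarrow> e (p x) = g x"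
    and G: "algebra_on \<Sigma> G"
  shows "alg_hom \<Sigma> Q R e"
  unfolding alg_hom_def
proof (intro conjI ballI allI impI)
  show "e \<in> carrier Q \<rightarrow> carrier R"
    unfolding surj[symmetric] using e alg_hom_closed[OF g] by auto
  fix f ys assume f: "f \<in> symbols \<Sigma>" and ys: "length ys = arity \<Sigma> f \<and> set ys \<subseteq> carrier Q"
  then obtain xs where xs: "set xs \<subseteq> carrier G" "map p xs = ys"
    using ex_map_eq[of ys p "carrier G"] surj by auto
  have len: "length xs = arity \<Sigma> f" using xs ys by auto
  have "op G f xs \<in> carrier G" using G f len xs by (auto simp: algebra_on_def)
  then have "e (op Q f ys) = g (op G f xs)"
    using alg_hom_op[OF p f len] xs e by metis
  also have "\<dots> = op R f (map g xs)" using alg_hom_op[OF g f len] xs by blast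
  also have "map g xs = map e ys" using xs e by (auto simp: subset_iff)
  finally show "e (op Q f ys) = op R f (map e ys)" .
qed

lemma algebra_on_hom_image:
  assumes p: "alg_hom \<Sigma> G Q p" and surj: "p ` carrier G = carrier Q" and G: "algebra_on \<Sigma> G"
  shows "algebra_on \<Sigma> Q"
  unfolding algebra_on_def
proof (intro ballI allI impI)
  fix f ys assume f: "f \<in> symbols \<Sigma>" and ys: "length ys = arity \<Sigma> f \<and> set ys \<subseteq> carrier Q"
  then obtain xs where xs: "set xs \<subseteq> carrier G" "map p xs = ys"
    using ex_map_eq[of ys p "carrier G"] surj by auto
  have len: "length xs = arity \<Sigma> f" using xs ys by auto
  have "op G f xs \<in> carrier G" using G f len xs by (auto simp: algebra_on_def)
  then show "op Q f ys \<in> carrier Q"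
    using alg_hom_op[OF p f len] xs alg_hom_closed[OF p] by metis
qed

section \<open>Congruences, generated congruences and their pullbacks\<close>

lemma congruence_iff:
  "congruence \<Sigma> A \<alpha> \<longleftrightarrow> \<alpha> \<subseteq> carrier A \<times> carrier A \<and> (\<forall>x\<in>carrier A. (x, x) \<in> \<alpha>) \<and>
     (\<forall>x y. (x, y) \<in> \<alpha> \<longrightarrow> (y, x) \<in> \<alpha>) \<and> (\<forall>x y z. (x, y) \<in> \<alpha> \<longrightarrow> (y, z) \<in> \<alpha> \<longrightarrow> (x, z) \<in> \<alpha>) \<and>
     (\<forall>f\<in>symbols \<Sigma>. \<forall>xs ys. length xs = arity \<Sigma> f \<and> list_all2 (\<lambda>x y. (x, y) \<in> \<alpha>) xs ys \<longrightarrow>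
        (op A f xs, op A f ys) \<in> \<alpha>)"
  unfolding congruence_def equiv_def refl_on_def sym_def trans_def by blast

lemma congruenceI:
  assumes "\<alpha> \<subseteq> carrier A \<times> carrier A" "\<And>x. x \<in> carrier A \<Longrightarrow> (x, x) \<in> \<alpha>"
    and "\<And>x y. (x, y) \<in> \<alpha> \<Longrightarrow> (y, x) \<in> \<alpha>"
    and "\<And>x y z. (x, y) \<in> \<alpha> \<Longrightarrow> (y, z) \<in> \<alpha> \<Longrightarrow> (x, z) \<in> \<alpha>"
    and "\<And>f xs ys. \<lbrakk>f \<in> symbols \<Sigma>; length xs = arity \<Sigma> f; list_all2 (\<lambda>x y. (x, y) \<in> \<alpha>) xs ys\<rbrakk>
      \<Longrightarrow> (op A f xs, op A f ys) \<in> \<alpha>"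
  shows "congruence \<Sigma> A \<alpha>"
  unfolding congruence_iff using assms by (intro conjI ballI allI impI) (assumption | blast)+

lemma congruence_op:
  "\<lbrakk>congruence \<Sigma> A \<alpha>; f \<in> symbols \<Sigma>; length xs = arity \<Sigma> f; list_all2 (\<lambda>x y. (x, y) \<in> \<alpha>) xs ys\<rbrakk>
    \<Longrightarrow> (op A f xs, op A f ys) \<in> \<alpha>"
  unfolding congruence_def by blast

lemma congruence_carrier: "congruence \<Sigma> A \<alpha> \<Longrightarrow> \<alpha> \<subseteq> carrier A \<times> carrier A"
  and congruence_refl: "congruence \<Sigma> A \<alpha> \<Longrightarrow> x \<in> carrier A \<Longrightarrow> (x, x) \<in> \<alpha>"
  and congruence_sym: "congruence \<Sigma> A \<alpha> \<Longrightarrow> (x, y) \<in> \<alpha> \<Longrightarrow> (y, x) \<in> \<alpha>"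
  and congruence_trans: "congruence \<Sigma> A \<alpha> \<Longrightarrow> (x, y) \<in> \<alpha> \<Longrightarrow> (y, z) \<in> \<alpha> \<Longrightarrow> (x, z) \<in> \<alpha>"
  unfolding congruence_iff by blast+

lemma congruence_full:
  assumes "algebra_on \<Sigma> A"
  shows "congruence \<Sigma> A (carrier A \<times> carrier A)"
proof -
  have "set xs \<subseteq> carrier A \<and> set ys \<subseteq> carrier A \<and> length xs = length ys"
    if "list_all2 (\<lambda>x y. (x, y) \<in> carrier A \<times> carrier A) xs ys" for xs ys
    using that by (induction rule: list_all2_induct) auto
  then show ?thesis using assms unfolding congruence_iff algebra_on_def by auto
qed

lemma congruence_Inter:
  assumes "\<C> \<noteq> {}" "\<And>\<alpha>. \<alpha> \<in> \<C> \<Longrightarrow> congruence \<Sigma> A \<alpha>"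
  shows "congruence \<Sigma> A (\<Inter>\<C>)"
proof -
  have "list_all2 (\<lambda>x y. (x, y) \<in> \<alpha>) xs ys"
    if "list_all2 (\<lambda>x y. (x, y) \<in> \<Inter>\<C>) xs ys" "\<alpha> \<in> \<C>" for xs ys \<alpha>
    using that(1) by (rule list_all2_mono) (use that(2) in blast)
  then have "(op A f xs, op A f ys) \<in> \<Inter>\<C>"
    if "f \<in> symbols \<Sigma>" "length xs = arity \<Sigma> f" "list_all2 (\<lambda>x y. (x, y) \<in> \<Inter>\<C>) xs ys" for f xs ys
    using that congruence_op[OF assms(2)] by (meson InterI)
  moreover have "\<Inter>\<C> \<subseteq> carrier A \<times> carrier A" using assms congruence_carrier by blast
  moreover have "(x, z) \<in> \<Inter>\<C>" if "(x, y) \<in> \<Inter>\<C>" "(y, z) \<in> \<Inter>\<C>" for x y z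
    using that congruence_trans[OF assms(2), of _ x y z] by (meson InterI InterD)
  ultimately show ?thesis
    by (intro congruenceI)
      (auto intro: assms(2)[THEN congruence_refl] assms(2)[THEN congruence_sym])
qed

lemma cong_gen_congruence:
  assumes "algebra_on \<Sigma> A" "R \<subseteq> carrier A \<times> carrier A"
  shows "congruence \<Sigma> A (cong_gen \<Sigma> A R)"
  unfolding cong_gen_def using congruence_full[OF assms(1)] assms(2)
  by (intro congruence_Inter) auto

lemma cong_gen_incl: "R \<subseteq> cong_gen \<Sigma> A R"
  unfolding cong_gen_def by blast

lemma cong_gen_least: "congruence \<Sigma> A \<alpha> \<Longrightarrow> R \<subseteq> \<alpha> \<Longrightarrow> cong_gen \<Sigma> A R \<subseteq> \<alpha>"
  unfolding cong_gen_def by blast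

lemma cong_gen_mono: "R \<subseteq> R' \<Longrightarrow> cong_gen \<Sigma> A R \<subseteq> cong_gen \<Sigma> A R'"
  unfolding cong_gen_def by blast

lemma cong_gen_subset_iff: "congruence \<Sigma> A \<alpha> \<Longrightarrow> cong_gen \<Sigma> A R \<subseteq> \<alpha> \<longleftrightarrow> R \<subseteq> \<alpha>"
  using cong_gen_incl cong_gen_least by blast

lemma carrier_Con: "carrier (Con \<Sigma> A) = {\<alpha>. congruence \<Sigma> A \<alpha>}"
  by (simp add: Con_def)

lemma carrier_Conc:
  "carrier (Conc \<Sigma> A) = {cong_gen \<Sigma> A R | R. finite R \<and> R \<subseteq> carrier A \<times> carrier A}"
  by (simp add: Conc_def)

lemma principal_cong_in_Conc:
  "x \<in> carrier A \<Longrightarrow> y \<in> carrier A \<Longrightarrow> principal_cong \<Sigma> A x y \<in> carrier (Conc \<Sigma> A)"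
  unfolding carrier_Conc principal_cong_def by blast

lemma Conc_join:
  assumes "algebra_on \<Sigma> A" "finite R" "R \<subseteq> carrier A \<times> carrier A" "finite R'" "R' \<subseteq> carrier A \<times> carrier A"
  shows "cong_gen \<Sigma> A R \<squnion>\<^bsub>Conc \<Sigma> A\<^esub> cong_gen \<Sigma> A R' = cong_gen \<Sigma> A (R \<union> R')"
proof -
  interpret C: partial_order "Conc \<Sigma> A"
    unfolding Conc_def by (rule partial_order_incl_order)
  show ?thesis
  proof (rule C.join_eqI)
    have "cong_gen \<Sigma> A R \<in> carrier (Conc \<Sigma> A)" if "finite R" "R \<subseteq> carrier A \<times> carrier A" for R
      using that by (auto simp: carrier_Conc)
    then show "cong_gen \<Sigma> A R \<in> carrier (Conc \<Sigma> A)" "cong_gen \<Sigma> A R' \<in> carrier (Conc \<Sigma> A)"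
      "cong_gen \<Sigma> A (R \<union> R') \<in> carrier (Conc \<Sigma> A)" using assms by auto
    show "cong_gen \<Sigma> A R \<sqsubseteq>\<^bsub>Conc \<Sigma> A\<^esub> cong_gen \<Sigma> A (R \<union> R')"
      "cong_gen \<Sigma> A R' \<sqsubseteq>\<^bsub>Conc \<Sigma> A\<^esub> cong_gen \<Sigma> A (R \<union> R')"
      by (auto simp: Conc_def cong_gen_def)
    fix \<gamma> assume "\<gamma> \<in> carrier (Conc \<Sigma> A)"
    then have "congruence \<Sigma> A \<gamma>" using cong_gen_congruence[OF assms(1)] by (auto simp: carrier_Conc)
    then show "\<lbrakk>cong_gen \<Sigma> A R \<sqsubseteq>\<^bsub>Conc \<Sigma> A\<^esub> \<gamma>; cong_gen \<Sigma> A R' \<sqsubseteq>\<^bsub>Conc \<Sigma> A\<^esub> \<gamma>\<rbrakk> \<Longrightarrow>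
      cong_gen \<Sigma> A (R \<union> R') \<sqsubseteq>\<^bsub>Conc \<Sigma> A\<^esub> \<gamma>"
      by (simp add: Conc_def cong_gen_subset_iff)
  qed
qed

lemma Conc_bottom:
  assumes "algebra_on \<Sigma> A"
  shows "\<bottom>\<^bsub>Conc \<Sigma> A\<^esub> = cong_gen \<Sigma> A {}"
proof -
  interpret C: partial_order "Conc \<Sigma> A"
    unfolding Conc_def by (rule partial_order_incl_order)
  show ?thesis
    by (rule C.bottom_eqI) (auto simp: Conc_def cong_gen_def)
qed

lemma Conc_congruence:
  "algebra_on \<Sigma> A \<Longrightarrow> \<beta> \<in> carrier (Conc \<Sigma> A) \<Longrightarrow> congruence \<Sigma> A \<beta>"
  using cong_gen_congruence by (auto simp: carrier_Conc)

lemma congruence_vimage: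
  assumes e: "alg_hom \<Sigma> G Q e" and G: "algebra_on \<Sigma> G" and \<gamma>: "congruence \<Sigma> Q \<gamma>"
  shows "congruence \<Sigma> G {(x, y) \<in> carrier G \<times> carrier G. (e x, e y) \<in> \<gamma>}" (is "congruence _ _ ?\<beta>")
proof -
  have ops: "(op G f xs, op G f ys) \<in> ?\<beta>"
    if f: "f \<in> symbols \<Sigma>" and len: "length xs = arity \<Sigma> f" and r: "list_all2 (\<lambda>x y. (x, y) \<in> ?\<beta>) xs ys"
    for f xs ys
  proof -
    from r have c: "set xs \<subseteq> carrier G \<and> set ys \<subseteq> carrier G \<and> length xs = length ys \<and>
      list_all2 (\<lambda>x y. (x, y) \<in> \<gamma>) (map e xs) (map e ys)"
      by (induction rule: list_all2_induct) auto
    then have "(op Q f (map e xs), op Q f (map e ys)) \<in> \<gamma>"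
      using congruence_op[OF \<gamma> f, of "map e xs" "map e ys"] len by simp
    then have "(e (op G f xs), e (op G f ys)) \<in> \<gamma>"
      using alg_hom_op[OF e f] len c by simp
    moreover have "op G f xs \<in> carrier G" "op G f ys \<in> carrier G"
      using G f len c by (auto simp: algebra_on_def)
    ultimately show ?thesis by simp
  qed
  have "(e x, e x) \<in> \<gamma>" if "x \<in> carrier G" for x
    using that congruence_refl[OF \<gamma>] alg_hom_closed[OF e] by blast
  with ops show ?thesis
    by (intro congruenceI) (auto intro: congruence_sym[OF \<gamma>] congruence_trans[OF \<gamma>])
qed

text \<open>Whether a pair lies in the pullback depends only on the images of its entries, so
  preimages may be picked freely and every condition on \<open>\<gamma>\<close> is read off the
  pullback; for transitivity the middle element is lifted once and used in both pairs.\<close>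

lemma congruence_image:
  assumes p: "alg_hom \<Sigma> G Q p" and surj: "p ` carrier G = carrier Q"
    and \<gamma>: "\<gamma> \<subseteq> carrier Q \<times> carrier Q"
    and \<beta>: "congruence \<Sigma> G {(x, y) \<in> carrier G \<times> carrier G. (p x, p y) \<in> \<gamma>}" (is "congruence _ _ ?\<beta>")
  shows "congruence \<Sigma> Q \<gamma>"
proof -
  have rep: "\<exists>x\<in>carrier G. q = p x" if "q \<in> carrier Q" for q using that surj by blast
  have ops: "(op Q f qs, op Q f rs) \<in> \<gamma>"
    if f: "f \<in> symbols \<Sigma>" and len: "length qs = arity \<Sigma> f" and r: "list_all2 (\<lambda>x y. (x, y) \<in> \<gamma>) qs rs"
    for f qs rs
  proof -
    from r \<gamma> have c: "set qs \<subseteq> p ` carrier G \<and> set rs \<subseteq> p ` carrier G"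
      unfolding surj by (induction rule: list_all2_induct) auto
    then obtain xs ys where xs: "set xs \<subseteq> carrier G" "map p xs = qs" and ys: "set ys \<subseteq> carrier G" "map p ys = rs"
      using ex_map_eq by metis
    have "list_all2 (\<lambda>x y. (p x, p y) \<in> \<gamma>) xs ys" using r xs ys by (auto simp: list.rel_map)
    then have "list_all2 (\<lambda>x y. (x, y) \<in> ?\<beta>) xs ys"
      using xs(1) ys(1) by (auto simp: list_all2_conv_all_nth subset_iff)
    then have "(op G f xs, op G f ys) \<in> ?\<beta>"
      using congruence_op[OF \<beta> f] len xs by auto
    moreover have "length xs = arity \<Sigma> f" "length ys = arity \<Sigma> f"
      using len r xs(2) ys(2) by (auto dest!: list_all2_lengthD)
    ultimately show ?thesis
      using alg_hom_op[OF p f] xs ys by force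
  qed
  have "(q, q) \<in> \<gamma>" if q: "q \<in> carrier Q" for q
    using rep[OF q] congruence_refl[OF \<beta>] by auto
  moreover have "(r, q) \<in> \<gamma>" if "(q, r) \<in> \<gamma>" for q r
  proof -
    from that \<gamma> rep obtain x y where "x \<in> carrier G" "y \<in> carrier G" "q = p x" "r = p y" by blast
    then show ?thesis using that congruence_sym[OF \<beta>, of x y] by simp
  qed
  moreover have "(q, s) \<in> \<gamma>" if "(q, r) \<in> \<gamma>" "(r, s) \<in> \<gamma>" for q r s
  proof -
    from that \<gamma> have c: "q \<in> carrier Q" "r \<in> carrier Q" "s \<in> carrier Q" by auto
    from c rep obtain x y z where
      "x \<in> carrier G" "y \<in> carrier G" "z \<in> carrier G" "q = p x" "r = p y" "s = p z" by meson
    then show ?thesis using that congruence_trans[OF \<beta>, of x y z] by simp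
  qed
  ultimately show ?thesis using \<gamma> ops by (intro congruenceI)
qed

section \<open>Quotients of algebras and of subalgebras\<close>

lemma listset_classes:
  "listset (map (\<lambda>x. \<alpha> `` {x}) xs) = {ys. list_all2 (\<lambda>x y. (x, y) \<in> \<alpha>) xs ys}"
  by (induction xs) (auto simp: set_Cons_def list_all2_Cons1)

text \<open>Congruent argument lists have congruent values, so all members of the union in
  \<open>quot_alg\<close> are the same class. The list \<open>xs\<close> itself is one index, which
  keeps the union from being empty.\<close>

lemma quot_alg_hom:
  assumes A: "algebra_on \<Sigma> A" and \<alpha>: "congruence \<Sigma> A \<alpha>"
  shows "alg_hom \<Sigma> A (quot_alg A \<alpha>) (\<lambda>x. \<alpha> `` {x})"
  unfolding alg_hom_def
proof (intro conjI ballI allI impI)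
  show "(\<lambda>x. \<alpha> `` {x}) \<in> carrier A \<rightarrow> carrier (quot_alg A \<alpha>)"
    by (auto simp: quot_alg_def quotient_def)
  fix f xs assume f: "f \<in> symbols \<Sigma>" and xs: "length xs = arity \<Sigma> f \<and> set xs \<subseteq> carrier A"
  have eq: "equiv (carrier A) \<alpha>" using \<alpha> by (simp add: congruence_def)
  have "\<alpha> `` {op A f ys} = \<alpha> `` {op A f xs}" if "list_all2 (\<lambda>x y. (x, y) \<in> \<alpha>) xs ys" for ys
    using equiv_class_eq[OF eq congruence_op[OF \<alpha> f _ that]] xs by simp
  moreover have "list_all2 (\<lambda>x y. (x, y) \<in> \<alpha>) xs xs"
    using xs congruence_refl[OF \<alpha>] by (simp add: list.rel_refl_strong subset_iff)
  ultimately have "(\<Union>ys\<in>{ys. list_all2 (\<lambda>x y. (x, y) \<in> \<alpha>) xs ys}. \<alpha> `` {op A f ys}) = \<alpha> `` {op A f xs}"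
    by (intro SUP_eq_const) blast+
  then show "\<alpha> `` {op A f xs} = op (quot_alg A \<alpha>) f (map (\<lambda>x. \<alpha> `` {x}) xs)"
    unfolding quot_alg_def by (simp add: listset_classes)
qed

lemma quot_alg_surj: "(\<lambda>x. \<alpha> `` {x}) ` carrier A = carrier (quot_alg A \<alpha>)"
  by (auto simp: quot_alg_def quotient_def)

lemma congruence_class_eq_iff:
  "\<lbrakk>congruence \<Sigma> A \<alpha>; x \<in> carrier A; y \<in> carrier A\<rbrakk> \<Longrightarrow> \<alpha> `` {x} = \<alpha> `` {y} \<longleftrightarrow> (x, y) \<in> \<alpha>"
  unfolding congruence_def by (meson eq_equiv_class_iff)

lemma subalg_incl:
  assumes "subalg \<Sigma> A B"
  shows "alg_hom \<Sigma> (A\<lparr>carrier := B\<rparr>) A (\<lambda>x. x)"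
  using assms by (auto simp: alg_hom_def subalg_def)

lemma sub_quot_hom:
  assumes A: "algebra_on \<Sigma> A" and \<alpha>: "congruence \<Sigma> A \<alpha>" and B: "subalg \<Sigma> A B"
  defines "p \<equiv> \<lambda>x. (\<alpha> \<inter> B \<times> B) `` {x}"
  shows "alg_hom \<Sigma> (A\<lparr>carrier := B\<rparr>) (sub_quot A B \<alpha>) p" "p ` B = carrier (sub_quot A B \<alpha>)"
    and "\<And>x y. x \<in> B \<Longrightarrow> y \<in> B \<Longrightarrow> p x = p y \<longleftrightarrow> (x, y) \<in> \<alpha>"
    and "\<And>x. x \<in> B \<Longrightarrow> sub_quot_emb \<alpha> (p x) = \<alpha> `` {x}"
proof -
  have BA: "B \<subseteq> carrier A" and alg: "algebra_on \<Sigma> (A\<lparr>carrier := B\<rparr>)" using B by (auto simp: subalg_def)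
  \<comment> \<open>The restriction of \<open>\<alpha>\<close> is its pullback along the inclusion
    of \<open>B\<close>, hence a congruence.\<close>
  have "{(x, y) \<in> B \<times> B. (x, y) \<in> \<alpha>} = \<alpha> \<inter> B \<times> B" by auto
  with congruence_vimage[OF subalg_incl[OF B] alg \<alpha>]
  have cong: "congruence \<Sigma> (A\<lparr>carrier := B\<rparr>) (\<alpha> \<inter> B \<times> B)" by simp
  show "alg_hom \<Sigma> (A\<lparr>carrier := B\<rparr>) (sub_quot A B \<alpha>) p"
    unfolding sub_quot_def p_def by (rule quot_alg_hom[OF alg cong])
  show "p ` B = carrier (sub_quot A B \<alpha>)"
    unfolding sub_quot_def p_def using quot_alg_surj[of "\<alpha> \<inter> B \<times> B" "A\<lparr>carrier := B\<rparr>"] by simp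
  show "p x = p y \<longleftrightarrow> (x, y) \<in> \<alpha>" if "x \<in> B" "y \<in> B" for x y
    unfolding p_def using congruence_class_eq_iff[OF cong, of x y] that by auto
  show "sub_quot_emb \<alpha> (p x) = \<alpha> `` {x}" if "x \<in> B" for x
  proof
    show "sub_quot_emb \<alpha> (p x) \<subseteq> \<alpha> `` {x}"
      unfolding sub_quot_emb_def p_def using congruence_trans[OF \<alpha>, of x] by blast
    have "(x, x) \<in> \<alpha>" using that BA congruence_refl[OF \<alpha>] by blast
    then show "\<alpha> `` {x} \<subseteq> sub_quot_emb \<alpha> (p x)" using that by (auto simp: sub_quot_emb_def p_def)
  qed
qed

text \<open>Closure of \<open>V\<close> under homomorphic images speaks of algebras over the type of
  \<open>A\<close> only, while \<open>Q\<close> may live elsewhere. A section \<open>s\<close> of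
  \<open>p\<close> brings \<open>Q\<close> back: the copy consists of one representative in
  \<open>A\<close> per element of \<open>Q\<close>, with the operations transported.\<close>

lemma hom_image_copy:
  assumes p: "alg_hom \<Sigma> A Q p" and surj: "p ` carrier A = carrier Q" and A: "algebra_on \<Sigma> A"
    and "A \<in> V" "closed_hom_images \<Sigma> V"
  shows "\<exists>Q'\<in>V. \<exists>h. alg_iso \<Sigma> Q Q' h"
proof -
  define s where "s = inv_into (carrier A) p"
  have s: "s q \<in> carrier A" "p (s q) = q" if "q \<in> carrier Q" for q
    using that surj by (auto simp: s_def inv_into_into f_inv_into_f)
  define Q' where "Q' = A\<lparr>carrier := s ` carrier Q, op := \<lambda>f xs. s (op Q f (map p xs))\<rparr>"
  have Q: "algebra_on \<Sigma> Q" by (rule algebra_on_hom_image[OF p surj A])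
  have hom: "alg_hom \<Sigma> Q Q' s"
    unfolding alg_hom_def
  proof (intro conjI ballI allI impI)
    show "s \<in> carrier Q \<rightarrow> carrier Q'" by (auto simp: Q'_def)
    fix f xs assume "length xs = arity \<Sigma> f \<and> set xs \<subseteq> carrier Q"
    then have "map (p \<circ> s) xs = xs" using s by (intro map_idI) auto
    then show "s (op Q f xs) = op Q' f (map s xs)" by (simp add: Q'_def)
  qed
  have img: "s ` carrier Q = carrier Q'" by (simp add: Q'_def)
  have "inj_on s (carrier Q)" using s by (metis inj_onI)
  then have iso: "alg_iso \<Sigma> Q Q' s"
    using hom img by (auto simp: alg_iso_def bij_betw_def)
  have "alg_hom \<Sigma> A Q' (s \<circ> p)" by (rule alg_hom_comp[OF p hom])
  moreover have "(s \<circ> p) ` carrier A = carrier Q'" using surj img by (metis image_comp)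
  moreover have "algebra_on \<Sigma> Q'" by (rule algebra_on_hom_image[OF hom img Q])
  ultimately have "Q' \<in> V" using assms(4,5) unfolding closed_hom_images_def by blast
  with iso show ?thesis by blast
qed

text \<open>The pairs of \<open>A\<close> whose images lie in the right-hand side form a congruence
  containing \<open>R\<close>, hence containing all of \<open>cong_gen \<Sigma> A R\<close>.
  Principal congruences are thereby sent to principal congruences.\<close>

lemma Con_map_cong_gen:
  assumes h: "alg_hom \<Sigma> A B h" and A: "algebra_on \<Sigma> A" and B: "algebra_on \<Sigma> B"
    and R: "R \<subseteq> carrier A \<times> carrier A"
  shows "Con_map \<Sigma> B h (cong_gen \<Sigma> A R) = cong_gen \<Sigma> B (map_prod h h ` R)"
proof
  have sub: "map_prod h h ` X \<subseteq> carrier B \<times> carrier B" if "X \<subseteq> carrier A \<times> carrier A" for X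
    using that alg_hom_closed[OF h] by auto
  have c: "congruence \<Sigma> B (cong_gen \<Sigma> B (map_prod h h ` R))" (is "congruence _ _ ?\<gamma>")
    by (rule cong_gen_congruence[OF B sub[OF R]])
  have "cong_gen \<Sigma> A R \<subseteq> {(x, y) \<in> carrier A \<times> carrier A. (h x, h y) \<in> ?\<gamma>}"
    using R cong_gen_incl[of "map_prod h h ` R" \<Sigma> B]
    by (intro cong_gen_least congruence_vimage[OF h A c]) auto
  then have "map_prod h h ` cong_gen \<Sigma> A R \<subseteq> ?\<gamma>" by auto
  then show "Con_map \<Sigma> B h (cong_gen \<Sigma> A R) \<subseteq> ?\<gamma>"
    unfolding Con_map_def by (rule cong_gen_least[OF c])
  have "map_prod h h ` R \<subseteq> map_prod h h ` cong_gen \<Sigma> A R" using cong_gen_incl by (intro image_mono)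
  then show "?\<gamma> \<subseteq> Con_map \<Sigma> B h (cong_gen \<Sigma> A R)"
    unfolding Con_map_def by (rule cong_gen_mono)
qed

section \<open>Semilattice-valued distances representing congruences\<close>

definition dist_rel :: "'a set \<Rightarrow> ('a \<Rightarrow> 'a \<Rightarrow> 's) \<Rightarrow> 's set \<Rightarrow> ('a \<times> 'a) set" where
  "dist_rel G \<delta> X = {(x, y) \<in> G \<times> G. \<delta> x y \<in> X}"

text \<open>
  \<open>\<delta>\<close> represents \<open>L\<close> modulo \<open>\<alpha>\<close> if \<open>dist_rel\<close> is an order isomorphism from the ideals of \<open>L\<close> onto
  the congruences containing \<open>\<alpha>\<close>. That \<open>dist_rel X\<close> contains \<open>\<alpha>\<close> is left out; where needed, it
  follows from \<open>dist_rel {\<bottom>} = \<alpha>\<close>.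
\<close>

definition represents ::
  "'f signature \<Rightarrow> ('f, 'a) alg \<Rightarrow> ('a \<times> 'a) set \<Rightarrow> 's gorder \<Rightarrow> ('a \<Rightarrow> 'a \<Rightarrow> 's) \<Rightarrow> bool" where
  "represents \<Sigma> G \<alpha> L \<delta> \<longleftrightarrow>
     (\<forall>x\<in>carrier G. \<forall>y\<in>carrier G. \<delta> x y \<in> carrier L) \<and>
     (\<forall>X. poset_ideal L X \<longrightarrow> congruence \<Sigma> G (dist_rel (carrier G) \<delta> X)) \<and>
     (\<forall>\<gamma>. congruence \<Sigma> G \<gamma> \<and> \<alpha> \<subseteq> \<gamma> \<longrightarrow> (\<exists>X. poset_ideal L X \<and> dist_rel (carrier G) \<delta> X = \<gamma>)) \<and>
     (\<forall>X Y. poset_ideal L X \<and> poset_ideal L Y \<and> dist_rel (carrier G) \<delta> X \<subseteq> dist_rel (carrier G) \<delta> Y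
        \<longrightarrow> X \<subseteq> Y)"

lemma representsD:
  assumes "represents \<Sigma> G \<alpha> L \<delta>"
  shows "\<And>x y. x \<in> carrier G \<Longrightarrow> y \<in> carrier G \<Longrightarrow> \<delta> x y \<in> carrier L"
    and "\<And>X. poset_ideal L X \<Longrightarrow> congruence \<Sigma> G (dist_rel (carrier G) \<delta> X)"
    and "\<And>\<gamma>. congruence \<Sigma> G \<gamma> \<Longrightarrow> \<alpha> \<subseteq> \<gamma> \<Longrightarrow> \<exists>X. poset_ideal L X \<and> dist_rel (carrier G) \<delta> X = \<gamma>"
    and "\<And>X Y. \<lbrakk>poset_ideal L X; poset_ideal L Y; dist_rel (carrier G) \<delta> X \<subseteq> dist_rel (carrier G) \<delta> Y\<rbrakk>
      \<Longrightarrow> X \<subseteq> Y"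
  using assms by (simp_all add: represents_def)

text \<open>No triangle inequality is assumed; its role is played by the relation of the principal
  ideal below \<open>\<delta> a a'\<close>. This is a congruence containing \<open>(a, b)\<close>,
  \<open>(a', b')\<close> and \<open>(a, a')\<close>, hence \<open>(b, b')\<close>. So
  \<open>\<delta>\<close> is constant on classes of its zero relation and descends to the
  quotient.\<close>

lemma represents_dist_eq:
  assumes "join_semilattice0 L" and rep: "represents \<Sigma> G \<alpha> L \<delta>"
    and x: "(x, x') \<in> dist_rel (carrier G) \<delta> {\<bottom>\<^bsub>L\<^esub>}" and y: "(y, y') \<in> dist_rel (carrier G) \<delta> {\<bottom>\<^bsub>L\<^esub>}"
  shows "\<delta> x y = \<delta> x' y'"
proof -
  interpret L: semilattice0 L by standard fact
  note C = representsD(2)[OF rep]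
  have le: "\<delta> b b' \<sqsubseteq>\<^bsub>L\<^esub> \<delta> a a'"
    if a: "(a, b) \<in> dist_rel (carrier G) \<delta> {\<bottom>\<^bsub>L\<^esub>}" and a': "(a', b') \<in> dist_rel (carrier G) \<delta> {\<bottom>\<^bsub>L\<^esub>}"
    for a b a' b'
  proof -
    have c: "a \<in> carrier G" "b \<in> carrier G" "a' \<in> carrier G" "b' \<in> carrier G"
      using a a' by (auto simp: dist_rel_def)
    then have d: "\<delta> a a' \<in> carrier L" using representsD(1)[OF rep] by blast
    let ?R = "dist_rel (carrier G) \<delta> (down L (\<delta> a a'))"
    have R: "congruence \<Sigma> G ?R" using C L.ideal_down_set[OF d] by blast
    have "(a, b) \<in> ?R" "(a', b') \<in> ?R" "(a, a') \<in> ?R"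
      using a a' c d by (auto simp: dist_rel_def down_def)
    then have "(b, b') \<in> ?R"
      using congruence_sym[OF R] congruence_trans[OF R] by meson
    then show ?thesis by (simp add: dist_rel_def down_def)
  qed
  have "poset_ideal L {\<bottom>\<^bsub>L\<^esub>}"
    using L.ideal_down_set[of "\<bottom>\<^bsub>L\<^esub>"] L.le_bottom_iff by (auto simp: down_def cong: conj_cong)
  from congruence_sym[OF C[OF this]] x y
  have "(x', x) \<in> dist_rel (carrier G) \<delta> {\<bottom>\<^bsub>L\<^esub>}" "(y', y) \<in> dist_rel (carrier G) \<delta> {\<bottom>\<^bsub>L\<^esub>}" by auto
  with le x y have "\<delta> x' y' \<sqsubseteq>\<^bsub>L\<^esub> \<delta> x y" "\<delta> x y \<sqsubseteq>\<^bsub>L\<^esub> \<delta> x' y'" by auto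
  moreover have "\<delta> x y \<in> carrier L" "\<delta> x' y' \<in> carrier L"
    using x y representsD(1)[OF rep] by (auto simp: dist_rel_def)
  ultimately show ?thesis by (intro L.le_antisym)
qed

text \<open>Pulling back along \<open>p\<close> turns the relations of \<open>\<delta>'\<close> into
  those of \<open>\<delta>\<close>. Since \<open>p\<close> collapses \<open>\<alpha>\<close>, every
  pulled-back congruence lies above \<open>\<alpha>\<close>; this is why the lower bound for the
  target is the empty set, which every congruence contains.\<close>

lemma represents_image:
  assumes rep: "represents \<Sigma> G \<alpha> L \<delta>" and p: "alg_hom \<Sigma> G Q p" and surj: "p ` carrier G = carrier Q"
    and G: "algebra_on \<Sigma> G" and \<alpha>: "\<alpha> \<subseteq> carrier G \<times> carrier G"
    and ker: "\<And>x y. (x, y) \<in> \<alpha> \<Longrightarrow> p x = p y"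
    and \<delta>': "\<And>x y. x \<in> carrier G \<Longrightarrow> y \<in> carrier G \<Longrightarrow> \<delta>' (p x) (p y) = \<delta> x y"
  shows "represents \<Sigma> Q {} L \<delta>'"
proof -
  let ?RG = "dist_rel (carrier G) \<delta>" and ?RQ = "dist_rel (carrier Q) \<delta>'"
  have pull: "{(x, y) \<in> carrier G \<times> carrier G. (p x, p y) \<in> ?RQ X} = ?RG X" for X
    using \<delta>' alg_hom_closed[OF p] by (auto simp: dist_rel_def)
  have rep_pair: "\<exists>x\<in>carrier G. \<exists>y\<in>carrier G. a = p x \<and> b = p y" if "a \<in> carrier Q" "b \<in> carrier Q" for a b
    using that surj by blast
  show ?thesis
    unfolding represents_def
  proof (intro conjI ballI allI impI)
    fix a b assume "a \<in> carrier Q" "b \<in> carrier Q"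
    then show "\<delta>' a b \<in> carrier L" using rep_pair \<delta>' representsD(1)[OF rep] by metis
  next
    fix X assume "poset_ideal L X"
    then have "congruence \<Sigma> G (?RG X)" by (rule representsD(2)[OF rep])
    then show "congruence \<Sigma> Q (?RQ X)"
      by (intro congruence_image[OF p surj]) (unfold pull, auto simp: dist_rel_def)
  next
    fix \<gamma> assume \<gamma>: "congruence \<Sigma> Q \<gamma> \<and> {} \<subseteq> \<gamma>"
    let ?\<beta> = "{(x, y) \<in> carrier G \<times> carrier G. (p x, p y) \<in> \<gamma>}"
    have "congruence \<Sigma> G ?\<beta>" using congruence_vimage[OF p G] \<gamma> by blast
    moreover have "\<alpha> \<subseteq> ?\<beta>"
    proof
      fix z assume "z \<in> \<alpha>"
      then obtain x y where z: "z = (x, y)" "(x, y) \<in> \<alpha>" by (cases z) auto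
      then have "x \<in> carrier G" "y \<in> carrier G" using \<alpha> by auto
      moreover have "(p x, p y) \<in> \<gamma>"
        using ker[OF z(2)] congruence_refl[OF conjunct1[OF \<gamma>]] alg_hom_closed[OF p \<open>y \<in> carrier G\<close>] by simp
      ultimately show "z \<in> ?\<beta>" using z by simp
    qed
    ultimately obtain X where X: "poset_ideal L X" "?RG X = ?\<beta>" using representsD(3)[OF rep] by blast
    have "(a, b) \<in> ?RQ X \<longleftrightarrow> (a, b) \<in> \<gamma>" for a b
    proof (cases "a \<in> carrier Q \<and> b \<in> carrier Q")
      case True
      then obtain x y where xy: "x \<in> carrier G" "y \<in> carrier G" "a = p x" "b = p y" using rep_pair by blast
      then have "(a, b) \<in> ?RQ X \<longleftrightarrow> (x, y) \<in> ?RG X" using pull[of X] by auto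
      then show ?thesis using X xy by simp
    next
      case False
      then show ?thesis using congruence_carrier[OF conjunct1[OF \<gamma>]] by (auto simp: dist_rel_def)
    qed
    then have "?RQ X = \<gamma>" by auto
    with X show "\<exists>X. poset_ideal L X \<and> ?RQ X = \<gamma>" by blast
  next
    fix X Y assume XY: "poset_ideal L X \<and> poset_ideal L Y \<and> ?RQ X \<subseteq> ?RQ Y"
    then have "?RG X \<subseteq> ?RG Y" using pull[of X] pull[of Y] by blast
    with XY show "X \<subseteq> Y" using representsD(4)[OF rep] by blast
  qed
qed

text \<open>The adjunction between generating a congruence in the target and pulling one back to the
  source.\<close>

lemma Con_map_subset_iff:
  assumes e: "alg_hom \<Sigma> G Q e" and \<beta>: "congruence \<Sigma> G \<beta>" and \<gamma>: "congruence \<Sigma> Q \<gamma>"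
  shows "Con_map \<Sigma> Q e \<beta> \<subseteq> \<gamma> \<longleftrightarrow> \<beta> \<subseteq> {(x, y) \<in> carrier G \<times> carrier G. (e x, e y) \<in> \<gamma>}"
  unfolding Con_map_def cong_gen_subset_iff[OF \<gamma>] using congruence_carrier[OF \<beta>] by auto

lemma order_iso_incl_orderD:
  assumes "order_iso (incl_order P) (incl_order Q) f"
  shows "\<And>x. x \<in> P \<Longrightarrow> f x \<in> Q" "\<And>y. y \<in> Q \<Longrightarrow> \<exists>x\<in>P. f x = y"
    and "\<And>x y. x \<in> P \<Longrightarrow> y \<in> P \<Longrightarrow> f x \<subseteq> f y \<longleftrightarrow> x \<subseteq> y"
  using assms by (auto simp: order_iso_def order_emb_def bij_betw_def image_iff)

text \<open>A right adjoint of an order isomorphism is its inverse. The isomorphisms given by the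
  hypotheses thus get explicit inverses, namely pullbacks of congruences or of ideals.\<close>

lemma order_iso_upper_adjoint:
  assumes iso: "order_iso (incl_order P) (incl_order Q) f"
    and adj: "\<forall>x\<in>P. \<forall>y\<in>Q. f x \<subseteq> y \<longleftrightarrow> x \<subseteq> g y" and g: "\<forall>y\<in>Q. g y \<in> P"
  shows "y \<in> Q \<Longrightarrow> f (g y) = y" "x \<in> P \<Longrightarrow> g (f x) = x"
proof -
  note I = order_iso_incl_orderD[OF iso]
  show gf: "g (f x) = x" if "x \<in> P" for x
    using I(1,3) adj g that by (metis order_refl subset_antisym)
  show "f (g y) = y" if "y \<in> Q" for y
    using I(2)[OF that] gf by metis
qed

text \<open>Here \<open>e\<close> is an embedding of a smaller algebra and usually not onto. The
  isomorphism of congruence lattices replaces surjectivity: it makes pullback along \<open>e\<close>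
  a bijection on congruences, so the same ideals of \<open>L\<close> represent the congruences of
  \<open>G\<close>.\<close>

lemma represents_restrict:
  assumes rep: "represents \<Sigma> Q {} L \<delta>" and e: "alg_hom \<Sigma> G Q e" and G: "algebra_on \<Sigma> G"
    and iso: "order_iso (Con \<Sigma> G) (Con \<Sigma> Q) (Con_map \<Sigma> Q e)"
  shows "represents \<Sigma> G {} L (\<lambda>x y. \<delta> (e x) (e y))"
proof -
  let ?RG = "dist_rel (carrier G) (\<lambda>x y. \<delta> (e x) (e y))" and ?RQ = "dist_rel (carrier Q) \<delta>"
  let ?g = "\<lambda>\<gamma>. {(x, y) \<in> carrier G \<times> carrier G. (e x, e y) \<in> \<gamma>}"
  have pull: "?g (?RQ X) = ?RG X" for X
    using alg_hom_closed[OF e] by (auto simp: dist_rel_def)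
  have "congruence \<Sigma> G \<beta> \<Longrightarrow> congruence \<Sigma> Q \<gamma> \<Longrightarrow> Con_map \<Sigma> Q e \<beta> \<subseteq> \<gamma> \<longleftrightarrow> \<beta> \<subseteq> ?g \<gamma>" for \<beta> \<gamma>
    by (rule Con_map_subset_iff[OF e])
  moreover have g: "congruence \<Sigma> Q \<gamma> \<Longrightarrow> congruence \<Sigma> G (?g \<gamma>)" for \<gamma>
    by (rule congruence_vimage[OF e G])
  ultimately have inv: "congruence \<Sigma> Q \<gamma> \<Longrightarrow> Con_map \<Sigma> Q e (?g \<gamma>) = \<gamma>"
    "congruence \<Sigma> G \<beta> \<Longrightarrow> ?g (Con_map \<Sigma> Q e \<beta>) = \<beta>" for \<beta> \<gamma>
    using order_iso_upper_adjoint[OF iso[unfolded Con_def], of ?g] by simp_all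
  have map: "congruence \<Sigma> Q (Con_map \<Sigma> Q e \<beta>)" if "congruence \<Sigma> G \<beta>" for \<beta>
    using order_iso_incl_orderD(1)[OF iso[unfolded Con_def], of \<beta>] that by simp
  show ?thesis
    unfolding represents_def
  proof (intro conjI ballI allI impI)
    fix x y assume "x \<in> carrier G" "y \<in> carrier G"
    then show "\<delta> (e x) (e y) \<in> carrier L" using representsD(1)[OF rep] alg_hom_closed[OF e] by blast
  next
    fix X assume "poset_ideal L X"
    then show "congruence \<Sigma> G (?RG X)" using g[OF representsD(2)[OF rep]] pull by simp
  next
    fix \<beta> assume \<beta>: "congruence \<Sigma> G \<beta> \<and> {} \<subseteq> \<beta>"
    then obtain X where X: "poset_ideal L X" "?RQ X = Con_map \<Sigma> Q e \<beta>"
      using representsD(3)[OF rep map] by blast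
    have "?RG X = \<beta>" using inv(2)[OF conjunct1[OF \<beta>]] pull[of X] X(2) by simp
    with X show "\<exists>X. poset_ideal L X \<and> ?RG X = \<beta>" by blast
  next
    fix X Y assume XY: "poset_ideal L X \<and> poset_ideal L Y \<and> ?RG X \<subseteq> ?RG Y"
    then have c: "congruence \<Sigma> Q (?RQ X)" "congruence \<Sigma> Q (?RQ Y)"
      using representsD(2)[OF rep] by simp_all
    have "?g (?RQ X) \<subseteq> ?g (?RQ Y)" using XY unfolding pull by simp
    then have "Con_map \<Sigma> Q e (?g (?RQ X)) \<subseteq> ?RQ Y"
      by (simp only: Con_map_subset_iff[OF e g[OF c(1)] c(2)])
    then have "?RQ X \<subseteq> ?RQ Y" unfolding inv(1)[OF c(1)] .
    with XY show "X \<subseteq> Y" using representsD(4)[OF rep] by blast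
  qed
qed

section \<open>Compact congruences as elements of the representing semilattice\<close>

definition cong_rank :: "('f, 'a) alg \<Rightarrow> 's gorder \<Rightarrow> ('a \<Rightarrow> 'a \<Rightarrow> 's) \<Rightarrow> ('a \<times> 'a) set \<Rightarrow> 's" where
  "cong_rank Q L \<delta> \<beta> = (THE d. d \<in> carrier L \<and> dist_rel (carrier Q) \<delta> (down L d) = \<beta>)"

locale representation =
  fixes \<Sigma> :: "'f signature" and Q :: "('f, 'a) alg" and L :: "'s gorder" and \<delta> :: "'a \<Rightarrow> 'a \<Rightarrow> 's"
  assumes L: "join_semilattice0 L" and Q: "algebra_on \<Sigma> Q" and rep: "represents \<Sigma> Q {} L \<delta>"
begin

sublocale L: semilattice0 L by standard (rule L)

abbreviation "rel \<equiv> dist_rel (carrier Q) \<delta>"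

text \<open>\<open>dist_rel\<close> reflects inclusion of ideals, so comparing congruences becomes a
  question of membership in an ideal.\<close>

lemma rel_down_subset_iff:
  assumes d: "d \<in> carrier L" and X: "poset_ideal L X"
  shows "rel (down L d) \<subseteq> rel X \<longleftrightarrow> d \<in> X"
proof -
  have "rel (down L d) \<subseteq> rel X \<longleftrightarrow> down L d \<subseteq> X"
    using representsD(4)[OF rep L.ideal_down_set[OF d] X] by (auto simp: dist_rel_def)
  then show ?thesis using L.down_subset_iff[OF X d] by simp
qed

lemma rel_down_le_iff:
  "\<lbrakk>d \<in> carrier L; e \<in> carrier L\<rbrakk> \<Longrightarrow> rel (down L d) \<subseteq> rel (down L e) \<longleftrightarrow> d \<sqsubseteq>\<^bsub>L\<^esub> e"
  using rel_down_subset_iff[OF _ L.ideal_down_set] by (simp add: down_def)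

lemma rel_down_inj:
  assumes "d \<in> carrier L" "e \<in> carrier L" "rel (down L d) = rel (down L e)"
  shows "d = e"
proof (rule L.le_antisym)
  show "d \<sqsubseteq>\<^bsub>L\<^esub> e" "e \<sqsubseteq>\<^bsub>L\<^esub> d"
    using equalityD1[OF assms(3)] equalityD2[OF assms(3)] assms(1,2) by (simp_all only: rel_down_le_iff)
qed fact+

lemma cong_rank_rel: "d \<in> carrier L \<Longrightarrow> cong_rank Q L \<delta> (rel (down L d)) = d"
  unfolding cong_rank_def by (rule the_equality) (simp, erule conjE, rule rel_down_inj)

text \<open>The generated congruence is \<open>rel Y\<close> for some ideal \<open>Y\<close>. The
  distances of the finitely many generators lie in \<open>Y\<close>, so directedness gives one
  \<open>d\<close> in \<open>Y\<close> above them all, and the generated congruence is squeezed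
  between \<open>rel (down L d)\<close> and itself.\<close>

lemma compact_rel_down:
  assumes "finite R" "R \<subseteq> carrier Q \<times> carrier Q"
  shows "\<exists>d\<in>carrier L. cong_gen \<Sigma> Q R = rel (down L d)"
proof -
  obtain Y where Y: "poset_ideal L Y" "rel Y = cong_gen \<Sigma> Q R"
    using representsD(3)[OF rep cong_gen_congruence[OF Q assms(2)]] by auto
  have "(\<lambda>(x, y). \<delta> x y) ` R \<subseteq> Y"
    using Y(2) cong_gen_incl[of R \<Sigma> Q] by (auto simp: dist_rel_def)
  then obtain d where d: "d \<in> Y" "\<forall>z\<in>(\<lambda>(x, y). \<delta> x y) ` R. z \<sqsubseteq>\<^bsub>L\<^esub> d"
    using ideal_finite_ub[OF L.partial_order_axioms Y(1)] assms(1) by (metis finite_imageI)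
  have dc: "d \<in> carrier L" using Y d ideal_subset by metis
  have "R \<subseteq> rel (down L d)"
    using d(2) assms(2) representsD(1)[OF rep] by (fastforce simp: dist_rel_def down_def)
  then have "cong_gen \<Sigma> Q R \<subseteq> rel (down L d)"
    using representsD(2)[OF rep L.ideal_down_set[OF dc]] by (intro cong_gen_least)
  moreover have "rel (down L d) \<subseteq> cong_gen \<Sigma> Q R"
    using rel_down_subset_iff[OF dc Y(1)] d Y by simp
  ultimately show ?thesis using dc by blast
qed

text \<open>
  The ideals generated by the distances of finitely many pairs of \<open>rel (down L d)\<close> form a directed
  family whose union contains \<open>d\<close>; hence one of them does.
\<close>

lemma rel_down_compact:
  assumes d: "d \<in> carrier L"
  shows "rel (down L d) \<in> carrier (Conc \<Sigma> Q)"
proof -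
  define X where "X = {e \<in> carrier L. \<exists>R. finite R \<and> R \<subseteq> rel (down L d) \<and>
    (\<forall>Y. poset_ideal L Y \<longrightarrow> R \<subseteq> rel Y \<longrightarrow> e \<in> Y)}"
  have X: "poset_ideal L X"
    unfolding L.ideal_iff
  proof (intro conjI ballI impI)
    show "X \<subseteq> carrier L" by (auto simp: X_def)
    have "finite {}" by simp
    then show "\<bottom>\<^bsub>L\<^esub> \<in> X"
      unfolding X_def using L.ideal_bottom by blast
    fix a b assume a: "a \<in> X" and "b \<in> X"
    then obtain R S where R: "finite R" "R \<subseteq> rel (down L d)" "\<And>Y. poset_ideal L Y \<Longrightarrow> R \<subseteq> rel Y \<Longrightarrow> a \<in> Y"
      and S: "finite S" "S \<subseteq> rel (down L d)" "\<And>Y. poset_ideal L Y \<Longrightarrow> S \<subseteq> rel Y \<Longrightarrow> b \<in> Y"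
      unfolding X_def by blast
    have "finite (R \<union> S)" "R \<union> S \<subseteq> rel (down L d)" using R S by auto
    moreover have "a \<squnion>\<^bsub>L\<^esub> b \<in> Y" if "poset_ideal L Y" "R \<union> S \<subseteq> rel Y" for Y
      using that R(3) S(3) L.ideal_join by simp
    ultimately show "a \<squnion>\<^bsub>L\<^esub> b \<in> X"
      using a \<open>b \<in> X\<close> L.join_closed[of a b] unfolding X_def
      by (intro CollectI conjI exI[of _ "R \<union> S"] allI impI) simp_all
  next
    fix a b assume "a \<in> X" "b \<in> carrier L" "b \<sqsubseteq>\<^bsub>L\<^esub> a"
    then show "b \<in> X" unfolding X_def mem_Collect_eq by (meson L.ideal_down)
  qed
  have "rel (down L d) \<subseteq> rel X"
  proof
    fix z assume z: "z \<in> rel (down L d)"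
    then obtain x y where xy: "z = (x, y)" "x \<in> carrier Q" "y \<in> carrier Q"
      by (auto simp: dist_rel_def)
    have "\<delta> x y \<in> X"
      unfolding X_def using z xy representsD(1)[OF rep]
      by (auto simp: dist_rel_def intro!: exI[of _ "{(x, y)}"])
    then show "z \<in> rel X" using xy by (simp add: dist_rel_def)
  qed
  then have "d \<in> X" using rel_down_subset_iff[OF d X] by blast
  then obtain R where R: "finite R" "R \<subseteq> rel (down L d)"
    "\<And>Y. poset_ideal L Y \<Longrightarrow> R \<subseteq> rel Y \<Longrightarrow> d \<in> Y" unfolding X_def by blast
  have Rc: "R \<subseteq> carrier Q \<times> carrier Q" using R(2) by (auto simp: dist_rel_def)
  obtain Y where Y: "poset_ideal L Y" "rel Y = cong_gen \<Sigma> Q R"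
    using representsD(3)[OF rep cong_gen_congruence[OF Q Rc]] by auto
  then have "d \<in> Y" using R(3) cong_gen_incl by metis
  then have "rel (down L d) \<subseteq> cong_gen \<Sigma> Q R" using rel_down_subset_iff[OF d Y(1)] Y(2) by simp
  moreover have "cong_gen \<Sigma> Q R \<subseteq> rel (down L d)"
    by (rule cong_gen_least[OF representsD(2)[OF rep L.ideal_down_set[OF d]] R(2)])
  ultimately show ?thesis using R(1) Rc unfolding carrier_Conc by blast
qed

lemma carrier_Conc_eq: "carrier (Conc \<Sigma> Q) = (\<lambda>d. rel (down L d)) ` carrier L"
proof
  show "carrier (Conc \<Sigma> Q) \<subseteq> (\<lambda>d. rel (down L d)) ` carrier L"
    unfolding carrier_Conc using compact_rel_down by blast
qed (use rel_down_compact in blast)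

lemma cong_rank_bij: "bij_betw (cong_rank Q L \<delta>) (carrier (Conc \<Sigma> Q)) (carrier L)"
  unfolding carrier_Conc_eq
  by (rule bij_betw_byWitness[where f' = "\<lambda>d. rel (down L d)"]) (auto simp: cong_rank_rel)

lemma cong_rank:
  assumes "\<beta> \<in> carrier (Conc \<Sigma> Q)"
  shows "cong_rank Q L \<delta> \<beta> \<in> carrier L" "rel (down L (cong_rank Q L \<delta> \<beta>)) = \<beta>"
  using assms by (auto simp: carrier_Conc_eq cong_rank_rel)

text \<open>The inverse, sending \<open>d\<close> to \<open>rel (down L d)\<close>, preserves and
  reflects order, and joins and bottoms are determined by order. These maps will be the components
  of the natural isomorphism that the lifting requires.\<close>

lemma cong_rank_iso: "sl_iso (Conc \<Sigma> Q) L (cong_rank Q L \<delta>)"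
  unfolding sl_iso_def sl_hom_def
proof (intro conjI ballI)
  show bij: "bij_betw (cong_rank Q L \<delta>) (carrier (Conc \<Sigma> Q)) (carrier L)" by (rule cong_rank_bij)
  then show "cong_rank Q L \<delta> \<in> carrier (Conc \<Sigma> Q) \<rightarrow> carrier L" by (rule bij_betw_imp_funcset)
  interpret C: partial_order "Conc \<Sigma> Q"
    unfolding Conc_def by (rule partial_order_incl_order)
  have le: "\<beta> \<sqsubseteq>\<^bsub>Conc \<Sigma> Q\<^esub> \<gamma> \<longleftrightarrow> \<beta> \<subseteq> \<gamma>" for \<beta> \<gamma> by (simp add: Conc_def)
  note iff = rel_down_le_iff
  have "\<bottom>\<^bsub>Conc \<Sigma> Q\<^esub> = rel (down L \<bottom>\<^bsub>L\<^esub>)"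
    by (rule C.bottom_eqI) (use iff in \<open>auto simp: carrier_Conc_eq le\<close>)
  then show "cong_rank Q L \<delta> \<bottom>\<^bsub>Conc \<Sigma> Q\<^esub> = \<bottom>\<^bsub>L\<^esub>" by (simp add: cong_rank_rel)
  fix \<beta> \<gamma> assume "\<beta> \<in> carrier (Conc \<Sigma> Q)" "\<gamma> \<in> carrier (Conc \<Sigma> Q)"
  then obtain d e where d: "d \<in> carrier L" "\<beta> = rel (down L d)" and e: "e \<in> carrier L" "\<gamma> = rel (down L e)"
    by (auto simp: carrier_Conc_eq)
  have "\<beta> \<squnion>\<^bsub>Conc \<Sigma> Q\<^esub> \<gamma> = rel (down L (d \<squnion>\<^bsub>L\<^esub> e))"
  proof (rule C.join_eqI)
    fix \<epsilon> assume \<epsilon>: "\<epsilon> \<in> carrier (Conc \<Sigma> Q)" "\<beta> \<sqsubseteq>\<^bsub>Conc \<Sigma> Q\<^esub> \<epsilon>" "\<gamma> \<sqsubseteq>\<^bsub>Conc \<Sigma> Q\<^esub> \<epsilon>"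
    then obtain c where "c \<in> carrier L" "\<epsilon> = rel (down L c)" by (auto simp: carrier_Conc_eq)
    then show "rel (down L (d \<squnion>\<^bsub>L\<^esub> e)) \<sqsubseteq>\<^bsub>Conc \<Sigma> Q\<^esub> \<epsilon>"
      using \<epsilon>(2,3) d e iff by (auto simp: le intro: L.join_le)
  qed (use d e in \<open>simp_all add: carrier_Conc_eq le iff L.join_left L.join_right\<close>)
  then show "cong_rank Q L \<delta> (\<beta> \<squnion>\<^bsub>Conc \<Sigma> Q\<^esub> \<gamma>) = cong_rank Q L \<delta> \<beta> \<squnion>\<^bsub>L\<^esub> cong_rank Q L \<delta> \<gamma>"
    using d e by (simp add: cong_rank_rel)
qed

end

text \<open>With \<open>\<beta> = rel (down L d)\<close>, the claim is that its image generates the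
  relation of \<open>\<phi> d\<close>. One inclusion is monotonicity of \<open>\<phi>\<close>. For
  the other, the generated congruence is the relation of an ideal \<open>X\<close>, and it must be
  shown that \<open>X\<close> contains \<open>\<phi> d\<close> itself, although \<open>d\<close>
  need not be a distance.\<close>

lemma cong_rank_natural:
  assumes "representation \<Sigma> Q L \<delta>" "representation \<Sigma> Q' L' \<delta>'"
    and f: "alg_hom \<Sigma> Q Q' f" and \<phi>: "sl_hom L L' \<phi>"
    and \<delta>: "\<And>x y. x \<in> carrier Q \<Longrightarrow> y \<in> carrier Q \<Longrightarrow> \<delta>' (f x) (f y) = \<phi> (\<delta> x y)"
    and \<beta>: "\<beta> \<in> carrier (Conc \<Sigma> Q)"
  shows "cong_rank Q' L' \<delta>' (Con_map \<Sigma> Q' f \<beta>) = \<phi> (cong_rank Q L \<delta> \<beta>)"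
proof -
  interpret A: representation \<Sigma> Q L \<delta> by fact
  interpret B: representation \<Sigma> Q' L' \<delta>' by fact
  obtain d where d: "d \<in> carrier L" "\<beta> = A.rel (down L d)" using \<beta> by (auto simp: A.carrier_Conc_eq)
  have \<phi>d: "\<phi> d \<in> carrier L'" using sl_hom_closed[OF \<phi>] d by blast
  have pairs: "map_prod f f ` \<beta> \<subseteq> carrier Q' \<times> carrier Q'"
    using d alg_hom_closed[OF f] by (auto simp: dist_rel_def)
  obtain X where X: "poset_ideal L' X" "B.rel X = Con_map \<Sigma> Q' f \<beta>"
    using representsD(3)[OF B.rep cong_gen_congruence[OF B.Q pairs]] unfolding Con_map_def by auto
  have "map_prod f f ` \<beta> \<subseteq> B.rel (down L' (\<phi> d))"
    using d \<delta> sl_hom_mono[OF A.L B.L \<phi>] alg_hom_closed[OF f] sl_hom_closed[OF \<phi>]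
    by (auto simp: dist_rel_def down_def)
  then have "B.rel X \<subseteq> B.rel (down L' (\<phi> d))"
    unfolding X(2) Con_map_def
    by (rule cong_gen_least[OF representsD(2)[OF B.rep B.L.ideal_down_set[OF \<phi>d]]])
  moreover have "B.rel (down L' (\<phi> d)) \<subseteq> B.rel X"
  proof -
    \<comment> \<open>The preimage of \<open>X\<close> under \<open>\<phi>\<close> is an ideal whose
      relation contains that of \<open>down L d\<close>; since relations reflect inclusion of
      ideals, it contains \<open>d\<close>.\<close>
    have "A.rel (down L d) \<subseteq> A.rel {e \<in> carrier L. \<phi> e \<in> X}"
    proof
      fix z assume z: "z \<in> A.rel (down L d)"
      then obtain x y where xy: "z = (x, y)" "x \<in> carrier Q" "y \<in> carrier Q" by (auto simp: dist_rel_def)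
      have "map_prod f f z \<in> B.rel X"
        unfolding X(2) Con_map_def using z d cong_gen_incl by blast
      then show "z \<in> A.rel {e \<in> carrier L. \<phi> e \<in> X}"
        using xy \<delta> representsD(1)[OF A.rep] by (auto simp: dist_rel_def)
    qed
    then have "d \<in> {e \<in> carrier L. \<phi> e \<in> X}"
      using A.rel_down_subset_iff[OF d(1) ideal_vimage[OF A.L B.L \<phi> X(1)]] by blast
    then show ?thesis using B.rel_down_subset_iff[OF \<phi>d X(1)] by simp
  qed
  ultimately have "Con_map \<Sigma> Q' f \<beta> = B.rel (down L' (\<phi> d))" using X(2) by auto
  then show ?thesis using d \<phi>d by (simp add: A.cong_rank_rel B.cong_rank_rel)
qed

section \<open>Kernels and condensates\<close>

lemma functorD:
  assumes "is_functor K K' F"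
  shows "\<And>x. x \<in> Ob K \<Longrightarrow> fob F x \<in> Ob K'"
    and "\<And>x y f. \<lbrakk>x \<in> Ob K; y \<in> Ob K; f \<in> Hom K x y\<rbrakk> \<Longrightarrow> fmor F x y f \<in> Hom K' (fob F x) (fob F y)"
    and "\<And>x. x \<in> Ob K \<Longrightarrow> fmor F x x (Idm K x) = Idm K' (fob F x)"
    and "\<And>x y z f g. \<lbrakk>x \<in> Ob K; y \<in> Ob K; z \<in> Ob K; f \<in> Hom K x y; g \<in> Hom K y z\<rbrakk> \<Longrightarrow>
      fmor F x z (Cmp K x y z g f) = Cmp K' (fob F x) (fob F y) (fob F z) (fmor F y z g) (fmor F x y f)"
  using assms unfolding is_functor_def by simp_all

lemma ideal_downD: "\<lbrakk>poset_ideal P X; x \<in> X; y \<in> carrier P; y \<sqsubseteq>\<^bsub>P\<^esub> x\<rbrakk> \<Longrightarrow> y \<in> X"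
  by (simp add: poset_ideal_def)

lemma (in partial_order) The_greatest: "greatest L x A \<Longrightarrow> (THE y. greatest L y A) = x"
  by (blast intro: the_equality greatest_unique)

lemma poset_kernel_greatest:
  "poset_kernel U V \<Longrightarrow> u \<in> carrier U \<Longrightarrow> \<exists>v. greatest U v {w \<in> V. w \<sqsubseteq>\<^bsub>U\<^esub> u}"
  by (simp add: poset_kernel_def)

lemma kdot_greatest:
  assumes "partial_order U" "poset_kernel U V" "u \<in> carrier U"
  shows "greatest U (kdot U V u) {w \<in> V. w \<sqsubseteq>\<^bsub>U\<^esub> u}"
proof -
  from poset_kernel_greatest[OF assms(2,3)] obtain v where "greatest U v {w \<in> V. w \<sqsubseteq>\<^bsub>U\<^esub> u}" ..
  then show ?thesis unfolding kdot_def by (simp add: partial_order.The_greatest[OF assms(1)])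
qed

lemma kdot_eqI:
  assumes "partial_order U" "poset_kernel U V" "v \<in> V" "v \<sqsubseteq>\<^bsub>U\<^esub> u"
    and "\<And>w. w \<in> V \<Longrightarrow> w \<sqsubseteq>\<^bsub>U\<^esub> u \<Longrightarrow> w \<sqsubseteq>\<^bsub>U\<^esub> v"
  shows "kdot U V u = v"
proof -
  have "greatest U v {w \<in> V. w \<sqsubseteq>\<^bsub>U\<^esub> u}"
    using assms by (auto simp: greatest_def poset_kernel_def)
  then show ?thesis unfolding kdot_def by (rule partial_order.The_greatest[OF assms(1)])
qed

text \<open>The finite set \<open>V \<inter> X\<close> has an upper bound \<open>z\<close> in
  \<open>X\<close>, and the largest element of \<open>V\<close> below \<open>z\<close> is then the
  largest of \<open>V \<inter> X\<close>.\<close>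

lemma kdot_ideal_greatest:
  assumes po: "partial_order U" and V: "poset_kernel U V" and X: "poset_ideal U X"
  shows "greatest U (kdot_ideal U V X) (V \<inter> X)"
proof -
  interpret partial_order U by fact
  have Xc: "X \<subseteq> carrier U" and "finite (V \<inter> X)" and Vc: "V \<subseteq> carrier U"
    using X V by (auto simp: poset_ideal_def poset_kernel_def)
  then obtain z where z: "z \<in> X" "\<forall>x\<in>V \<inter> X. x \<sqsubseteq>\<^bsub>U\<^esub> z"
    using ideal_finite_ub[OF po X, of "V \<inter> X"] by blast
  have k: "greatest U (kdot U V z) {w \<in> V. w \<sqsubseteq>\<^bsub>U\<^esub> z}"
    using kdot_greatest[OF po V] z(1) Xc by blast
  then have kV: "kdot U V z \<in> V" "kdot U V z \<sqsubseteq>\<^bsub>U\<^esub> z" by (auto simp: greatest_def)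
  then have "kdot U V z \<in> X" using ideal_downD[OF X z(1)] Vc by blast
  then have "greatest U (kdot U V z) (V \<inter> X)"
    using k z(2) kV Xc by (auto simp: greatest_def)
  then show ?thesis unfolding kdot_ideal_def by (simp add: The_greatest)
qed

locale condensate =
  fixes I :: "'i gorder" and S :: "'s gorder set" and U :: "'u gorder" and nm :: "'u \<Rightarrow> 'i"
    and D :: "('i, 's) diagram"
  assumes I: "partial_order I" and S: "\<forall>L\<in>S. join_semilattice0 L"
    and cov: "norm_covering I U nm"
    and D: "is_functor (poset_cat I) (sl_cat S) D"
begin

abbreviation "C \<equiv> Cond U nm D"
abbreviation "tr u v \<equiv> fmor D (nm u) (nm v) ()"

lemma U: "partial_order U"
  using cov by (simp add: norm_covering_def supported_def)

sublocale I: partial_order I by (rule I)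
sublocale U: partial_order U by (rule U)

lemma nm_closed: "u \<in> carrier U \<Longrightarrow> nm u \<in> carrier I"
  and nm_mono: "\<lbrakk>u \<in> carrier U; v \<in> carrier U; u \<sqsubseteq>\<^bsub>U\<^esub> v\<rbrakk> \<Longrightarrow> nm u \<sqsubseteq>\<^bsub>I\<^esub> nm v"
  using cov by (auto simp: norm_covering_def order_preserving_def isotone_def)

lemma kernel_exists: "finite X \<Longrightarrow> X \<subseteq> carrier U \<Longrightarrow> \<exists>V. poset_kernel U V \<and> X \<subseteq> V"
  using cov by (simp add: norm_covering_def supported_def)

lemma kernel_sub: "poset_kernel U V \<Longrightarrow> v \<in> V \<Longrightarrow> v \<in> carrier U"
  by (auto simp: poset_kernel_def)

lemma kdot:
  assumes "poset_kernel U V" "u \<in> carrier U"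
  shows "kdot U V u \<in> V" "kdot U V u \<in> carrier U" "kdot U V u \<sqsubseteq>\<^bsub>U\<^esub> u"
    and "\<And>w. w \<in> V \<Longrightarrow> w \<sqsubseteq>\<^bsub>U\<^esub> u \<Longrightarrow> w \<sqsubseteq>\<^bsub>U\<^esub> kdot U V u"
  using kdot_greatest[OF U assms] by (auto simp: greatest_def)

lemma kdot_self: "poset_kernel U V \<Longrightarrow> v \<in> V \<Longrightarrow> kdot U V v = v"
  using kernel_sub by (intro kdot_eqI[OF U]) auto

lemma kdot_between:
  assumes V: "poset_kernel U V" and c: "t \<in> carrier U" "u \<in> carrier U"
    and le: "kdot U V u \<sqsubseteq>\<^bsub>U\<^esub> t" "t \<sqsubseteq>\<^bsub>U\<^esub> u"
  shows "kdot U V t = kdot U V u"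
proof (rule kdot_eqI[OF U V])
  fix w assume "w \<in> V" "w \<sqsubseteq>\<^bsub>U\<^esub> t"
  moreover from this have "w \<sqsubseteq>\<^bsub>U\<^esub> u" using U.le_trans[OF _ le(2)] c kernel_sub[OF V] by blast
  ultimately show "w \<sqsubseteq>\<^bsub>U\<^esub> kdot U V u" using kdot(4)[OF V c(2)] by blast
qed (use kdot[OF V c(2)] le in auto)

lemma kdot_ideal:
  assumes "poset_kernel U V" "poset_ideal U X"
  shows "kdot_ideal U V X \<in> V" "kdot_ideal U V X \<in> X" "kdot_ideal U V X \<in> carrier U"
    and "\<And>w. w \<in> V \<Longrightarrow> w \<in> X \<Longrightarrow> w \<sqsubseteq>\<^bsub>U\<^esub> kdot_ideal U V X"
  using kdot_ideal_greatest[OF U assms] by (auto simp: greatest_def)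

lemma D_semilattice: "i \<in> carrier I \<Longrightarrow> join_semilattice0 (fob D i)"
  using functorD(1)[OF D, of i] S by (simp add: poset_cat_def sl_cat_def)

lemma D_hom: "\<lbrakk>i \<in> carrier I; j \<in> carrier I; i \<sqsubseteq>\<^bsub>I\<^esub> j\<rbrakk> \<Longrightarrow> sl_hom (fob D i) (fob D j) (fmor D i j ())"
  using functorD(2)[OF D, of i j "()"] by (simp add: poset_cat_def sl_cat_def)

lemma D_id: "\<lbrakk>i \<in> carrier I; x \<in> carrier (fob D i)\<rbrakk> \<Longrightarrow> fmor D i i () x = x"
  using functorD(3)[OF D, of i] by (simp add: poset_cat_def sl_cat_def)

lemma D_comp:
  "\<lbrakk>i \<in> carrier I; j \<in> carrier I; k \<in> carrier I; i \<sqsubseteq>\<^bsub>I\<^esub> j; j \<sqsubseteq>\<^bsub>I\<^esub> k; x \<in> carrier (fob D i)\<rbrakk> \<Longrightarrow>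
    fmor D j k () (fmor D i j () x) = fmor D i k () x"
  using functorD(4)[OF D, of i j k "()" "()"] by (simp add: poset_cat_def sl_cat_def compose_def)

lemma tr_hom: "\<lbrakk>u \<in> carrier U; v \<in> carrier U; u \<sqsubseteq>\<^bsub>U\<^esub> v\<rbrakk> \<Longrightarrow> sl_hom (fob D (nm u)) (fob D (nm v)) (tr u v)"
  by (intro D_hom nm_closed nm_mono)

lemma tr_tr:
  "\<lbrakk>u \<in> carrier U; v \<in> carrier U; w \<in> carrier U; u \<sqsubseteq>\<^bsub>U\<^esub> v; v \<sqsubseteq>\<^bsub>U\<^esub> w; x \<in> carrier (fob D (nm u))\<rbrakk>
    \<Longrightarrow> tr v w (tr u v x) = tr u w x"
  by (intro D_comp nm_closed nm_mono)

section \<open>Elements of the condensate and their supports\<close>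

lemma carrier_C:
  "a \<in> carrier C \<longleftrightarrow> a \<in> (\<Pi>\<^sub>E u\<in>carrier U. carrier (fob D (nm u))) \<and> (\<exists>V. is_support U nm D a V)"
  by (simp add: Cond_def Let_def sl_prod_def)

lemma le_C: "a \<sqsubseteq>\<^bsub>C\<^esub> b \<longleftrightarrow> (\<forall>u\<in>carrier U. a u \<sqsubseteq>\<^bsub>fob D (nm u)\<^esub> b u)"
  by (simp add: Cond_def Let_def sl_prod_def)

lemma C_value: "a \<in> carrier C \<Longrightarrow> u \<in> carrier U \<Longrightarrow> a u \<in> carrier (fob D (nm u))"
  by (auto simp: carrier_C)

lemma D_nm: "u \<in> carrier U \<Longrightarrow> semilattice0 (fob D (nm u))"
  by standard (intro D_semilattice nm_closed)

sublocale C: partial_order C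
proof unfold_locales
  show eqC: "(.=\<^bsub>C\<^esub>) = (=)" by (simp add: Cond_def Let_def sl_prod_def)
  show "a \<sqsubseteq>\<^bsub>C\<^esub> a" if "a \<in> carrier C" for a
    unfolding le_C
  proof
    fix u assume u: "u \<in> carrier U"
    interpret L: semilattice0 "fob D (nm u)" by (rule D_nm[OF u])
    show "a u \<sqsubseteq>\<^bsub>fob D (nm u)\<^esub> a u" using C_value[OF that u] by simp
  qed
  show "a .=\<^bsub>C\<^esub> b" if ab: "a \<sqsubseteq>\<^bsub>C\<^esub> b" "b \<sqsubseteq>\<^bsub>C\<^esub> a" "a \<in> carrier C" "b \<in> carrier C" for a b
    unfolding eqC
  proof (rule PiE_ext)
    show "a \<in> (\<Pi>\<^sub>E u\<in>carrier U. carrier (fob D (nm u)))" "b \<in> (\<Pi>\<^sub>E u\<in>carrier U. carrier (fob D (nm u)))"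
      using ab by (auto simp only: carrier_C)
    fix u assume u: "u \<in> carrier U"
    interpret L: semilattice0 "fob D (nm u)" by (rule D_nm[OF u])
    show "a u = b u" using ab C_value u le_C by (intro L.le_antisym) auto
  qed
  show "a \<sqsubseteq>\<^bsub>C\<^esub> c" if abc: "a \<sqsubseteq>\<^bsub>C\<^esub> b" "b \<sqsubseteq>\<^bsub>C\<^esub> c" "a \<in> carrier C" "b \<in> carrier C" "c \<in> carrier C" for a b c
    unfolding le_C
  proof
    fix u assume u: "u \<in> carrier U"
    interpret L: semilattice0 "fob D (nm u)" by (rule D_nm[OF u])
    show "a u \<sqsubseteq>\<^bsub>fob D (nm u)\<^esub> c u"
      using abc C_value[OF _ u] u unfolding le_C by (intro L.le_trans[of "a u" "b u" "c u"]) auto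
  qed
qed (simp_all add: Cond_def Let_def sl_prod_def)

lemma support_kernel: "is_support U nm D a V \<Longrightarrow> poset_kernel U V"
  by (simp add: is_support_def)

lemma support_finite: "is_support U nm D a V \<Longrightarrow> finite V" "is_support U nm D a V \<Longrightarrow> V \<subseteq> carrier U"
  by (simp_all add: is_support_def poset_kernel_def)

lemma support_value:
  "is_support U nm D a V \<Longrightarrow> u \<in> carrier U \<Longrightarrow> a u = tr (kdot U V u) u (a (kdot U V u))"
  by (simp add: is_support_def)

text \<open>From V.u below W.u below u it follows that V.(W.u) = V.u, so the transition from V.u to
  u factors through the value at W.u.\<close>

lemma support_mono:
  assumes a: "a \<in> carrier C" and V: "is_support U nm D a V" and W: "poset_kernel U W" "V \<subseteq> W"
  shows "is_support U nm D a W"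
  unfolding is_support_def
proof (intro conjI ballI W)
  fix u assume u: "u \<in> carrier U"
  let ?v = "kdot U V u" and ?w = "kdot U W u"
  note v = kdot[OF support_kernel[OF V] u] and w = kdot[OF W(1) u]
  have vw: "?v \<sqsubseteq>\<^bsub>U\<^esub> ?w" using v w W by blast
  have "a u = tr ?v u (a ?v)" by (rule support_value[OF V u])
  also have "\<dots> = tr ?w u (tr ?v ?w (a ?v))"
    using u v(2) w(2,3) vw C_value[OF a v(2)] by (intro tr_tr[symmetric])
  also have "kdot U V ?w = ?v" using kdot_between[OF support_kernel[OF V] w(2) u vw w(3)] .
  then have "tr ?v ?w (a ?v) = a ?w" using support_value[OF V w(2)] by simp
  finally show "a u = tr ?w u (a ?w)" .
qed

lemma common_support:
  assumes "a \<in> carrier C" "b \<in> carrier C" "finite X" "X \<subseteq> carrier U"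
  shows "\<exists>V. is_support U nm D a V \<and> is_support U nm D b V \<and> X \<subseteq> V"
proof -
  obtain V W where VW: "is_support U nm D a V" "is_support U nm D b W" using assms by (auto simp: carrier_C)
  then have "finite (V \<union> W \<union> X)" "V \<union> W \<union> X \<subseteq> carrier U"
    using assms by (simp_all add: support_finite)
  from kernel_exists[OF this] obtain Z where "poset_kernel U Z" "V \<union> W \<union> X \<subseteq> Z" by (elim exE conjE)
  then show ?thesis
    using support_mono[OF assms(1) VW(1)] support_mono[OF assms(2) VW(2)] by (intro exI[of _ Z]) simp
qed

text \<open>A point \<open>v\<close> of a kernel satisfies \<open>kdot U V v = v\<close>, so a
  kernel imposes no relation between values at its points: they can be prescribed freely and then
  propagate upwards. All special elements of the condensate are built this way.\<close>

lemma spread: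
  assumes V: "poset_kernel U V" and g: "\<forall>v\<in>V. g v \<in> carrier (fob D (nm v))"
  defines "a \<equiv> \<lambda>u\<in>carrier U. tr (kdot U V u) u (g (kdot U V u))"
  shows "a \<in> carrier C" "is_support U nm D a V" "\<And>v. v \<in> V \<Longrightarrow> a v = g v"
proof -
  show av: "a v = g v" if "v \<in> V" for v
    using that kernel_sub[OF V that] g D_id nm_closed unfolding a_def by (simp add: kdot_self[OF V])
  have "a u = tr (kdot U V u) u (a (kdot U V u))" if u: "u \<in> carrier U" for u
    using av[OF kdot(1)[OF V u]] u by (simp add: a_def)
  then show supp: "is_support U nm D a V" using V by (simp add: is_support_def)
  have "a u \<in> carrier (fob D (nm u))" if u: "u \<in> carrier U" for u
    using kdot[OF V u] g sl_hom_closed[OF tr_hom] u by (auto simp: a_def)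
  then have "a \<in> (\<Pi>\<^sub>E u\<in>carrier U. carrier (fob D (nm u)))" by (auto simp: a_def)
  with supp show "a \<in> carrier C" unfolding carrier_C by blast
qed

section \<open>Joins and zero of the condensate\<close>

lemma C_join_ex:
  assumes a: "a \<in> carrier C" and b: "b \<in> carrier C"
  defines "c \<equiv> \<lambda>u\<in>carrier U. a u \<squnion>\<^bsub>fob D (nm u)\<^esub> b u"
  shows "c \<in> carrier C" "a \<sqsubseteq>\<^bsub>C\<^esub> c" "b \<sqsubseteq>\<^bsub>C\<^esub> c"
    and "\<And>d. \<lbrakk>d \<in> carrier C; a \<sqsubseteq>\<^bsub>C\<^esub> d; b \<sqsubseteq>\<^bsub>C\<^esub> d\<rbrakk> \<Longrightarrow> c \<sqsubseteq>\<^bsub>C\<^esub> d"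
    and "\<And>V. is_support U nm D a V \<Longrightarrow> is_support U nm D b V \<Longrightarrow> is_support U nm D c V"
proof -
  show supp: "is_support U nm D c V" if V: "is_support U nm D a V" "is_support U nm D b V" for V
    unfolding is_support_def
  proof (intro conjI ballI)
    show k: "poset_kernel U V" using V by (simp add: is_support_def)
    fix u assume u: "u \<in> carrier U"
    let ?v = "kdot U V u"
    note v = kdot[OF k u]
    have "c u = tr ?v u (a ?v) \<squnion>\<^bsub>fob D (nm u)\<^esub> tr ?v u (b ?v)"
      using support_value[OF V(1) u] support_value[OF V(2) u] u by (simp add: c_def)
    also have "\<dots> = tr ?v u (a ?v \<squnion>\<^bsub>fob D (nm ?v)\<^esub> b ?v)"
      using tr_hom[OF v(2) u v(3)] C_value[OF a v(2)] C_value[OF b v(2)] by (simp add: sl_hom_def)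
    finally show "c u = tr ?v u (c ?v)" using v(2) by (simp add: c_def)
  qed
  have "c \<in> (\<Pi>\<^sub>E u\<in>carrier U. carrier (fob D (nm u)))"
  proof (rule PiE_I)
    fix u assume u: "u \<in> carrier U"
    interpret L: semilattice0 "fob D (nm u)" by (rule D_nm[OF u])
    show "c u \<in> carrier (fob D (nm u))" using C_value[OF a u] C_value[OF b u] u by (simp add: c_def)
  qed (simp add: c_def)
  moreover obtain V where "is_support U nm D a V" "is_support U nm D b V"
    using common_support[OF a b, of "{}"] by auto
  ultimately show "c \<in> carrier C" using supp unfolding carrier_C by blast
  have *: "a u \<sqsubseteq>\<^bsub>fob D (nm u)\<^esub> c u \<and> b u \<sqsubseteq>\<^bsub>fob D (nm u)\<^esub> c u \<and>
      (\<forall>d\<in>carrier (fob D (nm u)). a u \<sqsubseteq>\<^bsub>fob D (nm u)\<^esub> d \<longrightarrow> b u \<sqsubseteq>\<^bsub>fob D (nm u)\<^esub> d \<longrightarrow> c u \<sqsubseteq>\<^bsub>fob D (nm u)\<^esub> d)"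
    if u: "u \<in> carrier U" for u
  proof -
    interpret L: semilattice0 "fob D (nm u)" by (rule D_nm[OF u])
    show ?thesis using C_value[OF a u] C_value[OF b u] u
      by (simp add: c_def L.join_left L.join_right L.join_le)
  qed
  then show "a \<sqsubseteq>\<^bsub>C\<^esub> c" "b \<sqsubseteq>\<^bsub>C\<^esub> c" by (simp_all add: le_C)
  show "c \<sqsubseteq>\<^bsub>C\<^esub> d" if "d \<in> carrier C" "a \<sqsubseteq>\<^bsub>C\<^esub> d" "b \<sqsubseteq>\<^bsub>C\<^esub> d" for d
    using * that C_value[OF that(1)] by (simp add: le_C)
qed

lemma C_join: "\<lbrakk>a \<in> carrier C; b \<in> carrier C\<rbrakk> \<Longrightarrow> a \<squnion>\<^bsub>C\<^esub> b = (\<lambda>u\<in>carrier U. a u \<squnion>\<^bsub>fob D (nm u)\<^esub> b u)"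
  by (rule C.join_eqI) (use C_join_ex in auto)

lemma C_bottom_ex:
  defines "z \<equiv> \<lambda>u\<in>carrier U. \<bottom>\<^bsub>fob D (nm u)\<^esub>"
  shows "z \<in> carrier C" "\<And>a. a \<in> carrier C \<Longrightarrow> z \<sqsubseteq>\<^bsub>C\<^esub> a"
    and "\<And>V. poset_kernel U V \<Longrightarrow> is_support U nm D z V"
proof -
  show supp: "is_support U nm D z V" if V: "poset_kernel U V" for V
    unfolding is_support_def
  proof (intro conjI ballI V)
    fix u assume u: "u \<in> carrier U"
    note v = kdot[OF V u]
    show "z u = tr (kdot U V u) u (z (kdot U V u))"
      using u v(2) tr_hom[OF v(2) u v(3)] by (simp add: z_def sl_hom_def)
  qed
  have b: "\<bottom>\<^bsub>fob D (nm u)\<^esub> \<in> carrier (fob D (nm u)) \<and> (\<forall>d\<in>carrier (fob D (nm u)). \<bottom>\<^bsub>fob D (nm u)\<^esub> \<sqsubseteq>\<^bsub>fob D (nm u)\<^esub> d)"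
    if u: "u \<in> carrier U" for u
  proof -
    interpret L: semilattice0 "fob D (nm u)" by (rule D_nm[OF u])
    show ?thesis by simp
  qed
  obtain V where "poset_kernel U V" using kernel_exists[of "{}"] by auto
  then show "z \<in> carrier C" unfolding carrier_C using supp b by (auto simp: z_def)
  show "z \<sqsubseteq>\<^bsub>C\<^esub> a" if "a \<in> carrier C" for a
    unfolding le_C using b C_value[OF that] by (simp add: z_def)
qed

lemma C_bottom: "\<bottom>\<^bsub>C\<^esub> = (\<lambda>u\<in>carrier U. \<bottom>\<^bsub>fob D (nm u)\<^esub>)"
  by (rule C.bottom_eqI) (use C_bottom_ex in auto)

lemma C_semilattice: "join_semilattice0 C"
proof (rule join_semilattice0I)
  show "partial_order C" by (rule C.partial_order_axioms)
  show "(\<lambda>u\<in>carrier U. \<bottom>\<^bsub>fob D (nm u)\<^esub>) \<in> carrier C" by (rule C_bottom_ex)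
  show "(\<lambda>u\<in>carrier U. \<bottom>\<^bsub>fob D (nm u)\<^esub>) \<sqsubseteq>\<^bsub>C\<^esub> w" if "w \<in> carrier C" for w
    using that by (rule C_bottom_ex)
  show "\<exists>z\<in>carrier C. x \<sqsubseteq>\<^bsub>C\<^esub> z \<and> y \<sqsubseteq>\<^bsub>C\<^esub> z \<and> (\<forall>w\<in>carrier C. x \<sqsubseteq>\<^bsub>C\<^esub> w \<longrightarrow> y \<sqsubseteq>\<^bsub>C\<^esub> w \<longrightarrow> z \<sqsubseteq>\<^bsub>C\<^esub> w)"
    if "x \<in> carrier C" "y \<in> carrier C" for x y
    by (rule bexI[OF _ C_join_ex(1)[OF that]]) (use C_join_ex(2-4)[OF that] in blast)
qed

section \<open>Projections of the condensate at sharp ideals\<close>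

lemma sharp_ideal:
  assumes "sharp_ideal I U nm X"
  shows "poset_ideal U X" "ideal_norm I nm X \<in> carrier I" "\<exists>w\<in>X. nm w = ideal_norm I nm X"
    and "\<And>w. w \<in> X \<Longrightarrow> nm w \<sqsubseteq>\<^bsub>I\<^esub> ideal_norm I nm X"
proof -
  show "poset_ideal U X" using assms by (simp add: sharp_ideal_def)
  obtain i where "greatest I i (nm ` X)" using assms by (auto simp: sharp_ideal_def)
  then have "greatest I (ideal_norm I nm X) (nm ` X)"
    using I.The_greatest unfolding ideal_norm_def by metis
  then show "ideal_norm I nm X \<in> carrier I" "\<exists>w\<in>X. nm w = ideal_norm I nm X"
    "\<And>w. w \<in> X \<Longrightarrow> nm w \<sqsubseteq>\<^bsub>I\<^esub> ideal_norm I nm X"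
    by (auto simp: greatest_def)
qed

lemma ideal_norm_mono:
  assumes "sharp_ideal I U nm X" "sharp_ideal I U nm Y" "X \<subseteq> Y"
  shows "ideal_norm I nm X \<sqsubseteq>\<^bsub>I\<^esub> ideal_norm I nm Y"
  using sharp_ideal(3)[OF assms(1)] sharp_ideal(4)[OF assms(2)] assms(3) by (metis subsetD)

lemma kdot_ideal_mono:
  assumes X: "poset_ideal U X" and k: "poset_kernel U V" "poset_kernel U W" "V \<subseteq> W"
  shows "kdot_ideal U V X \<sqsubseteq>\<^bsub>U\<^esub> kdot_ideal U W X" "kdot U V (kdot_ideal U W X) = kdot_ideal U V X"
proof -
  note v = kdot_ideal[OF k(1) X] and w = kdot_ideal[OF k(2) X]
  show le: "kdot_ideal U V X \<sqsubseteq>\<^bsub>U\<^esub> kdot_ideal U W X" using v w k by blast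
  show "kdot U V (kdot_ideal U W X) = kdot_ideal U V X"
  proof (rule kdot_eqI[OF U k(1) v(1) le])
    fix t assume t: "t \<in> V" "t \<sqsubseteq>\<^bsub>U\<^esub> kdot_ideal U W X"
    then have "t \<in> X" using ideal_downD[OF X w(2)] kernel_sub[OF k(1) t(1)] by blast
    then show "t \<sqsubseteq>\<^bsub>U\<^esub> kdot_ideal U V X" using t v by blast
  qed
qed

lemma proj_value_mono:
  assumes X: "sharp_ideal I U nm X" and a: "a \<in> carrier C" and V: "is_support U nm D a V"
    and W: "poset_kernel U W" "V \<subseteq> W"
  shows "fmor D (nm (kdot_ideal U V X)) (ideal_norm I nm X) () (a (kdot_ideal U V X)) =
    fmor D (nm (kdot_ideal U W X)) (ideal_norm I nm X) () (a (kdot_ideal U W X))"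
proof -
  let ?v = "kdot_ideal U V X" and ?w = "kdot_ideal U W X"
  note X' = sharp_ideal[OF X]
  note v = kdot_ideal[OF support_kernel[OF V] X'(1)] and w = kdot_ideal[OF W(1) X'(1)]
  note m = kdot_ideal_mono[OF X'(1) support_kernel[OF V] W]
  have "a ?w = tr ?v ?w (a ?v)" using support_value[OF V w(3)] m(2) by simp
  then show ?thesis
    using D_comp[of "nm ?v" "nm ?w" "ideal_norm I nm X" "a ?v"] v(3) w(2,3) X'(2,4) m(1)
      nm_closed nm_mono C_value[OF a] by simp
qed

text \<open>The projection is defined through a support picked by \<open>SOME\<close>. Any support
  and the picked one lie in a common kernel, and passing to a larger kernel does not change the
  value.\<close>

lemma cond_proj_eq:
  assumes X: "sharp_ideal I U nm X" and a: "a \<in> carrier C" and V: "is_support U nm D a V"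
  shows "cond_proj I U nm D X a = fmor D (nm (kdot_ideal U V X)) (ideal_norm I nm X) () (a (kdot_ideal U V X))"
proof -
  define W where "W = (SOME W. is_support U nm D a W)"
  have W: "is_support U nm D a W" unfolding W_def using V by (rule someI)
  have "finite (V \<union> W)" "V \<union> W \<subseteq> carrier U" using V W by (simp_all add: support_finite)
  from kernel_exists[OF this] obtain Z where Z: "poset_kernel U Z" "V \<subseteq> Z" "W \<subseteq> Z"
    by (elim exE conjE) simp
  show ?thesis
    unfolding cond_proj_def W_def[symmetric] Let_def
    using proj_value_mono[OF X a V Z(1,2)] proj_value_mono[OF X a W Z(1,3)] by simp
qed

text \<open>If \<open>V\<close> contains a point \<open>w\<close> of \<open>X\<close> of full norm,
  then the largest element of \<open>V \<inter> X\<close> lies above \<open>w\<close> and has full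
  norm too, so the transition map in the projection is an identity and projecting is
  evaluating.\<close>

lemma cond_proj_at:
  assumes X: "sharp_ideal I U nm X" and a: "a \<in> carrier C" and V: "is_support U nm D a V"
    and w: "w \<in> X" "nm w = ideal_norm I nm X" "w \<in> V"
  shows "cond_proj I U nm D X a = a (kdot_ideal U V X)" "nm (kdot_ideal U V X) = ideal_norm I nm X"
proof -
  note X' = sharp_ideal[OF X]
  note v = kdot_ideal[OF support_kernel[OF V] X'(1)]
  have "nm w \<sqsubseteq>\<^bsub>I\<^esub> nm (kdot_ideal U V X)"
    using v w kernel_sub[OF support_kernel[OF V]] by (intro nm_mono) auto
  then show n: "nm (kdot_ideal U V X) = ideal_norm I nm X"
    using X'(4)[OF v(2)] w X'(2) nm_closed[OF v(3)] by (intro I.le_antisym) auto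
  show "cond_proj I U nm D X a = a (kdot_ideal U V X)"
    unfolding cond_proj_eq[OF X a V] n using D_id[OF X'(2)] C_value[OF a v(3)] n by simp
qed

text \<open>Statements about projections of two elements, and of whatever is built over the same
  support, become statements about values at a single point.\<close>

lemma common_point:
  assumes X: "sharp_ideal I U nm X" and a: "a \<in> carrier C" and b: "b \<in> carrier C"
  shows "\<exists>V v. v \<in> V \<and> v \<in> X \<and> nm v = ideal_norm I nm X \<and> is_support U nm D a V \<and>
    is_support U nm D b V \<and> v = kdot_ideal U V X \<and>
    (\<forall>c\<in>carrier C. is_support U nm D c V \<longrightarrow> cond_proj I U nm D X c = c v)"
proof -
  note X' = sharp_ideal[OF X]
  obtain w where w: "w \<in> X" "nm w = ideal_norm I nm X" using X'(3) by blast
  then have "{w} \<subseteq> carrier U" using ideal_subset[OF X'(1)] by blast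
  then obtain V where V: "is_support U nm D a V" "is_support U nm D b V" "w \<in> V"
    using common_support[OF a b, of "{w}"] by auto
  show ?thesis
    using cond_proj_at[OF X _ _ w V(3)] V(1,2) kdot_ideal[OF support_kernel[OF V(1)] X'(1)] a by blast
qed

lemma cond_proj_hom:
  assumes X: "sharp_ideal I U nm X"
  shows "sl_hom C (fob D (ideal_norm I nm X)) (cond_proj I U nm D X)"
  unfolding sl_hom_def
proof (intro conjI ballI funcsetI)
  fix a assume a: "a \<in> carrier C"
  obtain V v where v: "v \<in> X" "nm v = ideal_norm I nm X" "cond_proj I U nm D X a = a v"
    using common_point[OF X a a] a by blast
  then show "cond_proj I U nm D X a \<in> carrier (fob D (ideal_norm I nm X))"
    using C_value[OF a, of v] ideal_subset[OF sharp_ideal(1)[OF X]] by auto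
  fix b assume b: "b \<in> carrier C"
  obtain V v where v: "v \<in> X" "nm v = ideal_norm I nm X"
    "is_support U nm D a V" "is_support U nm D b V"
    and p: "\<And>c. c \<in> carrier C \<Longrightarrow> is_support U nm D c V \<Longrightarrow> cond_proj I U nm D X c = c v"
    using common_point[OF X a b] by blast
  have "v \<in> carrier U" using v(1) ideal_subset[OF sharp_ideal(1)[OF X]] by blast
  then show "cond_proj I U nm D X (a \<squnion>\<^bsub>C\<^esub> b) =
      cond_proj I U nm D X a \<squnion>\<^bsub>fob D (ideal_norm I nm X)\<^esub> cond_proj I U nm D X b"
    unfolding C_join[OF a b]
    using p[OF a v(3)] p[OF b v(4)] p[OF C_join_ex(1)[OF a b] C_join_ex(5)[OF a b v(3,4)]] v(2) by simp
next
  obtain V v where v: "v \<in> X" "nm v = ideal_norm I nm X"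
    "is_support U nm D \<bottom>\<^bsub>C\<^esub> V" "cond_proj I U nm D X \<bottom>\<^bsub>C\<^esub> = \<bottom>\<^bsub>C\<^esub> v"
    using common_point[OF X C_bottom_ex(1) C_bottom_ex(1)] C_bottom_ex(1) unfolding C_bottom by blast
  have "v \<in> carrier U" using v(1) ideal_subset[OF sharp_ideal(1)[OF X]] by blast
  then show "cond_proj I U nm D X \<bottom>\<^bsub>C\<^esub> = \<bottom>\<^bsub>fob D (ideal_norm I nm X)\<^esub>"
    using v by (simp add: C_bottom)
qed

lemma cond_proj_surj:
  assumes X: "sharp_ideal I U nm X" and x: "x \<in> carrier (fob D (ideal_norm I nm X))"
  shows "\<exists>a\<in>carrier C. cond_proj I U nm D X a = x"
proof -
  obtain V v where v: "v \<in> V" "nm v = ideal_norm I nm X" "is_support U nm D \<bottom>\<^bsub>C\<^esub> V"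
    and p: "\<And>c. c \<in> carrier C \<Longrightarrow> is_support U nm D c V \<Longrightarrow> cond_proj I U nm D X c = c v"
    using common_point[OF X C_bottom_ex(1) C_bottom_ex(1)] unfolding C_bottom by blast
  \<comment> \<open>The projection sees only the value at \<open>v\<close>; elsewhere on the kernel
    zero will do.\<close>
  let ?g = "\<lambda>t. if t = v then x else \<bottom>\<^bsub>fob D (nm t)\<^esub>"
  note k = support_kernel[OF v(3)]
  have "\<forall>t\<in>V. ?g t \<in> carrier (fob D (nm t))"
  proof
    fix t assume that: "t \<in> V"
    interpret L: semilattice0 "fob D (nm t)" by (rule D_nm[OF kernel_sub[OF k that]])
    show "?g t \<in> carrier (fob D (nm t))" using v x by auto
  qed
  note a = spread[of V ?g, OF k this]
  show ?thesis using p[OF a(1,2)] a(3)[OF v(1)] a(1) by auto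
qed

text \<open>The witness \<open>c\<close> agrees with \<open>a\<close> on the kernel except at
  \<open>v\<close>, where it is zero; so its projection vanishes. At \<open>u\<close> with
  \<open>kdot U V u = v\<close> the assumed inequality is transported from \<open>v\<close> to
  \<open>u\<close> and gives \<open>a u\<close> below \<open>b u\<close>; at every other
  \<open>u\<close> the values of \<open>a\<close> and \<open>c\<close> agree.\<close>

lemma cond_proj_le:
  assumes X: "sharp_ideal I U nm X" and a: "a \<in> carrier C" and b: "b \<in> carrier C"
    and le: "cond_proj I U nm D X a \<sqsubseteq>\<^bsub>fob D (ideal_norm I nm X)\<^esub> cond_proj I U nm D X b"
  shows "\<exists>c\<in>cond_theta I U nm D X. a \<sqsubseteq>\<^bsub>C\<^esub> b \<squnion>\<^bsub>C\<^esub> c"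
proof -
  obtain V v where v: "v \<in> V" "nm v = ideal_norm I nm X" and V: "is_support U nm D a V" "is_support U nm D b V"
    and p: "\<And>c. c \<in> carrier C \<Longrightarrow> is_support U nm D c V \<Longrightarrow> cond_proj I U nm D X c = c v"
    using common_point[OF X a b] by blast
  let ?g = "\<lambda>t. if t = v then \<bottom>\<^bsub>fob D (nm t)\<^esub> else a t"
  note k = support_kernel[OF V(1)]
  have "\<forall>t\<in>V. ?g t \<in> carrier (fob D (nm t))"
  proof
    fix t assume that: "t \<in> V"
    note t = kernel_sub[OF k that]
    interpret L: semilattice0 "fob D (nm v)" by (rule D_nm[OF kernel_sub[OF k v(1)]])
    show "?g t \<in> carrier (fob D (nm t))" using C_value[OF a t] L.bottom_closed by simp
  qed
  note c = spread[of V ?g, OF k this]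
  define c where "c = (\<lambda>u\<in>carrier U. tr (kdot U V u) u (?g (kdot U V u)))"
  note c = c[folded c_def]
  have "c \<in> cond_theta I U nm D X"
    using p[OF c(1,2)] c(1) c(3)[OF v(1)] v(2) by (simp add: cond_theta_def)
  moreover have "a \<sqsubseteq>\<^bsub>C\<^esub> b \<squnion>\<^bsub>C\<^esub> c"
    unfolding C_join[OF b c(1)] le_C
  proof
    fix u assume u: "u \<in> carrier U"
    interpret L: semilattice0 "fob D (nm u)" by (rule D_nm[OF u])
    note t = kdot[OF k u]
    note vals = C_value[OF a u] C_value[OF b u] C_value[OF c(1) u]
    have "a u \<sqsubseteq>\<^bsub>fob D (nm u)\<^esub> b u \<squnion>\<^bsub>fob D (nm u)\<^esub> c u"
    proof (cases "kdot U V u = v")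
      case True
      have vU: "v \<in> carrier U" using t(2) True by simp
      have "a v \<sqsubseteq>\<^bsub>fob D (nm v)\<^esub> b v" using le p[OF a V(1)] p[OF b V(2)] v(2) by simp
      then have "tr v u (a v) \<sqsubseteq>\<^bsub>fob D (nm u)\<^esub> tr v u (b v)"
        using t(3) True u vU C_value[OF a vU] C_value[OF b vU]
        by (intro sl_hom_mono[OF D_semilattice D_semilattice tr_hom] nm_closed) auto
      then have "a u \<sqsubseteq>\<^bsub>fob D (nm u)\<^esub> b u"
        using support_value[OF V(1) u] support_value[OF V(2) u] True by simp
      then show ?thesis using vals L.join_left L.le_trans L.join_closed by meson
    next
      case False
      then have "c u = a u" using support_value[OF V(1) u] u by (simp add: c_def)
      then show ?thesis using vals L.join_right by metis
    qed
    then show "a u \<sqsubseteq>\<^bsub>fob D (nm u)\<^esub> (\<lambda>u\<in>carrier U. b u \<squnion>\<^bsub>fob D (nm u)\<^esub> c u) u" using u by simp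
  qed
  ultimately show ?thesis by blast
qed

text \<open>The condition on \<open>V\<close> makes the largest elements of
  \<open>V \<inter> X\<close> and \<open>V \<inter> Y\<close> coincide, so both projections start
  from the same value of \<open>a\<close>. This is the form in which compatibility is used.\<close>

lemma cond_proj_change:
  assumes X: "sharp_ideal I U nm X" and Y: "sharp_ideal I U nm Y" and XY: "X \<subseteq> Y"
    and a: "a \<in> carrier C" and V: "is_support U nm D a V" and sub: "V \<inter> Y \<subseteq> X"
  shows "cond_proj I U nm D Y a = fmor D (ideal_norm I nm X) (ideal_norm I nm Y) () (cond_proj I U nm D X a)"
proof -
  have "V \<inter> X = V \<inter> Y" using sub XY by blast
  then have eq: "kdot_ideal U V Y = kdot_ideal U V X" by (simp add: kdot_ideal_def)
  note v = kdot_ideal[OF support_kernel[OF V] sharp_ideal(1)[OF X]]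
  show ?thesis
    unfolding cond_proj_eq[OF X a V] cond_proj_eq[OF Y a V] eq
    by (rule D_comp[symmetric])
      (use v sharp_ideal(2,4)[OF X] sharp_ideal(2)[OF Y] ideal_norm_mono[OF X Y XY] C_value[OF a] nm_closed in auto)
qed

end

text \<open>Naturality of \<open>\<psi>\<close> makes a support of \<open>a\<close> a support of its
  image, so both projections are computed at the same point.\<close>

lemma cond_proj_natural:
  assumes "condensate I S U nm D" "condensate I S U nm E"
    and hom: "\<And>i. i \<in> carrier I \<Longrightarrow> sl_hom (fob D i) (fob E i) (\<psi> i)"
    and nat: "\<And>i j x. \<lbrakk>i \<in> carrier I; j \<in> carrier I; i \<sqsubseteq>\<^bsub>I\<^esub> j; x \<in> carrier (fob D i)\<rbrakk> \<Longrightarrow>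
      fmor E i j () (\<psi> i x) = \<psi> j (fmor D i j () x)"
    and X: "sharp_ideal I U nm X" and a: "a \<in> carrier (Cond U nm D)"
  shows "cond_proj I U nm E X (Cond_map U nm \<psi> a) = \<psi> (ideal_norm I nm X) (cond_proj I U nm D X a)"
proof -
  interpret D: condensate I S U nm D by fact
  interpret E: condensate I S U nm E by fact
  let ?b = "Cond_map U nm \<psi> a"
  obtain V where V: "is_support U nm D a V" using a by (auto simp: D.carrier_C)
  note k = D.support_kernel[OF V]
  have supp: "is_support U nm E ?b V"
    unfolding is_support_def
  proof (intro conjI ballI k)
    fix u assume u: "u \<in> carrier U"
    note v = D.kdot[OF k u]
    have "fmor E (nm (kdot U V u)) (nm u) () (\<psi> (nm (kdot U V u)) (a (kdot U V u))) =
        \<psi> (nm u) (fmor D (nm (kdot U V u)) (nm u) () (a (kdot U V u)))"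
      using u v D.nm_closed D.nm_mono D.C_value[OF a] by (intro nat) auto
    then show "?b u = fmor E (nm (kdot U V u)) (nm u) () (?b (kdot U V u))"
      using D.support_value[OF V u] u v(2) by (simp add: Cond_map_def)
  qed
  have "?b u \<in> carrier (fob E (nm u))" if "u \<in> carrier U" for u
    using sl_hom_closed[OF hom[OF D.nm_closed]] that D.C_value[OF a] by (simp add: Cond_map_def)
  then have "?b \<in> (\<Pi>\<^sub>E u\<in>carrier U. carrier (fob E (nm u)))" by (auto simp: Cond_map_def)
  then have b: "?b \<in> carrier (Cond U nm E)" unfolding E.carrier_C using supp by blast
  let ?v = "kdot_ideal U V X"
  note v = D.kdot_ideal[OF k D.sharp_ideal(1)[OF X]]
  have "fmor E (nm ?v) (ideal_norm I nm X) () (\<psi> (nm ?v) (a ?v)) =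
      \<psi> (ideal_norm I nm X) (fmor D (nm ?v) (ideal_norm I nm X) () (a ?v))"
    using v D.nm_closed D.sharp_ideal[OF X] D.C_value[OF a] by (intro nat) auto
  then show ?thesis
    unfolding D.cond_proj_eq[OF X a V] E.cond_proj_eq[OF X b supp] using v(3) by (simp add: Cond_map_def)
qed

section \<open>Quasi-liftings as distances\<close>

text \<open>A surjective semilattice homomorphism is in general not determined by the ideal sent to
  zero. The last condition on \<open>f\<close> supplies this: it makes every ideal containing
  \<open>\<theta>\<close> saturated for \<open>f\<close>, so that the image of such an ideal is an
  ideal with the original one as preimage.\<close>

lemma ideal_correspondence:
  assumes C: "join_semilattice0 C" and L: "join_semilattice0 L" and f: "sl_hom C L f"
    and surj: "\<forall>x\<in>carrier L. \<exists>a\<in>carrier C. f a = x"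
    and \<theta>: "\<theta> = {a \<in> carrier C. f a = \<bottom>\<^bsub>L\<^esub>}"
    and le: "\<forall>a\<in>carrier C. \<forall>b\<in>carrier C. f a \<sqsubseteq>\<^bsub>L\<^esub> f b \<longrightarrow> (\<exists>c\<in>\<theta>. a \<sqsubseteq>\<^bsub>C\<^esub> b \<squnion>\<^bsub>C\<^esub> c)"
  defines "pre \<equiv> \<lambda>X. {a \<in> carrier C. f a \<in> X}"
  shows "\<And>X. poset_ideal L X \<Longrightarrow> \<theta> \<subseteq> pre X"
    and "\<And>X. poset_ideal L X \<Longrightarrow> poset_ideal C (pre X)"
    and "\<And>Y. poset_ideal C Y \<Longrightarrow> \<theta> \<subseteq> Y \<Longrightarrow> \<exists>X. poset_ideal L X \<and> pre X = Y"
    and "\<And>X X'. poset_ideal L X \<Longrightarrow> pre X \<subseteq> pre X' \<Longrightarrow> X \<subseteq> X'"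
proof -
  interpret C: semilattice0 C by standard fact
  interpret L: semilattice0 L by standard fact
  show "\<theta> \<subseteq> pre X" if "poset_ideal L X" for X
    using L.ideal_bottom[OF that] by (auto simp: \<theta> pre_def)
  show "poset_ideal C (pre X)" if "poset_ideal L X" for X
    unfolding pre_def by (rule ideal_vimage[OF C L f that])
  show "X \<subseteq> X'" if X: "poset_ideal L X" "pre X \<subseteq> pre X'" for X X'
  proof
    fix x assume "x \<in> X"
    then obtain a where "a \<in> carrier C" "f a = x" using surj ideal_subset[OF X(1) \<open>x \<in> X\<close>] by blast
    then show "x \<in> X'" using X(2) \<open>x \<in> X\<close> by (auto simp: pre_def)
  qed
  show "\<exists>X. poset_ideal L X \<and> pre X = Y" if Y: "poset_ideal C Y" "\<theta> \<subseteq> Y" for Y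
  proof (intro exI conjI)
    have Yc: "a \<in> carrier C" if "a \<in> Y" for a using that ideal_subset[OF Y(1)] by blast
    \<comment> \<open>Saturation: \<open>a\<close> lies below the join of \<open>b\<close> in
      \<open>Y\<close> and some \<open>c\<close> in \<open>\<theta>\<close>, both members of
      \<open>Y\<close>.\<close>
    have sat: "a \<in> Y" if ab: "a \<in> carrier C" "b \<in> Y" "f a \<sqsubseteq>\<^bsub>L\<^esub> f b" for a b
    proof -
      obtain c where "c \<in> \<theta>" "a \<sqsubseteq>\<^bsub>C\<^esub> b \<squnion>\<^bsub>C\<^esub> c" using le Yc[OF ab(2)] ab by blast
      then show ?thesis using C.ideal_down[OF Y(1) C.ideal_join[OF Y(1) that(2), of c]] Y(2) that(1) by blast
    qed
    show "poset_ideal L (f ` Y)"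
      unfolding L.ideal_iff
    proof (intro conjI ballI impI)
      show "f ` Y \<subseteq> carrier L" using Yc sl_hom_closed[OF f] by blast
      show "\<bottom>\<^bsub>L\<^esub> \<in> f ` Y" using C.ideal_bottom[OF Y(1)] f unfolding sl_hom_def by force
      fix x y assume "x \<in> f ` Y" "y \<in> f ` Y"
      then obtain a b where ab: "a \<in> Y" "b \<in> Y" "x = f a" "y = f b" by blast
      then have "x \<squnion>\<^bsub>L\<^esub> y = f (a \<squnion>\<^bsub>C\<^esub> b)" using f Yc by (simp add: sl_hom_def)
      then show "x \<squnion>\<^bsub>L\<^esub> y \<in> f ` Y" using C.ideal_join[OF Y(1) ab(1,2)] by blast
    next
      fix x y assume "x \<in> f ` Y" and y: "y \<in> carrier L" "y \<sqsubseteq>\<^bsub>L\<^esub> x"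
      then obtain b where b: "b \<in> Y" "x = f b" by blast
      obtain a where a: "a \<in> carrier C" "f a = y" using surj y by blast
      then have "a \<in> Y" using sat[OF a(1) b(1)] b y by simp
      then show "y \<in> f ` Y" using a by blast
    qed
    show "pre (f ` Y) = Y"
    proof
      show "pre (f ` Y) \<subseteq> Y"
      proof
        fix a assume "a \<in> pre (f ` Y)"
        then obtain b where "a \<in> carrier C" "b \<in> Y" "f a = f b" by (auto simp: pre_def)
        then show "a \<in> Y" using sat L.le_refl[OF sl_hom_closed[OF f Yc]] by metis
      qed
    qed (use Yc in \<open>auto simp: pre_def\<close>)
  qed
qed

lemma Conc_semilattice:
  assumes A: "algebra_on \<Sigma> A"
  shows "join_semilattice0 (Conc \<Sigma> A)"
proof (rule join_semilattice0I)
  show "partial_order (Conc \<Sigma> A)" unfolding Conc_def by (rule partial_order_incl_order)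
  show "cong_gen \<Sigma> A {} \<in> carrier (Conc \<Sigma> A)" unfolding carrier_Conc by blast
  show "cong_gen \<Sigma> A {} \<sqsubseteq>\<^bsub>Conc \<Sigma> A\<^esub> \<gamma>" if "\<gamma> \<in> carrier (Conc \<Sigma> A)" for \<gamma>
    using cong_gen_least[OF Conc_congruence[OF A that]] by (simp add: Conc_def)
  fix \<beta> \<gamma> assume "\<beta> \<in> carrier (Conc \<Sigma> A)" "\<gamma> \<in> carrier (Conc \<Sigma> A)"
  then obtain R R' where R: "finite R" "R \<subseteq> carrier A \<times> carrier A" "\<beta> = cong_gen \<Sigma> A R"
    "finite R'" "R' \<subseteq> carrier A \<times> carrier A" "\<gamma> = cong_gen \<Sigma> A R'" unfolding carrier_Conc by blast
  let ?\<epsilon> = "cong_gen \<Sigma> A (R \<union> R')"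
  have "finite (R \<union> R')" "R \<union> R' \<subseteq> carrier A \<times> carrier A" using R by auto
  then have "?\<epsilon> \<in> carrier (Conc \<Sigma> A)" unfolding carrier_Conc by blast
  moreover have "\<beta> \<subseteq> ?\<epsilon>" "\<gamma> \<subseteq> ?\<epsilon>" unfolding R by (intro cong_gen_mono; blast)+
  moreover have "?\<epsilon> \<subseteq> \<zeta>" if "\<zeta> \<in> carrier (Conc \<Sigma> A)" "\<beta> \<subseteq> \<zeta>" "\<gamma> \<subseteq> \<zeta>" for \<zeta>
    using that(2,3) cong_gen_subset_iff[OF Conc_congruence[OF A that(1)]] unfolding R by simp
  ultimately show "\<exists>z\<in>carrier (Conc \<Sigma> A). \<beta> \<sqsubseteq>\<^bsub>Conc \<Sigma> A\<^esub> z \<and> \<gamma> \<sqsubseteq>\<^bsub>Conc \<Sigma> A\<^esub> z \<and>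
      (\<forall>w\<in>carrier (Conc \<Sigma> A). \<beta> \<sqsubseteq>\<^bsub>Conc \<Sigma> A\<^esub> w \<longrightarrow> \<gamma> \<sqsubseteq>\<^bsub>Conc \<Sigma> A\<^esub> w \<longrightarrow> z \<sqsubseteq>\<^bsub>Conc \<Sigma> A\<^esub> w)"
    by (intro bexI[of _ ?\<epsilon>]) (auto simp: Conc_def)
qed

lemma principal_cong_subset_iff: "congruence \<Sigma> A \<gamma> \<Longrightarrow> principal_cong \<Sigma> A x y \<subseteq> \<gamma> \<longleftrightarrow> (x, y) \<in> \<gamma>"
  unfolding principal_cong_def by (simp add: cong_gen_subset_iff)

lemma Con_map_principal_cong:
  assumes "alg_hom \<Sigma> A B h" "algebra_on \<Sigma> A" "algebra_on \<Sigma> B" "x \<in> carrier A" "y \<in> carrier A"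
  shows "Con_map \<Sigma> B h (principal_cong \<Sigma> A x y) = principal_cong \<Sigma> B (h x) (h y)"
  unfolding principal_cong_def using assms by (subst Con_map_cong_gen) auto

section \<open>Congruences obtained from ideals along a homomorphism on compact congruences\<close>

context
  fixes \<Sigma> :: "'f signature" and T :: "('f, 'a) alg" and C :: "'c gorder" and \<tau> :: "('a \<times> 'a) set \<Rightarrow> 'c"
  assumes T: "algebra_on \<Sigma> T" and C: "join_semilattice0 C" and \<tau>: "sl_hom (Conc \<Sigma> T) C \<tau>"
begin

interpretation C: semilattice0 C by standard (rule C)

text \<open>Viewed as an ideal of compact congruences, this is the preimage of the ideal
  \<open>Y\<close> under \<open>\<tau>\<close>, but written as a relation on elements so that it can
  be compared with distances.\<close>

abbreviation (input) "pull \<equiv> dist_rel (carrier T) (\<lambda>x y. \<tau> (principal_cong \<Sigma> T x y))"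

lemma pull_mono_mem:
  assumes Y: "poset_ideal C Y" and \<beta>: "\<beta> \<in> carrier (Conc \<Sigma> T)" "\<gamma> \<in> carrier (Conc \<Sigma> T)" "\<beta> \<subseteq> \<gamma>" "\<tau> \<gamma> \<in> Y"
  shows "\<tau> \<beta> \<in> Y"
proof -
  have "\<tau> \<beta> \<sqsubseteq>\<^bsub>C\<^esub> \<tau> \<gamma>"
    using \<beta> by (intro sl_hom_mono[OF Conc_semilattice[OF T] C \<tau>]) (simp_all add: Conc_def)
  then show ?thesis using C.ideal_down[OF Y] \<beta> sl_hom_closed[OF \<tau>] by blast
qed

text \<open>A finitely generated congruence is the join of the principal ones of its generators, and
  \<open>\<tau>\<close> preserves finite joins.\<close>

lemma finite_subset_pull:
  assumes Y: "poset_ideal C Y" and "finite R" "R \<subseteq> pull Y"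
  shows "\<tau> (cong_gen \<Sigma> T R) \<in> Y"
  using assms(2,3)
proof (induction rule: finite_induct)
  case empty
  then show ?case
    using \<tau> C.ideal_bottom[OF Y] unfolding sl_hom_def Conc_bottom[OF T] by simp
next
  case (insert z R)
  obtain x y where z: "z = (x, y)" by (cases z)
  have xy: "x \<in> carrier T" "y \<in> carrier T" "\<tau> (principal_cong \<Sigma> T x y) \<in> Y" and R: "R \<subseteq> pull Y"
    using insert.prems z by (auto simp: dist_rel_def)
  then have Rc: "R \<subseteq> carrier T \<times> carrier T" by (auto simp: dist_rel_def)
  have "cong_gen \<Sigma> T (insert z R) = principal_cong \<Sigma> T x y \<squnion>\<^bsub>Conc \<Sigma> T\<^esub> cong_gen \<Sigma> T R"
    unfolding principal_cong_def using Conc_join[OF T, of "{(x, y)}" R] xy insert.hyps Rc z by simp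
  moreover have "cong_gen \<Sigma> T R \<in> carrier (Conc \<Sigma> T)" using insert.hyps Rc unfolding carrier_Conc by blast
  ultimately have "\<tau> (cong_gen \<Sigma> T (insert z R)) = \<tau> (principal_cong \<Sigma> T x y) \<squnion>\<^bsub>C\<^esub> \<tau> (cong_gen \<Sigma> T R)"
    using \<tau> principal_cong_in_Conc[OF xy(1,2)] by (simp add: sl_hom_def)
  then show ?case using C.ideal_join[OF Y xy(3) insert.IH[OF R]] by simp
qed

lemma compact_subset_pull_iff:
  assumes Y: "poset_ideal C Y" and \<gamma>: "\<gamma> \<in> carrier (Conc \<Sigma> T)"
  shows "\<gamma> \<subseteq> pull Y \<longleftrightarrow> \<tau> \<gamma> \<in> Y"
proof
  assume sub: "\<gamma> \<subseteq> pull Y"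
  obtain R where R: "\<gamma> = cong_gen \<Sigma> T R" "finite R" "R \<subseteq> carrier T \<times> carrier T"
    using \<gamma> unfolding carrier_Conc by blast
  then have "R \<subseteq> pull Y" using sub cong_gen_incl by blast
  then show "\<tau> \<gamma> \<in> Y" using finite_subset_pull[OF Y R(2)] R(1) by simp
next
  assume \<tau>\<gamma>: "\<tau> \<gamma> \<in> Y"
  have cong: "congruence \<Sigma> T \<gamma>" by (rule Conc_congruence[OF T \<gamma>])
  show "\<gamma> \<subseteq> pull Y"
  proof
    fix z assume z: "z \<in> \<gamma>"
    then obtain x y where xy: "z = (x, y)" "x \<in> carrier T" "y \<in> carrier T"
      using congruence_carrier[OF cong] by blast
    then have "\<tau> (principal_cong \<Sigma> T x y) \<in> Y"
      using z by (intro pull_mono_mem[OF Y principal_cong_in_Conc \<gamma> _ \<tau>\<gamma>])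
        (simp_all add: principal_cong_subset_iff[OF cong])
    then show "z \<in> pull Y" using xy by (simp add: dist_rel_def)
  qed
qed

text \<open>Each condition on a congruence has finitely many pairs as premises. The compact
  congruence generated by these pairs satisfies the condition and stays inside
  \<open>pull Y\<close>.\<close>

lemma pull_congruence:
  assumes Y: "poset_ideal C Y"
  shows "congruence \<Sigma> T (pull Y)"
proof -
  have gen: "z \<in> pull Y" if "finite R" "R \<subseteq> pull Y" "z \<in> cong_gen \<Sigma> T R" for R z
  proof -
    have "R \<subseteq> carrier T \<times> carrier T" using that(2) by (auto simp: dist_rel_def)
    then have "cong_gen \<Sigma> T R \<in> carrier (Conc \<Sigma> T)" using that(1) unfolding carrier_Conc by blast
    then show ?thesis
      using compact_subset_pull_iff[OF Y] finite_subset_pull[OF Y that(1,2)] that(3) by blast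
  qed
  have cg: "congruence \<Sigma> T (cong_gen \<Sigma> T R)" "R \<subseteq> cong_gen \<Sigma> T R" if "R \<subseteq> pull Y" for R
    using that by (auto intro!: cong_gen_congruence[OF T] cong_gen_incl simp: dist_rel_def)
  show ?thesis
  proof (rule congruenceI)
    show "pull Y \<subseteq> carrier T \<times> carrier T" by (auto simp: dist_rel_def)
    show "(x, x) \<in> pull Y" if "x \<in> carrier T" for x
      using gen[of "{}"] congruence_refl[OF cg(1)[of "{}"] that] by simp
    show "(y, x) \<in> pull Y" if "(x, y) \<in> pull Y" for x y
      using gen[of "{(x, y)}"] congruence_sym[OF cg(1)[of "{(x, y)}"], of x y] cg(2)[of "{(x, y)}"] that by simp
    show "(x, z) \<in> pull Y" if "(x, y) \<in> pull Y" "(y, z) \<in> pull Y" for x y z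
      using gen[of "{(x, y), (y, z)}"] congruence_trans[OF cg(1)[of "{(x, y), (y, z)}"], of x y z]
        cg(2)[of "{(x, y), (y, z)}"] that by simp
    fix f xs ys assume f: "f \<in> symbols \<Sigma>" and len: "length xs = arity \<Sigma> f"
      and r: "list_all2 (\<lambda>x y. (x, y) \<in> pull Y) xs ys"
    \<comment> \<open>Finite arity enters here: the pairs of corresponding arguments form a finite
      set.\<close>
    let ?R = "set (zip xs ys)"
    have sub: "?R \<subseteq> pull Y" using r by (auto simp: list_all2_iff)
    have "list_all2 (\<lambda>x y. (x, y) \<in> cong_gen \<Sigma> T ?R) xs ys"
      using r cg(2)[OF sub] by (auto simp: list_all2_iff)
    then show "(op T f xs, op T f ys) \<in> pull Y"
      by (intro gen[OF _ sub] congruence_op[OF cg(1)[OF sub] f len]) simp_all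
  qed
qed

end

context condensate
begin

text \<open>The map in the definition of a quasi-lifting has \<open>pl\<close> as right adjoint;
  being an isomorphism, it has \<open>pl\<close> as inverse. Composed with the correspondence
  between ideals of \<open>L\<close> and ideals of the condensate above \<open>\<theta>\<close>,
  this describes the congruences above \<open>\<alpha>\<close> by distances.\<close>

lemma quasi_lifting_represents:
  assumes V: "\<forall>T\<in>V. algebra_on \<Sigma> T" and ql: "quasi_lifting_ob \<Sigma> V I U nm D \<tau> T"
    and X: "X \<in> carrier (Id_e I U nm)"
  defines "\<alpha> \<equiv> ql_alpha \<Sigma> I U nm D \<tau> T X" and "L \<equiv> fob D (ideal_norm I nm X)"
    and "\<delta> \<equiv> \<lambda>x y. cond_proj I U nm D X (\<tau> (principal_cong \<Sigma> T x y))"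
  shows "congruence \<Sigma> T \<alpha>" "represents \<Sigma> T \<alpha> L \<delta>" "dist_rel (carrier T) \<delta> {\<bottom>\<^bsub>L\<^esub>} = \<alpha>"
proof -
  have sharp: "sharp_ideal I U nm X" using X by (simp add: Id_e_def extreme_ideal_def)
  have T: "algebra_on \<Sigma> T" and \<tau>: "sl_hom (Conc \<Sigma> T) C \<tau>" using ql V by (auto simp: quasi_lifting_ob_def)
  let ?\<theta> = "cond_theta I U nm D X" and ?pi = "cond_proj I U nm D X"
  have L: "join_semilattice0 L" unfolding L_def by (rule D_semilattice[OF sharp_ideal(2)[OF sharp]])
  interpret L: semilattice0 L by standard (rule L)
  interpret SC: semilattice0 C by standard (rule C_semilattice)
  have pi: "sl_hom C L ?pi" unfolding L_def by (rule cond_proj_hom[OF sharp])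
  have \<theta>: "?\<theta> = {a \<in> carrier C. ?pi a = \<bottom>\<^bsub>L\<^esub>}" by (simp add: cond_theta_def L_def)
  have pi_surj: "\<forall>x\<in>carrier L. \<exists>a\<in>carrier C. ?pi a = x"
    using cond_proj_surj[OF sharp] unfolding L_def by blast
  have pi_le: "\<forall>a\<in>carrier C. \<forall>b\<in>carrier C. ?pi a \<sqsubseteq>\<^bsub>L\<^esub> ?pi b \<longrightarrow> (\<exists>c\<in>?\<theta>. a \<sqsubseteq>\<^bsub>C\<^esub> b \<squnion>\<^bsub>C\<^esub> c)"
    using cond_proj_le[OF sharp] unfolding L_def by blast
  note corr = ideal_correspondence[OF C_semilattice L pi pi_surj \<theta> pi_le]
  have bot: "poset_ideal L {\<bottom>\<^bsub>L\<^esub>}"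
    using L.ideal_down_set[of "\<bottom>\<^bsub>L\<^esub>"] L.le_bottom_iff by (auto simp: down_def cong: conj_cong)
  have \<theta>_ideal: "poset_ideal C ?\<theta>" using corr(2)[OF bot] \<theta> by simp
  define pl where "pl = dist_rel (carrier T) (\<lambda>x y. \<tau> (principal_cong \<Sigma> T x y))"
  note pl_cong = pull_congruence[OF T C_semilattice \<tau>, folded pl_def]
  note pl_iff = compact_subset_pull_iff[OF T C_semilattice \<tau>, folded pl_def]
  \<comment> \<open>An ideal of \<open>L\<close> is pulled back in two stages, along the projection
    to the condensate and along \<open>\<tau>\<close> to the algebra.\<close>
  have rel_eq: "dist_rel (carrier T) \<delta> Z = pl {a \<in> carrier C. ?pi a \<in> Z}" for Z
    using sl_hom_closed[OF \<tau> principal_cong_in_Conc] by (auto simp: dist_rel_def \<delta>_def pl_def)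

  let ?G = "{\<beta> \<in> carrier (Conc \<Sigma> T). \<tau> \<beta> \<in> ?\<theta>}"
  have Gc: "\<Union>?G \<subseteq> carrier T \<times> carrier T" using congruence_carrier[OF Conc_congruence[OF T]] by blast
  interpret Con: partial_order "Con \<Sigma> T" unfolding Con_def by (rule partial_order_incl_order)
  have \<alpha>_eq: "\<alpha> = cong_gen \<Sigma> T (\<Union>?G)"
    unfolding \<alpha>_def ql_alpha_def
  proof (rule Con.sup_eqI[OF least_UpperI])
    show "\<beta> \<sqsubseteq>\<^bsub>Con \<Sigma> T\<^esub> cong_gen \<Sigma> T (\<Union>?G)" if "\<beta> \<in> ?G" for \<beta>
    proof -
      have "\<beta> \<subseteq> \<Union>?G" using that by blast
      also have "\<dots> \<subseteq> cong_gen \<Sigma> T (\<Union>?G)" by (rule cong_gen_incl)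
      finally show ?thesis by (simp add: Con_def)
    qed
    show sub: "?G \<subseteq> carrier (Con \<Sigma> T)" using Conc_congruence[OF T] by (auto simp: carrier_Con)
    show "cong_gen \<Sigma> T (\<Union>?G) \<in> carrier (Con \<Sigma> T)"
      using cong_gen_congruence[OF T Gc] by (simp add: carrier_Con)
    show "cong_gen \<Sigma> T (\<Union>?G) \<sqsubseteq>\<^bsub>Con \<Sigma> T\<^esub> \<gamma>" if "\<gamma> \<in> Upper (Con \<Sigma> T) ?G" for \<gamma>
    proof -
      have "congruence \<Sigma> T \<gamma>" using that by (simp add: Upper_def carrier_Con)
      moreover have "\<beta> \<subseteq> \<gamma>" if "\<beta> \<in> ?G" for \<beta>
        using Upper_memD[OF \<open>\<gamma> \<in> Upper (Con \<Sigma> T) ?G\<close> that sub] by (simp add: Con_def)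
      ultimately have "cong_gen \<Sigma> T (\<Union>?G) \<subseteq> \<gamma>" by (intro cong_gen_least) blast+
      then show ?thesis by (simp add: Con_def)
    qed
  qed
  show \<alpha>: "congruence \<Sigma> T \<alpha>" unfolding \<alpha>_eq by (rule cong_gen_congruence[OF T Gc])
  have \<alpha>_pl: "\<alpha> \<subseteq> pl Y" if Y: "poset_ideal C Y" "?\<theta> \<subseteq> Y" for Y
    unfolding \<alpha>_eq
  proof (rule cong_gen_least[OF pl_cong[OF Y(1)]])
    show "\<Union>?G \<subseteq> pl Y" using pl_iff[OF Y(1)] Y(2) by blast
  qed

  let ?P = "{\<beta> \<in> carrier (Con \<Sigma> T). \<alpha> \<subseteq> \<beta>}" and ?Q = "{Y \<in> carrier (Id_order C). ?\<theta> \<subseteq> Y}"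
  define \<Phi> where "\<Phi> \<beta> = Id_map C \<tau> {\<gamma> \<in> carrier (Conc \<Sigma> T). \<gamma> \<subseteq> \<beta>} \<squnion>\<^bsub>Id_order C\<^esub> ?\<theta>" for \<beta>
  have Q: "Y \<in> ?Q \<longleftrightarrow> poset_ideal C Y \<and> ?\<theta> \<subseteq> Y" for Y by (simp add: Id_order_def)
  have iso: "order_iso (incl_order ?P) (incl_order ?Q) \<Phi>"
    using ql X unfolding quasi_lifting_ob_def \<alpha>_def \<Phi>_def by blast
  \<comment> \<open>As \<open>Y\<close> contains \<open>\<theta>\<close> anyway, it contains
    \<open>\<Phi> \<beta>\<close> as soon as it contains the values of \<open>\<tau>\<close> at
    compact congruences below \<open>\<beta>\<close>; testing principal ones suffices.\<close>
  have adj: "\<Phi> \<beta> \<subseteq> Y \<longleftrightarrow> \<beta> \<subseteq> pl Y" if \<beta>: "\<beta> \<in> ?P" and Y: "Y \<in> ?Q" for \<beta> Y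
  proof -
    have cong: "congruence \<Sigma> T \<beta>" using \<beta> by (simp add: carrier_Con)
    have Y': "poset_ideal C Y" "?\<theta> \<subseteq> Y" using Y Q by blast+
    let ?S = "\<tau> ` {\<gamma> \<in> carrier (Conc \<Sigma> T). \<gamma> \<subseteq> \<beta>}"
    have Sc: "?S \<subseteq> carrier C" using sl_hom_closed[OF \<tau>] by blast
    note gen = SC.ideal_ideal_gen[OF Sc]
    have \<Phi>_eq: "\<Phi> \<beta> = ideal_gen C (ideal_gen C ?S \<union> ?\<theta>)"
      unfolding \<Phi>_def Id_map_def by (rule SC.Id_join_eq[OF gen \<theta>_ideal])
    have "\<Phi> \<beta> \<subseteq> Y \<longleftrightarrow> ?S \<subseteq> Y"
    proof
      assume "\<Phi> \<beta> \<subseteq> Y"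
      then show "?S \<subseteq> Y" unfolding \<Phi>_eq
        using SC.ideal_gen_incl[of ?S] SC.ideal_gen_incl[of "ideal_gen C ?S \<union> ?\<theta>"] by blast
    next
      assume "?S \<subseteq> Y"
      then have "ideal_gen C ?S \<subseteq> Y" by (rule SC.ideal_gen_least[OF Y'(1)])
      then show "\<Phi> \<beta> \<subseteq> Y" unfolding \<Phi>_eq using Y' by (intro SC.ideal_gen_least) simp_all
    qed
    also have "\<dots> \<longleftrightarrow> (\<forall>\<gamma>\<in>carrier (Conc \<Sigma> T). \<gamma> \<subseteq> \<beta> \<longrightarrow> \<gamma> \<subseteq> pl Y)"
      using pl_iff[OF Y'(1)] by blast
    also have "\<dots> \<longleftrightarrow> \<beta> \<subseteq> pl Y"
    proof (intro iffI subsetI)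
      fix z assume all: "\<forall>\<gamma>\<in>carrier (Conc \<Sigma> T). \<gamma> \<subseteq> \<beta> \<longrightarrow> \<gamma> \<subseteq> pl Y" and z: "z \<in> \<beta>"
      then obtain x y where xy: "z = (x, y)" "x \<in> carrier T" "y \<in> carrier T"
        using congruence_carrier[OF cong] by blast
      then have "principal_cong \<Sigma> T x y \<subseteq> \<beta>" using z by (simp add: principal_cong_subset_iff[OF cong])
      then have "principal_cong \<Sigma> T x y \<subseteq> pl Y" using all principal_cong_in_Conc[OF xy(2,3)] by blast
      then show "z \<in> pl Y" using xy by (simp add: principal_cong_subset_iff[OF pl_cong[OF Y'(1)]])
    qed blast
    finally show ?thesis .
  qed
  have pl_P: "\<forall>Y\<in>?Q. pl Y \<in> ?P"
    using pl_cong \<alpha>_pl unfolding Ball_def Q carrier_Con by simp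
  have "\<forall>\<beta>\<in>?P. \<forall>Y\<in>?Q. \<Phi> \<beta> \<subseteq> Y \<longleftrightarrow> \<beta> \<subseteq> pl Y" using adj by blast
  note inv = order_iso_upper_adjoint[OF iso this pl_P]
  note iso' = order_iso_incl_orderD[OF iso]
  have pre: "{a \<in> carrier C. ?pi a \<in> Z} \<in> ?Q" if "poset_ideal L Z" for Z
    unfolding Q using corr(1,2)[OF that] by simp

  show "represents \<Sigma> T \<alpha> L \<delta>"
    unfolding represents_def
  proof (intro conjI ballI allI impI)
    fix x y assume "x \<in> carrier T" "y \<in> carrier T"
    then show "\<delta> x y \<in> carrier L"
      unfolding \<delta>_def by (intro sl_hom_closed[OF pi] sl_hom_closed[OF \<tau>] principal_cong_in_Conc)
  next
    fix Z assume "poset_ideal L Z"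
    then show "congruence \<Sigma> T (dist_rel (carrier T) \<delta> Z)"
      unfolding rel_eq by (intro pl_cong corr(2))
  next
    fix \<gamma> assume "congruence \<Sigma> T \<gamma> \<and> \<alpha> \<subseteq> \<gamma>"
    then have \<gamma>: "\<gamma> \<in> ?P" by (simp add: carrier_Con)
    have "poset_ideal C (\<Phi> \<gamma>)" "?\<theta> \<subseteq> \<Phi> \<gamma>" using iso'(1)[OF \<gamma>] unfolding Q by blast+
    then obtain Z where "poset_ideal L Z" "{a \<in> carrier C. ?pi a \<in> Z} = \<Phi> \<gamma>" using corr(3) by blast
    then show "\<exists>Z. poset_ideal L Z \<and> dist_rel (carrier T) \<delta> Z = \<gamma>"
      using inv(2)[OF \<gamma>] unfolding rel_eq by auto
  next
    fix Z Z' assume Z: "poset_ideal L Z \<and> poset_ideal L Z' \<and> dist_rel (carrier T) \<delta> Z \<subseteq> dist_rel (carrier T) \<delta> Z'"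
    let ?Y = "{a \<in> carrier C. ?pi a \<in> Z}" and ?Y' = "{a \<in> carrier C. ?pi a \<in> Z'}"
    have Y: "?Y \<in> ?Q" "?Y' \<in> ?Q" using pre Z by blast+
    have "pl ?Y \<subseteq> pl ?Y'" using Z unfolding rel_eq by blast
    then have "\<Phi> (pl ?Y) \<subseteq> \<Phi> (pl ?Y')" using iso'(3)[OF pl_P[rule_format, OF Y(1)] pl_P[rule_format, OF Y(2)]] by blast
    then have "?Y \<subseteq> ?Y'" using inv(1)[OF Y(1)] inv(1)[OF Y(2)] by simp
    then show "Z \<subseteq> Z'" using corr(4)[of Z Z'] Z by blast
  qed

  \<comment> \<open>The inverse isomorphisms match the least members \<open>\<theta>\<close> and
    \<open>\<alpha>\<close> of the two sides, so the pairs at distance zero are exactly those in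
    \<open>\<alpha>\<close>.\<close>
  have \<alpha>P: "\<alpha> \<in> ?P" using \<alpha> by (simp add: carrier_Con)
  have \<theta>Q: "?\<theta> \<in> ?Q" unfolding Q using \<theta>_ideal by simp
  have "?\<theta> \<subseteq> \<Phi> \<alpha>" using iso'(1)[OF \<alpha>P] by blast
  then have "pl ?\<theta> \<subseteq> pl (\<Phi> \<alpha>)" by (auto simp: pl_def dist_rel_def)
  then have "pl ?\<theta> \<subseteq> \<alpha>" using inv(2)[OF \<alpha>P] by simp
  then have "pl ?\<theta> = \<alpha>" using \<alpha>_pl[OF \<theta>_ideal] by blast
  then show "dist_rel (carrier T) \<delta> {\<bottom>\<^bsub>L\<^esub>} = \<alpha>" unfolding rel_eq \<theta> by simp
qed

end

section \<open>Presented quotients and the lifting\<close>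

text \<open>Meant for two classes of the zero relation of \<open>\<delta>\<close>; on these the
  choice of representatives is immaterial by \<open>represents_dist_eq\<close>.\<close>

definition quot_dist :: "('a \<Rightarrow> 'a \<Rightarrow> 's) \<Rightarrow> 'a set \<Rightarrow> 'a set \<Rightarrow> 's" where
  "quot_dist \<delta> X Y = \<delta> (SOME x. x \<in> X) (SOME y. y \<in> Y)"

lemma quot_dist_class:
  assumes L: "join_semilattice0 L" and rep: "represents \<Sigma> T \<alpha> L \<delta>" and \<alpha>: "congruence \<Sigma> T \<alpha>"
    and ker: "dist_rel (carrier T) \<delta> {\<bottom>\<^bsub>L\<^esub>} = \<alpha>" and x: "x \<in> carrier T" and y: "y \<in> carrier T"
  shows "quot_dist \<delta> (\<alpha> `` {x}) (\<alpha> `` {y}) = \<delta> x y"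
proof -
  have "(SOME z. z \<in> \<alpha> `` {w}) \<in> \<alpha> `` {w}" if "w \<in> carrier T" for w
    by (rule someI[of _ w]) (use congruence_refl[OF \<alpha> that] in simp)
  then have "(x, SOME z. z \<in> \<alpha> `` {x}) \<in> \<alpha>" "(y, SOME z. z \<in> \<alpha> `` {y}) \<in> \<alpha>" using x y by blast+
  then show ?thesis
    unfolding quot_dist_def ker[symmetric] using represents_dist_eq[OF L rep] by metis
qed

lemma quot_represents:
  assumes T: "algebra_on \<Sigma> T" and L: "join_semilattice0 L" and rep: "represents \<Sigma> T \<alpha> L \<delta>"
    and \<alpha>: "congruence \<Sigma> T \<alpha>" and ker: "dist_rel (carrier T) \<delta> {\<bottom>\<^bsub>L\<^esub>} = \<alpha>"
  shows "representation \<Sigma> (quot_alg T \<alpha>) L (quot_dist \<delta>)"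
proof
  show "join_semilattice0 L" by fact
  show "algebra_on \<Sigma> (quot_alg T \<alpha>)"
    by (rule algebra_on_hom_image[OF quot_alg_hom[OF T \<alpha>] quot_alg_surj T])
  show "represents \<Sigma> (quot_alg T \<alpha>) {} L (quot_dist \<delta>)"
  proof (rule represents_image[OF rep quot_alg_hom[OF T \<alpha>] quot_alg_surj T congruence_carrier[OF \<alpha>]])
    fix x y assume xy: "(x, y) \<in> \<alpha>"
    then have "x \<in> carrier T" "y \<in> carrier T" using congruence_carrier[OF \<alpha>] by auto
    then show "\<alpha> `` {x} = \<alpha> `` {y}" using congruence_class_eq_iff[OF \<alpha>] xy by blast
  qed (rule quot_dist_class[OF L rep \<alpha> ker])
qed

text \<open>Carries the cardinality bound on the diagram over to the premise of the
  Loewenheim-Skolem property.\<close>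

lemma Conc_quot_card:
  assumes "algebra_on \<Sigma> T" "join_semilattice0 L" "represents \<Sigma> T \<alpha> L \<delta>"
    and "congruence \<Sigma> T \<alpha>" "dist_rel (carrier T) \<delta> {\<bottom>\<^bsub>L\<^esub>} = \<alpha>"
  shows "|carrier (Conc \<Sigma> (quot_alg T \<alpha>))| =o |carrier L|"
  using representation.cong_rank_bij[OF quot_represents[OF assms]] card_of_ordIsoI by blast

text \<open>\<open>Q\<close> stands for the quotient of \<open>G\<close> by its zero-distance
  relation, up to isomorphism. Only the surjection and the induced distance are recorded, so proper
  quotients and copies inside \<open>V\<close> are treated alike.\<close>

definition presents ::
  "'f signature \<Rightarrow> ('f, 'a) alg \<Rightarrow> 's gorder \<Rightarrow> ('a \<Rightarrow> 'a \<Rightarrow> 's) \<Rightarrow> ('f, 'a) alg \<Rightarrow> ('a \<Rightarrow> 'a) \<Rightarrow>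
   ('a \<Rightarrow> 'a \<Rightarrow> 's) \<Rightarrow> bool" where
  "presents \<Sigma> G L \<delta> Q p \<delta>' \<longleftrightarrow> representation \<Sigma> Q L \<delta>' \<and> alg_hom \<Sigma> G Q p \<and> p ` carrier G = carrier Q \<and>
     (\<forall>x\<in>carrier G. \<forall>y\<in>carrier G. \<delta>' (p x) (p y) = \<delta> x y \<and> (p x = p y \<longleftrightarrow> \<delta> x y = \<bottom>\<^bsub>L\<^esub>))"

lemma presents_iso:
  assumes p: "alg_hom \<Sigma> G R p" "p ` carrier G = carrier R" and G: "algebra_on \<Sigma> G"
    and rep: "representation \<Sigma> R L \<delta>\<^sub>R" and h: "alg_iso \<Sigma> R Q h"
    and dist: "\<And>x y. x \<in> carrier G \<Longrightarrow> y \<in> carrier G \<Longrightarrow> \<delta>\<^sub>R (p x) (p y) = \<delta> x y"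
    and ker: "\<And>x y. x \<in> carrier G \<Longrightarrow> y \<in> carrier G \<Longrightarrow> p x = p y \<longleftrightarrow> \<delta> x y = \<bottom>\<^bsub>L\<^esub>"
  shows "\<exists>p' \<delta>'. presents \<Sigma> G L \<delta> Q p' \<delta>'"
proof (intro exI)
  interpret R: representation \<Sigma> R L \<delta>\<^sub>R by fact
  have hom: "alg_hom \<Sigma> R Q h" and inj: "inj_on h (carrier R)" and img: "h ` carrier R = carrier Q"
    using h by (auto simp: alg_iso_def bij_betw_def)
  define \<delta>' where "\<delta>' a b = \<delta>\<^sub>R (inv_into (carrier R) h a) (inv_into (carrier R) h b)" for a b
  have \<delta>': "\<delta>' (h a) (h b) = \<delta>\<^sub>R a b" if "a \<in> carrier R" "b \<in> carrier R" for a b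
    using that inj by (simp add: \<delta>'_def)
  have "represents \<Sigma> Q {} L \<delta>'"
    by (rule represents_image[OF R.rep hom img R.Q]) (use \<delta>' in auto)
  then have "representation \<Sigma> Q L \<delta>'"
    using R.L algebra_on_hom_image[OF hom img R.Q] by (intro representation.intro)
  moreover have "alg_hom \<Sigma> G Q (h \<circ> p)" by (rule alg_hom_comp[OF p(1) hom])
  moreover have "(h \<circ> p) ` carrier G = carrier Q" using p(2) img by (metis image_comp)
  moreover have "\<delta>' ((h \<circ> p) x) ((h \<circ> p) y) = \<delta> x y \<and> ((h \<circ> p) x = (h \<circ> p) y \<longleftrightarrow> \<delta> x y = \<bottom>\<^bsub>L\<^esub>)"
    if "x \<in> carrier G" "y \<in> carrier G" for x y
    using that \<delta>' alg_hom_closed[OF p(1)] dist ker inj_on_eq_iff[OF inj, of "p x" "p y"] by simp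
  ultimately show "presents \<Sigma> G L \<delta> Q (h \<circ> p) \<delta>'" unfolding presents_def by blast
qed

text \<open>Serves the maximal extreme ideals, where the whole algebra is kept; closure under
  homomorphic images provides the copy of the quotient in \<open>V\<close>.\<close>

lemma quot_presents:
  assumes T: "algebra_on \<Sigma> T" "T \<in> V" and V: "closed_hom_images \<Sigma> V"
    and L: "join_semilattice0 L" and rep: "represents \<Sigma> T \<alpha> L \<delta>"
    and \<alpha>: "congruence \<Sigma> T \<alpha>" and ker: "dist_rel (carrier T) \<delta> {\<bottom>\<^bsub>L\<^esub>} = \<alpha>"
  shows "\<exists>Q\<in>V. \<exists>p \<delta>'. presents \<Sigma> T L \<delta> Q p \<delta>'"
proof -
  note q = quot_alg_hom[OF T(1) \<alpha>]
  obtain Q h where Q: "Q \<in> V" "alg_iso \<Sigma> (quot_alg T \<alpha>) Q h"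
    using hom_image_copy[OF q quot_alg_surj T V] by blast
  have "\<alpha> `` {x} = \<alpha> `` {y} \<longleftrightarrow> \<delta> x y = \<bottom>\<^bsub>L\<^esub>" if xy: "x \<in> carrier T" "y \<in> carrier T" for x y
    unfolding congruence_class_eq_iff[OF \<alpha> xy] using xy unfolding ker[symmetric] by (simp add: dist_rel_def)
  with presents_iso[OF q quot_alg_surj T(1) quot_represents[OF T(1) L rep \<alpha> ker] Q(2)]
    quot_dist_class[OF L rep \<alpha> ker] Q(1) show ?thesis by blast
qed

text \<open>Serves the non-maximal extreme ideals. The distance on the small quotient is the one of
  the full quotient restricted along the canonical embedding, and the isomorphism of congruence
  lattices keeps it representing.\<close>

lemma sub_quot_presents:
  assumes T: "algebra_on \<Sigma> T" and L: "join_semilattice0 L" and rep: "represents \<Sigma> T \<alpha> L \<delta>"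
    and \<alpha>: "congruence \<Sigma> T \<alpha>" and ker: "dist_rel (carrier T) \<delta> {\<bottom>\<^bsub>L\<^esub>} = \<alpha>"
    and B: "subalg \<Sigma> T B" and h: "alg_iso \<Sigma> (sub_quot T B \<alpha>) Q h"
    and iso: "order_iso (Con \<Sigma> (sub_quot T B \<alpha>)) (Con \<Sigma> (quot_alg T \<alpha>))
      (Con_map \<Sigma> (quot_alg T \<alpha>) (sub_quot_emb \<alpha>))"
  shows "\<exists>p \<delta>'. presents \<Sigma> (T\<lparr>carrier := B\<rparr>) L \<delta> Q p \<delta>'"
proof -
  have BT: "B \<subseteq> carrier T" and alg: "algebra_on \<Sigma> (T\<lparr>carrier := B\<rparr>)" using B by (auto simp: subalg_def)
  note p = sub_quot_hom[OF T \<alpha> B]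
  have p2: "(\<lambda>x. (\<alpha> \<inter> B \<times> B) `` {x}) ` carrier (T\<lparr>carrier := B\<rparr>) = carrier (sub_quot T B \<alpha>)"
    using p(2) by simp
  have cls: "alg_hom \<Sigma> (T\<lparr>carrier := B\<rparr>) (quot_alg T \<alpha>) (\<lambda>x. \<alpha> `` {x})"
    using alg_hom_comp[OF subalg_incl[OF B] quot_alg_hom[OF T \<alpha>]] by (simp add: comp_def)
  have emb: "alg_hom \<Sigma> (sub_quot T B \<alpha>) (quot_alg T \<alpha>) (sub_quot_emb \<alpha>)"
    by (rule alg_hom_factor[OF p(1) p2 cls _ alg]) (use p(4) in simp)
  have algq: "algebra_on \<Sigma> (sub_quot T B \<alpha>)" by (rule algebra_on_hom_image[OF p(1) p2 alg])
  interpret Q: representation \<Sigma> "quot_alg T \<alpha>" L "quot_dist \<delta>"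
    by (rule quot_represents[OF T L rep \<alpha> ker])
  have "representation \<Sigma> (sub_quot T B \<alpha>) L (\<lambda>X Y. quot_dist \<delta> (sub_quot_emb \<alpha> X) (sub_quot_emb \<alpha> Y))"
    by (intro representation.intro L algq represents_restrict[OF Q.rep emb algq iso])
  show ?thesis
  proof (rule presents_iso[OF p(1) p2 alg \<open>representation \<Sigma> (sub_quot T B \<alpha>) L _\<close> h])
    fix x y assume "x \<in> carrier (T\<lparr>carrier := B\<rparr>)" "y \<in> carrier (T\<lparr>carrier := B\<rparr>)"
    then have xy: "x \<in> B" "y \<in> B" "x \<in> carrier T" "y \<in> carrier T" using BT by auto
    then show "quot_dist \<delta> (sub_quot_emb \<alpha> ((\<alpha> \<inter> B \<times> B) `` {x})) (sub_quot_emb \<alpha> ((\<alpha> \<inter> B \<times> B) `` {y})) = \<delta> x y"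
      using p(4) quot_dist_class[OF L rep \<alpha> ker] by simp
    show "(\<alpha> \<inter> B \<times> B) `` {x} = (\<alpha> \<inter> B \<times> B) `` {y} \<longleftrightarrow> \<delta> x y = \<bottom>\<^bsub>L\<^esub>"
      unfolding p(3)[OF xy(1,2)] using xy unfolding ker[symmetric] by (simp add: dist_rel_def)
  qed
qed

text \<open>The equation \<open>dist\<close> does all the work. Since transition maps preserve zero,
  each \<open>g\<close> sends the kernel of one presentation into that of the next and descends;
  identities and composites are checked on representatives; and the same equation on the quotients
  makes \<open>cong_rank\<close> natural.\<close>

lemma lifting_of_presentations:
  fixes K :: "('o, 'h) cat" and E :: "('o, 'h, 's gorder, 's \<Rightarrow> 's) fctr"
    and G :: "'o \<Rightarrow> ('f, 'a) alg" and g :: "'o \<Rightarrow> 'o \<Rightarrow> 'h \<Rightarrow> 'a \<Rightarrow> 'a"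
  assumes K: "category K"
    and Q: "\<And>x. x \<in> Ob K \<Longrightarrow> Q x \<in> V"
    and pres: "\<And>x. x \<in> Ob K \<Longrightarrow> presents \<Sigma> (G x) (fob E x) (\<delta> x) (Q x) (p x) (\<delta>' x)"
    and G: "\<And>x. x \<in> Ob K \<Longrightarrow> algebra_on \<Sigma> (G x)"
    and g: "\<And>x y f. \<lbrakk>x \<in> Ob K; y \<in> Ob K; f \<in> Hom K x y\<rbrakk> \<Longrightarrow> alg_hom \<Sigma> (G x) (G y) (g x y f)"
    and E: "\<And>x y f. \<lbrakk>x \<in> Ob K; y \<in> Ob K; f \<in> Hom K x y\<rbrakk> \<Longrightarrow> sl_hom (fob E x) (fob E y) (fmor E x y f)"
    and dist: "\<And>x y f a b. \<lbrakk>x \<in> Ob K; y \<in> Ob K; f \<in> Hom K x y; a \<in> carrier (G x); b \<in> carrier (G x)\<rbrakk> \<Longrightarrow>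
      \<delta> y (g x y f a) (g x y f b) = fmor E x y f (\<delta> x a b)"
    and g_id: "\<And>x a. \<lbrakk>x \<in> Ob K; a \<in> carrier (G x)\<rbrakk> \<Longrightarrow> g x x (Idm K x) a = a"
    and g_comp: "\<And>x y z f k a. \<lbrakk>x \<in> Ob K; y \<in> Ob K; z \<in> Ob K; f \<in> Hom K x y; k \<in> Hom K y z; a \<in> carrier (G x)\<rbrakk> \<Longrightarrow>
      g x z (Cmp K x y z k f) a = g y z k (g x y f a)"
  shows "\<exists>B. lifting \<Sigma> V K E B"
proof -
  \<comment> \<open>A preimage under \<open>p x\<close> is chosen; the restriction to the carrier is
    demanded by the extensional morphisms of \<open>alg_cat\<close>.\<close>
  define m where "m x y f = (\<lambda>q\<in>carrier (Q x). p y (g x y f (inv_into (carrier (G x)) (p x) q)))" for x y f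
  define B where "B = \<lparr>fob = Q, fmor = m\<rparr>"
  have p: "alg_hom \<Sigma> (G x) (Q x) (p x)" "p x ` carrier (G x) = carrier (Q x)" if "x \<in> Ob K" for x
    using pres[OF that] by (auto simp: presents_def)
  have pd: "\<delta>' x (p x a) (p x b) = \<delta> x a b" "p x a = p x b \<longleftrightarrow> \<delta> x a b = \<bottom>\<^bsub>fob E x\<^esub>"
    if "x \<in> Ob K" "a \<in> carrier (G x)" "b \<in> carrier (G x)" for x a b
    using pres[OF that(1)] that(2,3) by (auto simp: presents_def)
  have rep: "representation \<Sigma> (Q x) (fob E x) (\<delta>' x)" if "x \<in> Ob K" for x
    using pres[OF that] by (simp add: presents_def)
  have gc: "g x y f a \<in> carrier (G y)" if "x \<in> Ob K" "y \<in> Ob K" "f \<in> Hom K x y" "a \<in> carrier (G x)" for x y f a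
    using alg_hom_closed[OF g] that by blast
  have pc: "p x a \<in> carrier (Q x)" if "x \<in> Ob K" "a \<in> carrier (G x)" for x a
    using alg_hom_closed[OF p(1)] that by blast
  have m: "m x y f (p x a) = p y (g x y f a)"
    if x: "x \<in> Ob K" and y: "y \<in> Ob K" and f: "f \<in> Hom K x y" and a: "a \<in> carrier (G x)" for x y f a
  proof -
    \<comment> \<open>The chosen preimage may differ from \<open>a\<close>, but it is at distance
      zero from \<open>a\<close>, and so are the images of the two.\<close>
    let ?b = "inv_into (carrier (G x)) (p x) (p x a)"
    have b: "?b \<in> carrier (G x)" "p x ?b = p x a" using a by (auto intro: inv_into_into f_inv_into_f)
    then have "\<delta> x ?b a = \<bottom>\<^bsub>fob E x\<^esub>" using pd(2)[OF x b(1) a] by simp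
    then have "\<delta> y (g x y f ?b) (g x y f a) = \<bottom>\<^bsub>fob E y\<^esub>"
      using dist[OF x y f b(1) a] E[OF x y f] by (simp add: sl_hom_def)
    then have "p y (g x y f ?b) = p y (g x y f a)" using pd(2)[OF y gc[OF x y f b(1)] gc[OF x y f a]] by simp
    then show ?thesis using pc[OF x a] by (simp add: m_def)
  qed
  have rp: "\<exists>a\<in>carrier (G x). q = p x a" if "x \<in> Ob K" "q \<in> carrier (Q x)" for x q
    using p(2)[OF that(1)] that(2) by blast
  have m_hom: "alg_hom \<Sigma> (Q x) (Q y) (m x y f)" if xyf: "x \<in> Ob K" "y \<in> Ob K" "f \<in> Hom K x y" for x y f
    by (rule alg_hom_factor[OF p[OF xyf(1)] alg_hom_comp[OF g[OF xyf] p(1)[OF xyf(2)]] _ G[OF xyf(1)]])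
      (simp add: m[OF xyf])
  have m_ext: "m x y f \<in> extensional (carrier (Q x))" for x y f by (simp add: m_def)
  interpret K: category K by fact
  have "is_functor K (alg_cat \<Sigma> V) B"
    unfolding is_functor_def
  proof (intro conjI ballI)
    show "fob B x \<in> Ob (alg_cat \<Sigma> V)" if "x \<in> Ob K" for x
      using Q[OF that] by (simp add: B_def alg_cat_def)
    show "fmor B x y f \<in> Hom (alg_cat \<Sigma> V) (fob B x) (fob B y)" if "x \<in> Ob K" "y \<in> Ob K" "f \<in> Hom K x y" for x y f
      using m_hom[OF that] m_ext by (simp add: B_def alg_cat_def)
    show "fmor B x x (Idm K x) = Idm (alg_cat \<Sigma> V) (fob B x)" if x: "x \<in> Ob K" for x
    proof -
      have "m x x (Idm K x) = (\<lambda>q\<in>carrier (Q x). q)"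
      proof (rule extensionalityI[OF m_ext])
        fix q assume "q \<in> carrier (Q x)"
        then obtain a where "a \<in> carrier (G x)" "q = p x a" using rp[OF x] by blast
        then show "m x x (Idm K x) q = (\<lambda>q\<in>carrier (Q x). q) q"
          using m[OF x x K.Idm_in_Hom[OF x]] g_id[OF x] pc[OF x] by simp
      qed simp
      then show ?thesis by (simp add: B_def alg_cat_def)
    qed
    show "fmor B x z (Cmp K x y z k f) =
        Cmp (alg_cat \<Sigma> V) (fob B x) (fob B y) (fob B z) (fmor B y z k) (fmor B x y f)"
      if x: "x \<in> Ob K" and y: "y \<in> Ob K" and z: "z \<in> Ob K" and f: "f \<in> Hom K x y" and k: "k \<in> Hom K y z"
      for x y z f k
    proof -
      have "m x z (Cmp K x y z k f) = compose (carrier (Q x)) (m y z k) (m x y f)"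
      proof (rule extensionalityI[OF m_ext])
        fix q assume q: "q \<in> carrier (Q x)"
        then obtain a where a: "a \<in> carrier (G x)" "q = p x a" using rp[OF x] by blast
        then show "m x z (Cmp K x y z k f) q = compose (carrier (Q x)) (m y z k) (m x y f) q"
          using q m[OF x z K.Cmp_in_Hom[OF x y z f k]] m[OF x y f] m[OF y z k gc[OF x y f a(1)]]
            g_comp[OF x y z f k a(1)]
          by (simp add: compose_def)
      qed simp
      then show ?thesis by (simp add: B_def alg_cat_def)
    qed
  qed
  moreover have "cong_rank (Q y) (fob E y) (\<delta>' y) (Con_map \<Sigma> (Q y) (m x y f) \<beta>) =
      fmor E x y f (cong_rank (Q x) (fob E x) (\<delta>' x) \<beta>)"
    if x: "x \<in> Ob K" and y: "y \<in> Ob K" and f: "f \<in> Hom K x y" and \<beta>: "\<beta> \<in> carrier (Conc \<Sigma> (Q x))" for x y f \<beta>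
  proof (rule cong_rank_natural[OF rep[OF x] rep[OF y] m_hom[OF x y f] E[OF x y f] _ \<beta>])
    fix q r assume "q \<in> carrier (Q x)" "r \<in> carrier (Q x)"
    then obtain a b where ab: "a \<in> carrier (G x)" "b \<in> carrier (G x)" "q = p x a" "r = p x b"
      using rp[OF x] by meson
    then show "\<delta>' y (m x y f q) (m x y f r) = fmor E x y f (\<delta>' x q r)"
      using m[OF x y f] pd(1)[OF y gc[OF x y f ab(1)] gc[OF x y f ab(2)]] pd(1)[OF x ab(1,2)]
        dist[OF x y f ab(1,2)] by simp
  qed
  moreover have "sl_iso (Conc \<Sigma> (Q x)) (fob E x) (cong_rank (Q x) (fob E x) (\<delta>' x))" if "x \<in> Ob K" for x
    by (rule representation.cong_rank_iso[OF rep[OF that]])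
  ultimately have "lifting \<Sigma> V K E B"
    unfolding lifting_def
    by (intro conjI exI[of _ "\<lambda>x. cong_rank (Q x) (fob E x) (\<delta>' x)"]) (simp_all add: B_def)
  then show ?thesis ..
qed

lemma category_poset_cat:
  assumes "partial_order I"
  shows "category (poset_cat I)"
proof -
  interpret partial_order I by fact
  show ?thesis
    by standard (auto simp: poset_cat_def intro: le_trans split: if_splits)
qed

lemma category_prod_cat:
  assumes "category C" "category C'"
  shows "category (prod_cat C C')"
proof -
  interpret C: category C by fact
  interpret C': category C' by fact
  show ?thesis
    by standard (auto simp: prod_cat_def C.Idm_in_Hom C'.Idm_in_Hom C.Cmp_in_Hom C'.Cmp_in_Hom
      C.Cmp_Idm_right C'.Cmp_Idm_right C.Cmp_Idm_left C'.Cmp_Idm_left C.Cmp_assoc C'.Cmp_assoc)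
qed

text \<open>If \<open>M\<close> is infinite, there are only \<open>|M|\<close> pairs, and finite
  sets add nothing. If \<open>M\<close> is finite, the union is finite but may be larger than
  \<open>M\<close>, and infinity of \<open>r\<close> is what bounds it.\<close>

lemma card_Union_pairs_less:
  fixes M :: "'m set" and r :: "'k rel"
  assumes M: "|M| <o r" and r: "Card_order r" "cinfinite r" and fin: "\<And>z. z \<in> M \<times> M \<Longrightarrow> finite (W z)"
  shows "|\<Union>z\<in>M \<times> M. W z| <o r"
proof (cases "finite M")
  case True
  then have "finite (\<Union>z\<in>M \<times> M. W z)" using fin by blast
  moreover have "\<not> finite (Field r)" using r by (simp add: cinfinite_def)
  ultimately show ?thesis
    by (intro finite_ordLess_infinite card_of_Well_order card_order_on_well_order_on[OF r(1)])
      (simp_all add: Field_card_of)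
next
  case False
  have "|\<Union>z\<in>M \<times> M. W z| \<le>o |M|"
  proof (rule card_of_UNION_ordLeq_infinite[OF False])
    show "|M \<times> M| \<le>o |M|" using card_of_Times_same_infinite[OF False] ordIso_iff_ordLeq by blast
    show "\<forall>z\<in>M \<times> M. |W z| \<le>o |M|"
      using fin False
      by (intro ballI ordLess_imp_ordLeq finite_ordLess_infinite card_of_Well_order) (simp_all add: Field_card_of)
  qed
  then show ?thesis using M by (rule ordLeq_ordLess_trans)
qed

lemma Ob_prod_poset: "x \<in> Ob (prod_cat (poset_cat I) J) \<longleftrightarrow> fst x \<in> carrier I \<and> snd x \<in> Ob J"
  by (simp add: prod_cat_def poset_cat_def mem_Times_iff)

lemma Hom_prod_poset:
  "f \<in> Hom (prod_cat (poset_cat I) J) x y \<longleftrightarrow> fst x \<sqsubseteq>\<^bsub>I\<^esub> fst y \<and> snd f \<in> Hom J (snd x) (snd y)"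
  by (simp add: prod_cat_def poset_cat_def split_beta mem_Times_iff)

theorem theorem6p9:
  fixes S :: "'s gorder set" and I :: "'i gorder" and \<kappa> :: "'i \<Rightarrow> 'k rel"
    and U :: "'u gorder" and nm :: "'u \<Rightarrow> 'i"
    and \<Sigma> :: "'f signature" and V :: "('f, 'a) alg set" and J :: "('j, 'h) cat"
    and D :: "('j, 'h, ('i, 's) diagram, 'i \<Rightarrow> 's \<Rightarrow> 's) fctr"
    and \<tau> :: "'j \<Rightarrow> ('a \<times> 'a) set \<Rightarrow> 'u \<Rightarrow> 's"
    and A :: "('j, 'h, ('f, 'a) alg, 'a \<Rightarrow> 'a) fctr"
  assumes "\<forall>L\<in>S. join_semilattice0 L"
    and "closed_finite_products S"
    and "closed_directed_unions S"
    and "partial_order I"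
    and "\<forall>i\<in>carrier I. Card_order (\<kappa> i)"
    and "\<forall>X\<in>carrier (non_maximal (Id_e I U nm)). cinfinite (\<kappa> (ideal_norm I nm X))"
    and "norm_covering I U nm"
    and "compatible I \<kappa> U nm"
    and "\<forall>T\<in>V. algebra_on \<Sigma> T"
    and "category J"
    and "closed_hom_images \<Sigma> V"
    and "loewenheim_skolem \<Sigma> V (non_maximal (Id_e I U nm)) J (\<lambda>X. \<kappa> (ideal_norm I nm X))"
    and "is_functor J (functor_cat (poset_cat I) (sl_cat S)) D"
    and "quasi_lifting \<Sigma> V I U nm J D \<tau> A"
    and "\<forall>i\<in>carrier I. |SIGMA j:Ob J. carrier (fob (fob D j) i)| <o \<kappa> i"
  shows "\<exists>B. lifting \<Sigma> V (prod_cat (poset_cat I) J) (diagram_hat D) B"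
proof -
  interpret I: partial_order I by fact
  let ?E = "Id_e I U nm"
  let ?N = "ideal_norm I nm"
  have sharp: "sharp_ideal I U nm u" if "u \<in> carrier ?E" for u
    using that by (simp add: Id_e_def extreme_ideal_def)
  have N_closed: "?N u \<in> carrier I" if u: "u \<in> carrier ?E" for u
  proof -
    obtain i where i: "greatest I i (nm ` u)" using sharp[OF u] by (auto simp: sharp_ideal_def)
    then have "?N u = i" unfolding ideal_norm_def by (rule I.The_greatest)
    with i show ?thesis by auto
  qed
  have leE: "u \<sqsubseteq>\<^bsub>?E\<^esub> v \<longleftrightarrow> u \<subseteq> v" for u v by (simp add: Id_e_def)
  have nonmaxE: "u \<in> carrier ?E" if "u \<in> carrier (non_maximal ?E)" for u
    using that by (simp add: non_maximal_def)

  \<comment> \<open>Components of the diagram and of the quasi-lifting\<close>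
  have cond: "condensate I S U nm (fob D j)" if "j \<in> Ob J" for j
    using functorD(1)[OF assms(13) that] assms(1,4,7) by (intro condensate.intro) (auto simp: functor_cat_def)
  have D_mor: "sl_hom (fob (fob D j) i) (fob (fob D k) i) (fmor D j k f i)"
    if "j \<in> Ob J" "k \<in> Ob J" "f \<in> Hom J j k" "i \<in> carrier I" for j k f i
    using functorD(2)[OF assms(13) that(1-3)] that(4) by (simp add: functor_cat_def poset_cat_def sl_cat_def)
  have D_nat: "fmor (fob D k) i i' () (fmor D j k f i x) = fmor D j k f i' (fmor (fob D j) i i' () x)"
    if "j \<in> Ob J" "k \<in> Ob J" "f \<in> Hom J j k" and i: "i \<in> carrier I" "i' \<in> carrier I" "i \<sqsubseteq>\<^bsub>I\<^esub> i'"
      and x: "x \<in> carrier (fob (fob D j) i)" for j k f i i' x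
  proof -
    have "compose (carrier (fob (fob D j) i)) (fmor (fob D k) i i' ()) (fmor D j k f i) =
        compose (carrier (fob (fob D j) i)) (fmor D j k f i') (fmor (fob D j) i i' ())"
      using functorD(2)[OF assms(13) that(1-3)] i by (simp add: functor_cat_def poset_cat_def sl_cat_def)
    from fun_cong[OF this, of x] show ?thesis using x by (simp add: compose_def)
  qed

  have A: "is_functor J (alg_cat \<Sigma> V) A" using assms(14) by (simp add: quasi_lifting_def)
  have AV: "fob A j \<in> V" if "j \<in> Ob J" for j using functorD(1)[OF A that] by (simp add: alg_cat_def)
  have Aalg: "algebra_on \<Sigma> (fob A j)" if "j \<in> Ob J" for j using AV[OF that] assms(9) by blast
  have A_hom: "alg_hom \<Sigma> (fob A j) (fob A k) (fmor A j k f)" if "j \<in> Ob J" "k \<in> Ob J" "f \<in> Hom J j k" for j k f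
    using functorD(2)[OF A that] by (simp add: alg_cat_def)
  have A_id: "fmor A j j (Idm J j) x = x" if "j \<in> Ob J" "x \<in> carrier (fob A j)" for j x
    using functorD(3)[OF A that(1)] that(2) by (simp add: alg_cat_def)
  have A_comp: "fmor A j l (Cmp J j k l g f) x = fmor A k l g (fmor A j k f x)"
    if "j \<in> Ob J" "k \<in> Ob J" "l \<in> Ob J" "f \<in> Hom J j k" "g \<in> Hom J k l" "x \<in> carrier (fob A j)" for j k l f g x
    using functorD(4)[OF A that(1-5)] that(6) by (simp add: alg_cat_def compose_def)

  have ql: "quasi_lifting_ob \<Sigma> V I U nm (fob D j) (\<tau> j) (fob A j)" if "j \<in> Ob J" for j
    using assms(14) that by (simp add: quasi_lifting_def)
  have \<tau>_nat: "\<tau> k (Con_map \<Sigma> (fob A k) (fmor A j k f) \<beta>) = Cond_map U nm (fmor D j k f) (\<tau> j \<beta>)"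
    if "j \<in> Ob J" "k \<in> Ob J" "f \<in> Hom J j k" "\<beta> \<in> carrier (Conc \<Sigma> (fob A j))" for j k f \<beta>
    using assms(14) that by (simp add: quasi_lifting_def)
  define pc where "pc j x y = \<tau> j (principal_cong \<Sigma> (fob A j) x y)" for j x y
  have pc: "pc j x y \<in> carrier (Cond U nm (fob D j))"
    if "j \<in> Ob J" "x \<in> carrier (fob A j)" "y \<in> carrier (fob A j)" for j x y
    unfolding pc_def using ql[OF that(1)] sl_hom_closed[OF _ principal_cong_in_Conc[OF that(2,3)]]
    by (auto simp: quasi_lifting_ob_def)
  define \<alpha> where "\<alpha> u j = ql_alpha \<Sigma> I U nm (fob D j) (\<tau> j) (fob A j) u" for u j
  define \<delta> where "\<delta> u j = (\<lambda>x y. cond_proj I U nm (fob D j) u (pc j x y))" for u j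
  let ?L = "\<lambda>u j. fob (fob D j) (?N u)"
  have rep: "congruence \<Sigma> (fob A j) (\<alpha> u j)" "represents \<Sigma> (fob A j) (\<alpha> u j) (?L u j) (\<delta> u j)"
    "dist_rel (carrier (fob A j)) (\<delta> u j) {\<bottom>\<^bsub>?L u j\<^esub>} = \<alpha> u j"
    if "u \<in> carrier ?E" "j \<in> Ob J" for u j
    using condensate.quasi_lifting_represents[OF cond[OF that(2)] assms(9) ql[OF that(2)] that(1)]
    unfolding \<alpha>_def \<delta>_def pc_def by blast+
  have L: "join_semilattice0 (?L u j)" if "u \<in> carrier ?E" "j \<in> Ob J" for u j
    using condensate.D_semilattice[OF cond[OF that(2)] N_closed[OF that(1)]] .

  \<comment> \<open>Small subalgebras from the Loewenheim-Skolem property\<close>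
  have congs: "\<forall>u\<in>carrier (non_maximal ?E). \<forall>j\<in>Ob J. congruence \<Sigma> (fob A j) (\<alpha> u j)"
    using rep(1) nonmaxE by blast
  \<comment> \<open>Each summand has the size of the corresponding component of the diagram, so the
    sums agree as well.\<close>
  have "|SIGMA j:Ob J. carrier (Conc \<Sigma> (quot_alg (fob A j) (\<alpha> u j)))| <o \<kappa> (?N u)"
    if "u \<in> carrier (non_maximal ?E)" for u
  proof -
    note u = nonmaxE[OF that]
    have "\<forall>j\<in>Ob J. |carrier (Conc \<Sigma> (quot_alg (fob A j) (\<alpha> u j)))| =o |carrier (?L u j)|"
      using Conc_quot_card[OF Aalg L[OF u] rep(2)[OF u] rep(1)[OF u] rep(3)[OF u]] by blast
    then have "|SIGMA j:Ob J. carrier (Conc \<Sigma> (quot_alg (fob A j) (\<alpha> u j)))| =o |SIGMA j:Ob J. carrier (?L u j)|"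
      by (rule card_of_Sigma_cong1)
    moreover have "|SIGMA j:Ob J. carrier (?L u j)| <o \<kappa> (?N u)"
      using assms(15) N_closed[OF u] by blast
    ultimately show ?thesis by (rule ordIso_ordLess_trans)
  qed
  then have small: "\<forall>u\<in>carrier (non_maximal ?E).
    |SIGMA j:Ob J. carrier (Conc \<Sigma> (quot_alg (fob A j) (\<alpha> u j)))| <o \<kappa> (?N u)" by blast
  from assms(12)[unfolded loewenheim_skolem_def, THEN spec, THEN spec, THEN mp, OF conjI[OF A conjI[OF congs small]]]
  obtain B0 where
    B0_sub: "\<forall>u\<in>carrier (non_maximal ?E). \<forall>j\<in>Ob J. subalg \<Sigma> (fob A j) (B0 u j)"
    and B0_V: "\<forall>u\<in>carrier (non_maximal ?E). \<forall>j\<in>Ob J.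
      \<exists>Q\<in>V. \<exists>h. alg_iso \<Sigma> (sub_quot (fob A j) (B0 u j) (\<alpha> u j)) Q h"
    and B0_mono: "\<forall>u\<in>carrier (non_maximal ?E). \<forall>v\<in>carrier (non_maximal ?E). \<forall>j\<in>Ob J.
      u \<sqsubseteq>\<^bsub>non_maximal ?E\<^esub> v \<longrightarrow> B0 u j \<subseteq> B0 v j"
    and B0_mor: "\<forall>u\<in>carrier (non_maximal ?E). \<forall>j\<in>Ob J. \<forall>k\<in>Ob J. \<forall>f\<in>Hom J j k.
      fmor A j k f ` B0 u j \<subseteq> B0 u k"
    and B0_iso: "\<forall>u\<in>carrier (non_maximal ?E). \<forall>j\<in>Ob J.
      order_iso (Con \<Sigma> (sub_quot (fob A j) (B0 u j) (\<alpha> u j))) (Con \<Sigma> (quot_alg (fob A j) (\<alpha> u j)))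
        (Con_map \<Sigma> (quot_alg (fob A j) (\<alpha> u j)) (sub_quot_emb (\<alpha> u j)))"
    and B0_card: "\<forall>u\<in>carrier (non_maximal ?E). |SIGMA j:Ob J. B0 u j| <o \<kappa> (?N u)"
    by (elim exE conjE) (rule that)

  define B where "B u j = (if u \<in> carrier (non_maximal ?E) then B0 u j else carrier (fob A j))" for u j
  have B_sub: "subalg \<Sigma> (fob A j) (B u j)" if "u \<in> carrier ?E" "j \<in> Ob J" for u j
    using B0_sub Aalg[OF that(2)] that by (simp add: B_def subalg_def)
  have BA: "B u j \<subseteq> carrier (fob A j)" if "u \<in> carrier ?E" "j \<in> Ob J" for u j
    using B_sub[OF that] by (simp add: subalg_def)
  have B_alg: "algebra_on \<Sigma> (fob A j\<lparr>carrier := B u j\<rparr>)" if "u \<in> carrier ?E" "j \<in> Ob J" for u j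
    using B_sub[OF that] by (simp add: subalg_def)
  have B_mono: "B u j \<subseteq> B v j" if uv: "u \<in> carrier ?E" "v \<in> carrier ?E" "u \<subseteq> v" and j: "j \<in> Ob J" for u v j
  proof (cases "u = v \<or> v \<notin> carrier (non_maximal ?E)")
    case True
    then show ?thesis using BA[OF uv(1) j] by (auto simp: B_def)
  next
    case False
    \<comment> \<open>An extreme ideal strictly below another one is not maximal, so the full
      algebra never sits below a proper subalgebra \<open>B0 v j\<close>.\<close>
    moreover have "u \<in> carrier (non_maximal ?E)"
      using uv False by (auto simp: non_maximal_def lless_def Id_e_def)
    moreover have "u \<sqsubseteq>\<^bsub>non_maximal ?E\<^esub> v" using uv by (simp add: non_maximal_def Id_e_def)
    ultimately show ?thesis using B0_mono j by (simp add: B_def)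
  qed
  have B_mor: "fmor A j k f x \<in> B u k"
    if "u \<in> carrier ?E" "j \<in> Ob J" "k \<in> Ob J" "f \<in> Hom J j k" "x \<in> B u j" for u j k f x
  proof (cases "u \<in> carrier (non_maximal ?E)")
    case True
    then have "fmor A j k f ` B0 u j \<subseteq> B0 u k" using B0_mor that by blast
    then show ?thesis using True that(5) by (auto simp: B_def)
  next
    case False
    then show ?thesis using alg_hom_closed[OF A_hom[OF that(2-4)]] that(5) by (simp add: B_def)
  qed
  have B_pres: "\<exists>Q\<in>V. \<exists>p \<delta>'. presents \<Sigma> (fob A j\<lparr>carrier := B u j\<rparr>) (?L u j) (\<delta> u j) Q p \<delta>'"
    if uj: "u \<in> carrier ?E" "j \<in> Ob J" for u j
  proof (cases "u \<in> carrier (non_maximal ?E)")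
    case True
    then obtain Q h where Q: "Q \<in> V" "alg_iso \<Sigma> (sub_quot (fob A j) (B u j) (\<alpha> u j)) Q h"
      using B0_V uj(2) by (fastforce simp: B_def)
    have "order_iso (Con \<Sigma> (sub_quot (fob A j) (B u j) (\<alpha> u j))) (Con \<Sigma> (quot_alg (fob A j) (\<alpha> u j)))
        (Con_map \<Sigma> (quot_alg (fob A j) (\<alpha> u j)) (sub_quot_emb (\<alpha> u j)))"
      using B0_iso True uj(2) by (simp add: B_def)
    from sub_quot_presents[OF Aalg[OF uj(2)] L[OF uj] rep(2)[OF uj] rep(1)[OF uj] rep(3)[OF uj] B_sub[OF uj] Q(2) this]
    show ?thesis using Q(1) by blast
  next
    case False
    then show ?thesis
      using quot_presents[OF Aalg[OF uj(2)] AV[OF uj(2)] assms(11) L[OF uj] rep(2)[OF uj] rep(1)[OF uj] rep(3)[OF uj]]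
      by (simp add: B_def)
  qed

  \<comment> \<open>Supports of distances and the choice of the ideals\<close>
  define supp where "supp j a = (SOME W. is_support U nm (fob D j) a W)" for j a
  have supp: "is_support U nm (fob D j) (pc j x y) (supp j (pc j x y))"
    if "j \<in> Ob J" "x \<in> carrier (fob A j)" "y \<in> carrier (fob A j)" for j x y
    unfolding supp_def using pc[OF that] condensate.carrier_C[OF cond[OF that(1)]] by (metis someI_ex)
  \<comment> \<open>Pairs are taken from the disjoint union over \<open>J\<close>, whose cardinal is
    the one bounded by \<open>\<kappa>\<close>; pairs with different indices carry no distance and
    contribute nothing.\<close>
  define W where "W = (\<lambda>((j, x), (k, y)). if j = k then supp j (pc j x y) else {})"
  let ?M = "\<lambda>u. SIGMA j:Ob J. B u j"
  have W: "finite (W z)" "W z \<subseteq> carrier U" if u: "u \<in> carrier ?E" and z: "z \<in> ?M u \<times> ?M u" for u z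
  proof -
    obtain j x k y where z': "z = ((j, x), (k, y))" by (metis surj_pair)
    have "finite (W z) \<and> W z \<subseteq> carrier U"
    proof (cases "j = k")
      case True
      then have j: "j \<in> Ob J" "x \<in> carrier (fob A j)" "y \<in> carrier (fob A j)"
        using z z' BA[OF u] by auto
      then show ?thesis
        using condensate.support_finite[OF cond[OF j(1)] supp[OF j]] True by (simp add: W_def z')
    qed (simp add: W_def z')
    then show "finite (W z)" "W z \<subseteq> carrier U" by blast+
  qed
  define F where "F u = (\<Union>z\<in>?M u \<times> ?M u. W z)" for u
  have F_mono: "order_preserving ?E (incl_order (Pow (carrier U))) F"
    unfolding order_preserving_def isotone_def
  proof (intro conjI ballI impI funcsetI)
    show "weak_partial_order ?E" "weak_partial_order (incl_order (Pow (carrier U)))"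
      unfolding Id_e_def using partial_order_incl_order partial_order_def by blast+
    show "F u \<in> carrier (incl_order (Pow (carrier U)))" if "u \<in> carrier ?E" for u
      using UN_least[OF W(2)[OF that]] by (simp add: F_def)
    show "F u \<sqsubseteq>\<^bsub>incl_order (Pow (carrier U))\<^esub> F v"
      if "u \<in> carrier ?E" "v \<in> carrier ?E" "u \<sqsubseteq>\<^bsub>?E\<^esub> v" for u v
    proof -
      have "?M u \<subseteq> ?M v" using B_mono[OF that(1,2)] that(3) leE by (intro Sigma_mono) auto
      then have "?M u \<times> ?M u \<subseteq> ?M v \<times> ?M v" by blast
      then show ?thesis unfolding F_def by (simp add: UN_mono)
    qed
  qed
  have F_card: "\<forall>u\<in>carrier (non_maximal ?E). |F u| <o \<kappa> (?N u)"
    unfolding F_def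
  proof (intro ballI, rule card_Union_pairs_less)
    fix u assume u: "u \<in> carrier (non_maximal ?E)"
    show "|?M u| <o \<kappa> (?N u)" using B0_card u by (simp add: B_def)
    show "Card_order (\<kappa> (?N u))" using assms(5) N_closed[OF nonmaxE[OF u]] by blast
    show "cinfinite (\<kappa> (?N u))" using assms(6) u by blast
    show "finite (W z)" if "z \<in> ?M u \<times> ?M u" for z by (rule W(1)[OF nonmaxE[OF u] that])
  qed
  from assms(8)[unfolded compatible_def, THEN spec, THEN mp, OF conjI[OF F_mono F_card]] obtain \<sigma> where \<sigma>: "order_preserving I ?E \<sigma>"
    and \<sigma>_norm: "\<forall>i\<in>carrier I. ?N (\<sigma> i) = i"
    and \<sigma>_F: "\<forall>i\<in>carrier I. \<forall>j\<in>carrier I. i \<sqsubseteq>\<^bsub>I\<^esub> j \<longrightarrow> F (\<sigma> i) \<inter> \<sigma> j \<subseteq> \<sigma> i"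
    by (elim exE conjE) (rule that)
  have \<sigma>E: "\<sigma> i \<in> carrier ?E" if "i \<in> carrier I" for i
    using \<sigma> that by (auto simp: order_preserving_def)
  have \<sigma>_mono: "\<sigma> i \<subseteq> \<sigma> i'" if "i \<in> carrier I" "i' \<in> carrier I" "i \<sqsubseteq>\<^bsub>I\<^esub> i'" for i i'
    using \<sigma> that leE by (simp add: order_preserving_def isotone_def)

  \<comment> \<open>Claimed only for elements of the subalgebra at \<open>\<sigma> i\<close>, since
    \<open>F (\<sigma> i)\<close> contains the supports of their distances alone.\<close>
  have \<delta>_change: "\<delta> (\<sigma> i') j x y = fmor (fob D j) i i' () (\<delta> (\<sigma> i) j x y)"
    if i: "i \<in> carrier I" "i' \<in> carrier I" "i \<sqsubseteq>\<^bsub>I\<^esub> i'" and j: "j \<in> Ob J"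
      and xy: "x \<in> B (\<sigma> i) j" "y \<in> B (\<sigma> i) j" for i i' j x y
  proof -
    have xyA: "x \<in> carrier (fob A j)" "y \<in> carrier (fob A j)" using BA[OF \<sigma>E[OF i(1)] j] xy by auto
    have "W ((j, x), (j, y)) \<subseteq> F (\<sigma> i)" unfolding F_def using j xy by (intro UN_upper) simp
    then have "supp j (pc j x y) \<subseteq> F (\<sigma> i)" by (simp add: W_def)
    then have "supp j (pc j x y) \<inter> \<sigma> i' \<subseteq> \<sigma> i" using \<sigma>_F i by blast
    from condensate.cond_proj_change[OF cond[OF j] sharp[OF \<sigma>E[OF i(1)]] sharp[OF \<sigma>E[OF i(2)]]
        \<sigma>_mono[OF i] pc[OF j xyA] supp[OF j xyA] this]
    show ?thesis using \<sigma>_norm i by (simp add: \<delta>_def)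
  qed
  have \<delta>_nat: "\<delta> u k (fmor A j k f x) (fmor A j k f y) = fmor D j k f (?N u) (\<delta> u j x y)"
    if u: "u \<in> carrier ?E" and jk: "j \<in> Ob J" "k \<in> Ob J" "f \<in> Hom J j k"
      and xy: "x \<in> carrier (fob A j)" "y \<in> carrier (fob A j)" for u j k f x y
  proof -
    have "pc k (fmor A j k f x) (fmor A j k f y) = Cond_map U nm (fmor D j k f) (pc j x y)"
      unfolding pc_def
      using \<tau>_nat[OF jk principal_cong_in_Conc[OF xy]] Con_map_principal_cong[OF A_hom[OF jk] Aalg[OF jk(1)] Aalg[OF jk(2)] xy]
      by simp
    then show ?thesis
      unfolding \<delta>_def
      using cond_proj_natural[OF cond[OF jk(1)] cond[OF jk(2)] D_mor[OF jk] D_nat[OF jk] sharp[OF u] pc[OF jk(1) xy]]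
      by simp
  qed

  \<comment> \<open>Assembly over the product category\<close>
  let ?K = "prod_cat (poset_cat I) J" and ?H = "diagram_hat D"
  define G where "G x = fob A (snd x)\<lparr>carrier := B (\<sigma> (fst x)) (snd x)\<rparr>" for x
  have GC: "carrier (G x) = B (\<sigma> (fst x)) (snd x)" for x by (simp add: G_def)
  have GA: "a \<in> carrier (fob A (snd x))" if x: "x \<in> Ob ?K" and a: "a \<in> carrier (G x)" for x a
    using BA[OF \<sigma>E, of "fst x" "snd x"] x a unfolding GC Ob_prod_poset by blast
  have Hob: "fob ?H x = fob (fob D (snd x)) (fst x)" for x by (simp add: diagram_hat_def split_beta)
  have Hmor: "fmor ?H x y f d = fmor D (snd x) (snd y) (snd f) (fst y) (fmor (fob D (snd x)) (fst x) (fst y) () d)"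
    if "d \<in> carrier (fob ?H x)" for x y f d
    using that unfolding Hob by (simp add: diagram_hat_def split_beta compose_def)
  \<comment> \<open>Member of \<open>V\<close>, surjection and distance are chosen together as one
    triple, because they have to fit each other.\<close>
  have "\<forall>x\<in>Ob ?K. \<exists>z. fst z \<in> V \<and>
      presents \<Sigma> (G x) (fob ?H x) (\<delta> (\<sigma> (fst x)) (snd x)) (fst z) (fst (snd z)) (snd (snd z))"
  proof
    fix x assume "x \<in> Ob ?K"
    then have x: "fst x \<in> carrier I" "snd x \<in> Ob J" by (simp_all add: Ob_prod_poset)
    obtain Q p \<delta>' where "Q \<in> V"
      "presents \<Sigma> (G x) (?L (\<sigma> (fst x)) (snd x)) (\<delta> (\<sigma> (fst x)) (snd x)) Q p \<delta>'"
      using B_pres[OF \<sigma>E[OF x(1)] x(2)] unfolding G_def by blast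
    then show "\<exists>z. fst z \<in> V \<and>
        presents \<Sigma> (G x) (fob ?H x) (\<delta> (\<sigma> (fst x)) (snd x)) (fst z) (fst (snd z)) (snd (snd z))"
      using \<sigma>_norm x(1) by (intro exI[of _ "(Q, p, \<delta>')"]) (simp add: Hob)
  qed
  from bchoice[OF this] obtain z where z: "\<forall>x\<in>Ob ?K. fst (z x) \<in> V \<and>
      presents \<Sigma> (G x) (fob ?H x) (\<delta> (\<sigma> (fst x)) (snd x)) (fst (z x)) (fst (snd (z x))) (snd (snd (z x)))" ..
  show ?thesis
  proof (rule lifting_of_presentations[where G = G and Q = "\<lambda>x. fst (z x)" and p = "\<lambda>x. fst (snd (z x))"
        and \<delta>' = "\<lambda>x. snd (snd (z x))" and \<delta> = "\<lambda>x. \<delta> (\<sigma> (fst x)) (snd x)"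
        and g = "\<lambda>x y f. fmor A (snd x) (snd y) (snd f)"])
    show "category ?K" by (intro category_prod_cat category_poset_cat assms(4,10))
    show "fst (z x) \<in> V" if "x \<in> Ob ?K" for x using z that by blast
    show "presents \<Sigma> (G x) (fob ?H x) (\<delta> (\<sigma> (fst x)) (snd x)) (fst (z x)) (fst (snd (z x))) (snd (snd (z x)))"
      if "x \<in> Ob ?K" for x using z that by blast
    show "algebra_on \<Sigma> (G x)" if "x \<in> Ob ?K" for x
      using that unfolding G_def Ob_prod_poset by (intro B_alg \<sigma>E) simp_all
  next
    fix x y f assume "x \<in> Ob ?K" "y \<in> Ob ?K" "f \<in> Hom ?K x y"
    then have i: "fst x \<in> carrier I" "fst y \<in> carrier I" "fst x \<sqsubseteq>\<^bsub>I\<^esub> fst y"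
      and j: "snd x \<in> Ob J" "snd y \<in> Ob J" "snd f \<in> Hom J (snd x) (snd y)"
      by (simp_all add: Ob_prod_poset Hom_prod_poset)
    note ux = \<sigma>E[OF i(1)] and uy = \<sigma>E[OF i(2)]
    \<comment> \<open>Along the morphism of \<open>J\<close> at the fixed ideal
      \<open>\<sigma> (fst x)\<close>, then by monotonicity to the larger ideal
      \<open>\<sigma> (fst y)\<close>.\<close>
    have step: "fmor A (snd x) (snd y) (snd f) a \<in> B (\<sigma> (fst y)) (snd y)" if "a \<in> B (\<sigma> (fst x)) (snd x)" for a
      using B_mor[OF ux j that] B_mono[OF ux uy \<sigma>_mono[OF i] j(2)] by blast
    show "alg_hom \<Sigma> (G x) (G y) (fmor A (snd x) (snd y) (snd f))"
      using A_hom[OF j] BA[OF ux j(1)] step unfolding alg_hom_def G_def by (auto simp: subset_iff)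
    have proj1: "sl_hom (fob ?H x) (fob (fob D (snd x)) (fst y)) (fmor (fob D (snd x)) (fst x) (fst y) ())"
      unfolding Hob by (rule condensate.D_hom[OF cond[OF j(1)] i])
    have proj2: "sl_hom (fob (fob D (snd x)) (fst y)) (fob ?H y) (fmor D (snd x) (snd y) (snd f) (fst y))"
      unfolding Hob by (rule D_mor[OF j i(2)])
    \<comment> \<open>\<open>Hmor\<close> evaluates the transition map on the carrier only, so joins
      and zero must be known to lie there.\<close>
    interpret Hx: semilattice0 "fob ?H x"
      by standard (unfold Hob, rule condensate.D_semilattice[OF cond[OF j(1)] i(1)])
    show "sl_hom (fob ?H x) (fob ?H y) (fmor ?H x y f)"
      using proj1 proj2 by (auto simp: sl_hom_def Hmor Pi_iff)
    fix a b assume ab: "a \<in> carrier (G x)" "b \<in> carrier (G x)"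
    then have abB: "a \<in> B (\<sigma> (fst x)) (snd x)" "b \<in> B (\<sigma> (fst x)) (snd x)" by (simp_all add: GC)
    then have abA: "a \<in> carrier (fob A (snd x))" "b \<in> carrier (fob A (snd x))" using BA[OF ux j(1)] by auto
    have "\<delta> (\<sigma> (fst x)) (snd x) a b \<in> carrier (fob ?H x)"
      using representsD(1)[OF rep(2)[OF ux j(1)] abA] \<sigma>_norm i(1) by (simp add: Hob)
    \<comment> \<open>Naturality in \<open>J\<close> is used at the larger ideal
      \<open>\<sigma> (fst y)\<close>, followed by the change of ideal for the index
      \<open>snd x\<close>; this matches the order of composition in
      \<open>diagram_hat\<close>.\<close>
    then show "\<delta> (\<sigma> (fst y)) (snd y) (fmor A (snd x) (snd y) (snd f) a) (fmor A (snd x) (snd y) (snd f) b) =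
        fmor ?H x y f (\<delta> (\<sigma> (fst x)) (snd x) a b)"
      using \<delta>_nat[OF uy j abA] \<delta>_change[OF i j(1) abB] \<sigma>_norm i(2) by (simp add: Hmor)
  next
    fix x a assume x: "x \<in> Ob ?K" "a \<in> carrier (G x)"
    have "snd (Idm ?K x) = Idm J (snd x)" by (simp add: prod_cat_def split_beta)
    then show "fmor A (snd x) (snd x) (snd (Idm ?K x)) a = a"
      using A_id[OF _ GA[OF x]] x(1) by (simp add: Ob_prod_poset)
  next
    fix x y w f k a assume "x \<in> Ob ?K" "y \<in> Ob ?K" "w \<in> Ob ?K" "f \<in> Hom ?K x y" "k \<in> Hom ?K y w" "a \<in> carrier (G x)"
    then have "snd x \<in> Ob J" "snd y \<in> Ob J" "snd w \<in> Ob J" "snd f \<in> Hom J (snd x) (snd y)"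
      "snd k \<in> Hom J (snd y) (snd w)" "a \<in> carrier (fob A (snd x))"
      using GA by (simp_all add: Ob_prod_poset Hom_prod_poset)
    from A_comp[OF this]
    show "fmor A (snd x) (snd w) (snd (Cmp ?K x y w k f)) a =
        fmor A (snd y) (snd w) (snd k) (fmor A (snd x) (snd y) (snd f) a)"
      by (simp add: prod_cat_def split_beta)
  qed
qed

end
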